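(* For every $\xi_0\in W^{1,\infty}(\mathbb S^1;\mathbb R^d)$ with $|\partial_s\xi_0(s)|\le1$ for a.e. $s\in\mathbb S^1$, there exists a global in time generalized solution $(\xi,\sigma)$ to the normalized uniformly compressing curve-shortening flow with initial datum $\xi_0$, and moreover $\sigma(t,s)\ge0$ for almost every $(t,s)\in Q_\infty$.
   Context: $\mathbb S^1=\mathbb R/\mathbb Z$, $d\ge2$, $Q_\infty=(0,\infty)\times\mathbb S^1$. Given $\xi_0$ as in the claim, a pair $(\xi,\sigma)$ is a generalized solution if: (i) $\xi\in L^\infty_{loc}([0,\infty);W^{1,\infty}(\mathbb S^1))^d$, $\partial_t\xi\in L^2_{loc}([0,\infty);L^2(\mathbb S^1))^d$, $\sigma\in L^2_{loc}([0,\infty);H^1(\mathbb S^1))$ and $\sigma\partial_s\xi\in L^2_{loc}([0,\infty);H^1(\mathbb S^1))^d$; (ii) for a.e. $(t,s)\in Q_\infty$: $\partial_t\xi=\partial_s(\sigma\partial_s\xi)+\xi$, $\sigma(|\partial_s\xi|^2-1)=0$, $|\partial_s\xi|\le1$, and $\xi(0,s)=\xi_0(s)$ for a.e. $s$; (iii) for a.e. $t\in(0,\infty)$, $\int_{\mathbb S^1}|\partial_t\xi(t,s)|^2ds\le\int_{\mathbb S^1}\xi(t,s)\cdot\partial_t\xi(t,s)\,ds$. *)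

theory Defs
  imports "HOL-Analysis.Analysis"
begin

text \<open>The circle S^1 = R/Z is represented by 1-periodic functions on the reals;
  integrals over S^1 are integrals over [0,1] w.r.t. Lebesgue measure.
  Space-time functions are curried: f t s, with t the time and s in S^1.\<close>

definition periodic1 :: "(real \<Rightarrow> 'a) \<Rightarrow> bool" where
  "periodic1 f \<longleftrightarrow> (\<forall>s. f (s + 1) = f s)"

definition test_S1 :: "(real \<Rightarrow> real) \<Rightarrow> (real \<Rightarrow> real) \<Rightarrow> bool" where
  "test_S1 \<phi> \<phi>' \<longleftrightarrow> periodic1 \<phi> \<and> (\<forall>s. (\<phi> has_real_derivative \<phi>' s) (at s))
     \<and> continuous_on UNIV \<phi>'"

definition weak_deriv_S1 :: "(real \<Rightarrow> 'a::euclidean_space) \<Rightarrow> (real \<Rightarrow> 'a) \<Rightarrow> bool" where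
  "weak_deriv_S1 f g \<longleftrightarrow>
     set_integrable lebesgue {0..1} f \<and> set_integrable lebesgue {0..1} g \<and>
     (\<forall>\<phi> \<phi>'. test_S1 \<phi> \<phi>' \<longrightarrow>
        (LINT s:{0..1}|lebesgue. \<phi>' s *\<^sub>R f s) = - (LINT s:{0..1}|lebesgue. \<phi> s *\<^sub>R g s))"

definition ess_bounded_S1 :: "(real \<Rightarrow> 'a::real_normed_vector) \<Rightarrow> real \<Rightarrow> bool" where
  "ess_bounded_S1 f C \<longleftrightarrow> (AE s in lebesgue. s \<in> {0..1} \<longrightarrow> norm (f s) \<le> C)"

definition W1inf_S1 :: "(real \<Rightarrow> 'a::euclidean_space) \<Rightarrow> bool" where
  "W1inf_S1 f \<longleftrightarrow> periodic1 f \<and>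
     (\<exists>g C. weak_deriv_S1 f g \<and> ess_bounded_S1 f C \<and> ess_bounded_S1 g C)"

definition test_Q :: "(real \<times> real \<Rightarrow> real) \<Rightarrow> (real \<times> real \<Rightarrow> real) \<Rightarrow> (real \<times> real \<Rightarrow> real) \<Rightarrow> bool" where
  "test_Q \<phi> \<phi>t \<phi>s \<longleftrightarrow>
     (\<forall>p. (\<phi> has_derivative (\<lambda>h. fst h * \<phi>t p + snd h * \<phi>s p)) (at p)) \<and>
     continuous_on UNIV \<phi>t \<and> continuous_on UNIV \<phi>s \<and>
     (\<forall>t s. \<phi> (t, s + 1) = \<phi> (t, s)) \<and>
     (\<exists>a b. 0 < a \<and> a < b \<and> (\<forall>t s. t < a \<or> b < t \<longrightarrow> \<phi> (t, s) = 0))"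

definition L2loc_L2 :: "(real \<Rightarrow> real \<Rightarrow> 'a::euclidean_space) \<Rightarrow> bool" where
  "L2loc_L2 F \<longleftrightarrow> (\<lambda>p. F (fst p) (snd p)) \<in> borel_measurable lebesgue \<and>
     (\<forall>T>0. set_integrable lebesgue ({0<..<T} \<times> {0..1}) (\<lambda>p. (norm (F (fst p) (snd p)))\<^sup>2))"

definition L2loc_H1 :: "(real \<Rightarrow> real \<Rightarrow> 'a::euclidean_space) \<Rightarrow> (real \<Rightarrow> real \<Rightarrow> 'a) \<Rightarrow> bool" where
  "L2loc_H1 F G \<longleftrightarrow> L2loc_L2 F \<and> L2loc_L2 G \<and>
     (AE t in lebesgue. 0 < t \<longrightarrow> weak_deriv_S1 (F t) (G t))"

definition gen_solution ::
  "(real \<Rightarrow> real ^ 'd) \<Rightarrow> (real \<Rightarrow> real \<Rightarrow> real ^ 'd) \<Rightarrow> (real \<Rightarrow> real \<Rightarrow> real) \<Rightarrow> bool" where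
  "gen_solution \<xi>0 \<xi> \<sigma> \<longleftrightarrow>
   (\<forall>t. periodic1 (\<xi> t)) \<and> (\<forall>t. periodic1 (\<sigma> t)) \<and>
   (\<exists>xs xt sigs w.
     \<comment> \<open>(i) xi \<in> L^\<infinity>_loc([0,\<infinity>); W^{1,\<infinity>}(S^1))\<close>
     (\<lambda>p. \<xi> (fst p) (snd p)) \<in> borel_measurable lebesgue \<and>
     (\<lambda>p. xs (fst p) (snd p)) \<in> borel_measurable lebesgue \<and>
     (AE t in lebesgue. 0 < t \<longrightarrow> weak_deriv_S1 (\<xi> t) (xs t)) \<and>
     (\<forall>T>0. \<exists>C. AE p in lebesgue. p \<in> {0<..<T} \<times> {0..1} \<longrightarrow>
          norm (\<xi> (fst p) (snd p)) \<le> C \<and> norm (xs (fst p) (snd p)) \<le> C) \<and>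
     \<comment> \<open>(i) d_t xi \<in> L^2_loc([0,\<infinity>); L^2(S^1)), distributional time derivative on Q_\<infinity>\<close>
     L2loc_L2 xt \<and>
     (\<forall>\<phi> \<phi>t \<phi>s. test_Q \<phi> \<phi>t \<phi>s \<longrightarrow>
        (LINT p:({0<..} \<times> {0..1})|lebesgue. \<phi>t p *\<^sub>R \<xi> (fst p) (snd p)) =
        - (LINT p:({0<..} \<times> {0..1})|lebesgue. \<phi> p *\<^sub>R xt (fst p) (snd p))) \<and>
     \<comment> \<open>(i) sigma \<in> L^2_loc([0,\<infinity>); H^1(S^1)), sigma d_s xi \<in> L^2_loc([0,\<infinity>); H^1(S^1))\<close>
     L2loc_H1 \<sigma> sigs \<and>
     L2loc_H1 (\<lambda>t s. \<sigma> t s *\<^sub>R xs t s) w \<and>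
     \<comment> \<open>(ii) equations a.e. in Q_\<infinity>\<close>
     (AE p in lebesgue. p \<in> {0<..} \<times> {0..1} \<longrightarrow>
        xt (fst p) (snd p) = w (fst p) (snd p) + \<xi> (fst p) (snd p) \<and>
        \<sigma> (fst p) (snd p) * ((norm (xs (fst p) (snd p)))\<^sup>2 - 1) = 0 \<and>
        norm (xs (fst p) (snd p)) \<le> 1) \<and>
     \<comment> \<open>(ii) initial datum, attained in the L^2(S^1) sense\<close>
     (AE s in lebesgue. s \<in> {0..1} \<longrightarrow> \<xi> 0 s = \<xi>0 s) \<and>
     ((\<lambda>t. LINT s:{0..1}|lebesgue. (norm (\<xi> t s - \<xi> 0 s))\<^sup>2) \<longlongrightarrow> 0) (at_right 0) \<and>
     \<comment> \<open>(iii) energy inequality\<close>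
     (AE t in lebesgue. 0 < t \<longrightarrow>
        (LINT s:{0..1}|lebesgue. (norm (xt t s))\<^sup>2) \<le> (LINT s:{0..1}|lebesgue. \<xi> t s \<bullet> xt t s)))"

end

(* The flow is the L2 gradient flow of the functional -|x|^2/2 on the convex set K of 1-Lipschitz closed
   curves: x' = x - f with f in the normal cone of K at x. The projected Euler scheme
   x_{k+1} = P_K((1 + h) x_k) with h = 2^-n is Cauchy under halving of the step, and its limit is
   Lipschitz in time and inherits a local evolution variational inequality and an energy estimate.
   The derivatives in t and s are L2 limits of dyadic difference quotients, which form martingales.
   Dividing the two inequalities by the time step shows, for almost every t, that f = x - x' lies in the
   normal cone and that |x'|^2 <= <x, x'>.
   In one space dimension a normal vector has the form f = -kappa' and, after subtracting the geometric
   median c of kappa, kappa - c = sigma x_s with sigma = |kappa - c| >= 0, which is the Lagrange multiplier. *)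

theory Submission
  imports Defs
begin

section \<open>Gradient flows of concave quadratics on convex sets\<close>

text \<open>All curves live in the space of continuous closed curves with the L2 product. It is not
  complete, but the constraint set is, since a common Lipschitz bound turns L2 convergence into
  uniform convergence; so no passage to classes modulo null sets is needed. Velocities are only
  square integrable and leave this space, so they enter through integrals. The time derivative is
  needed in two ways at once: for almost every s as a derivative in t (distributional equation), and
  for almost every t as an L2 limit in s (variational inequality). A martingale limit on the product
  space, along a subsequence with summable errors, gives both, together with joint measurability.
  The multiplier has no pointwise formula: where it vanishes, x_s may have any length at most 1. It
  comes from duality: among mean-zero fields w of length at most 1 the integral of kappa . w is
  largest for w = x_s, and the dual problem is to minimise the mean of |kappa - c| over c.
  Minimisers need not be unique, whence the measurable selection.\<close>

lemma projection_exists: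
  fixes K :: "'a::real_inner set"
  assumes "convex K" "complete K" "K \<noteq> {}"
  shows "\<exists>p\<in>K. \<forall>z\<in>K. (y - p) \<bullet> (z - p) \<le> 0"
proof -
  define D where "D = (INF z\<in>K. (norm (y - z))\<^sup>2)"
  have bdd: "bdd_below ((\<lambda>z. (norm (y - z))\<^sup>2) ` K)"
    by (rule bdd_belowI2[where m=0]) simp
  have D_le: "D \<le> (norm (y - z))\<^sup>2" if "z \<in> K" for z
    unfolding D_def by (rule cINF_lower[OF bdd that])
  have "\<exists>z\<in>K. (norm (y - z))\<^sup>2 < D + 1 / Suc n" for n
  proof -
    have "D < D + 1 / Suc n" by simp
    then show ?thesis
      unfolding D_def using assms(3) bdd by (subst (asm) cINF_less_iff) auto
  qed
  then obtain z where zK: "\<And>n. z n \<in> K" and zD: "\<And>n. (norm (y - z n))\<^sup>2 < D + 1 / Suc n"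
    by metis
  \<comment> \<open>The midpoint lies in \<open>K\<close>, so the parallelogram identity bounds the
    distance between two almost minimal points. The limit is then taken inside \<open>K\<close>,
    which is the only set assumed complete.\<close>
  have para: "(norm (z m - z n))\<^sup>2 \<le> 2 / Suc m + 2 / Suc n" for m n
  proof -
    define w where "w = (1/2) *\<^sub>R z m + (1/2) *\<^sub>R z n"
    have "w \<in> K" unfolding w_def
      by (rule convexD[OF assms(1) zK zK]) auto
    then have "D \<le> (norm (y - w))\<^sup>2" by (rule D_le)
    moreover have "(norm (z m - z n))\<^sup>2 = 2 * (norm (y - z m))\<^sup>2 + 2 * (norm (y - z n))\<^sup>2 - 4 * (norm (y - w))\<^sup>2"
      unfolding w_def power2_norm_eq_inner
      by (simp add: inner_diff_left inner_diff_right inner_add_left inner_add_right inner_commute algebra_simps)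
    ultimately show ?thesis using zD[of m] zD[of n] by simp
  qed
  have "Cauchy z"
  proof (rule metric_CauchyI)
    fix e :: real assume "e > 0"
    then have "0 < e\<^sup>2 / 4" by simp
    then obtain N where "1 / real (Suc N) < e\<^sup>2 / 4" using nat_approx_posE by metis
    then have N: "4 / real (Suc N) < e\<^sup>2" by simp
    show "\<exists>M. \<forall>m\<ge>M. \<forall>n\<ge>M. dist (z m) (z n) < e"
    proof (intro exI allI impI)
      fix m n assume "m \<ge> N" "n \<ge> N"
      then have "2 / Suc m \<le> 2 / Suc N" "2 / Suc n \<le> 2 / Suc N"
        by (auto simp: frac_le)
      then have "(norm (z m - z n))\<^sup>2 < e\<^sup>2" using para[of m n] N by simp
      then show "dist (z m) (z n) < e"
        using \<open>e > 0\<close> by (simp add: dist_norm power_less_imp_less_base)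
    qed
  qed
  then obtain p where p: "p \<in> K" "z \<longlonglongrightarrow> p"
    using assms(2) zK unfolding complete_def by metis
  have "(\<lambda>n. (norm (y - z n))\<^sup>2) \<longlonglongrightarrow> (norm (y - p))\<^sup>2"
    by (intro tendsto_intros p)
  moreover have "(\<lambda>n. D + 1 / Suc n) \<longlonglongrightarrow> D + 0"
    using LIMSEQ_inverse_real_of_nat_add[of D] by (simp add: inverse_eq_divide)
  ultimately have pD: "(norm (y - p))\<^sup>2 \<le> D"
    using LIMSEQ_le[of "\<lambda>n. (norm (y - z n))\<^sup>2" _ "\<lambda>n. D + 1 / Suc n" "D+0"] zD
    by (metis add.right_neutral less_imp_le)
  have "(y - p) \<bullet> (w - p) \<le> 0" if "w \<in> K" for w
  proof (rule ccontr)
    assume "\<not> ?thesis"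
    then have pos: "(y - p) \<bullet> (w - p) > 0" by simp
    define a where "a = (y - p) \<bullet> (w - p)"
    define b where "b = (norm (w - p))\<^sup>2"
    have le: "2 * t * a \<le> t\<^sup>2 * b" if "0 < t" "t \<le> 1" for t
    proof -
      have "(1 - t) *\<^sub>R p + t *\<^sub>R w \<in> K"
        by (rule convexD[OF assms(1) p(1) \<open>w \<in> K\<close>]) (use that in auto)
      from D_le[OF this] pD have "(norm (y - p))\<^sup>2 \<le> (norm (y - ((1 - t) *\<^sub>R p + t *\<^sub>R w)))\<^sup>2"
        by linarith
      also have "y - ((1 - t) *\<^sub>R p + t *\<^sub>R w) = (y - p) - t *\<^sub>R (w - p)"
        by (simp add: algebra_simps)
      also have "(norm ((y - p) - t *\<^sub>R (w - p)))\<^sup>2 = (norm (y - p))\<^sup>2 - 2 * t * a + t\<^sup>2 * b"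
        unfolding power2_norm_eq_inner a_def b_def
        by (simp add: inner_diff_left inner_diff_right inner_commute algebra_simps power2_eq_square)
      finally show ?thesis by simp
    qed
    have b0: "b \<ge> 0" by (simp add: b_def)
    \<comment> \<open>Small enough for \<open>t * b\<close> to stay below \<open>a\<close>, against
      the lower bound \<open>2 * a\<close>; the denominator \<open>b + 1\<close> also covers
      \<open>b = 0\<close>.\<close>
    define t where "t = min 1 (a / (b + 1))"
    have t: "0 < t" "t \<le> 1" "t \<le> a / (b+1)" using pos b0 by (auto simp: t_def a_def)
    have "2 * a \<le> t * b" using le[OF t(1,2)] t(1) by (simp add: power2_eq_square)
    also have "\<dots> \<le> a / (b+1) * (b + 1)" using t b0 pos by (intro mult_mono) (auto simp: a_def)
    also have "\<dots> = a" using b0 by simp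
    finally show False using pos by (simp add: a_def)
  qed
  then show ?thesis using p by blast
qed

section \<open>The projected Euler scheme and its continuous limit\<close>

locale constrained_flow =
  fixes K :: "'a::real_inner set" and x0 :: 'a
  assumes convex: "convex K" and complete: "complete K"
    and zero_in: "0 \<in> K" and x0_in: "x0 \<in> K"
begin

definition P where "P y = (SOME p. p \<in> K \<and> (\<forall>z\<in>K. (y - p) \<bullet> (z - p) \<le> 0))"

lemma P: "P y \<in> K" "z \<in> K \<Longrightarrow> (y - P y) \<bullet> (z - P y) \<le> 0"
proof -
  have "\<exists>p. p \<in> K \<and> (\<forall>z\<in>K. (y - p) \<bullet> (z - p) \<le> 0)"
    using projection_exists[OF convex complete, of y] zero_in by blast
  from someI_ex[OF this] show "P y \<in> K" "z \<in> K \<Longrightarrow> (y - P y) \<bullet> (z - P y) \<le> 0"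
    unfolding P_def by blast+
qed

primrec X :: "real \<Rightarrow> nat \<Rightarrow> 'a" where
  "X h 0 = x0"
| "X h (Suc k) = P ((1 + h) *\<^sub>R X h k)"

lemma X_in: "X h k \<in> K"
  by (cases k) (auto simp: x0_in P)

lemma X_VI: "z \<in> K \<Longrightarrow> ((1 + h) *\<^sub>R X h k - X h (Suc k)) \<bullet> (z - X h (Suc k)) \<le> 0"
  using P(2) by simp

text \<open>The previous iterate lies in \<open>K\<close>, so it is an admissible competitor in
  \<open>X_VI\<close>. This is the discrete form of |x'|^2 <= <x, x'>.\<close>

lemma X_step_sq: "(norm (X h (Suc k) - X h k))\<^sup>2 \<le> h * (X h k \<bullet> (X h (Suc k) - X h k))"
  using X_VI[OF X_in[of h k], of h k] unfolding power2_norm_eq_inner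
  by (simp add: algebra_simps inner_commute del: X.simps)

lemma X_step: assumes "h \<ge> 0" shows "norm (X h (Suc k) - X h k) \<le> h * norm (X h k)"
proof (cases "norm (X h (Suc k) - X h k) = 0")
  case False
  have "(norm (X h (Suc k) - X h k))\<^sup>2 \<le> h * (norm (X h k) * norm (X h (Suc k) - X h k))"
    using X_step_sq[of h k] mult_left_mono[OF norm_cauchy_schwarz assms] order_trans by blast
  then show ?thesis using False
    by (simp add: power2_eq_square mult.assoc[symmetric] del: X.simps)
next
  case True
  then show ?thesis using assms by (simp del: X.simps)
qed

lemma X_norm: assumes "h \<ge> 0" shows "norm (X h k) \<le> exp (h * k) * norm x0"
proof (induction k)
  case (Suc k)
  have "norm (X h (Suc k)) \<le> norm (X h k) + norm (X h (Suc k) - X h k)"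
    by (rule norm_triangle_sub)
  also have "\<dots> \<le> (1 + h) * norm (X h k)" using X_step[OF assms, of k] by (simp add: algebra_simps del: X.simps)
  also have "\<dots> \<le> exp h * (exp (h * k) * norm x0)"
    using assms Suc by (intro mult_mono) auto
  also have "\<dots> = exp (h * Suc k) * norm x0" by (simp add: exp_add[symmetric] algebra_simps)
  finally show ?case .
qed simp

lemma X_norm': assumes "h \<ge> 0" "h * real k \<le> T" shows "norm (X h k) \<le> exp T * norm x0"
  using X_norm[OF assms(1), of k] assms(2)
  by (meson exp_le_cancel_iff mult_right_mono norm_ge_zero order_trans)

lemma X_lip: assumes "h \<ge> 0" "k \<le> l" "h * real l \<le> T"
  shows "norm (X h l - X h k) \<le> h * (real l - real k) * (exp T * norm x0)"
  using assms(2,3)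
proof (induction l rule: dec_induct)
  case (step l)
  have hl: "h * real l \<le> T" using step.prems assms(1) by (simp add: distrib_left)
  have "norm (X h (Suc l) - X h k) \<le> norm (X h (Suc l) - X h l) + norm (X h l - X h k)"
    using norm_triangle_ineq[of "X h (Suc l) - X h l" "X h l - X h k"] by (simp del: X.simps)
  also have "\<dots> \<le> h * (exp T * norm x0) + h * (real l - real k) * (exp T * norm x0)"
    using X_step[OF assms(1), of l] X_norm'[OF assms(1) hl] step.IH[OF hl] assms(1)
    by (meson add_mono mult_left_mono order_trans)
  finally show ?case by (simp add: algebra_simps del: X.simps)
qed simp

text \<open>Discrete form of (d/dt) |x - z|^2 <= 2 <x - z, x>, with the right-hand side frozen at
  the left end of the time interval. Freezing costs an error quadratic in the elapsed time, whose
  constant does not depend on the step, so the estimate survives the limit h -> 0 and the error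
  disappears after division by the elapsed time.\<close>

lemma X_EVI: assumes "h \<ge> 0" "k \<le> l" "h * real l \<le> T" "z \<in> K"
  defines "R \<equiv> exp T * norm x0" and "\<tau> \<equiv> h * (real l - real k)"
  shows "(norm (X h l - z))\<^sup>2 - (norm (X h k - z))\<^sup>2
    \<le> 2 * \<tau> * ((X h k - z) \<bullet> X h k) + 2 * \<tau> * \<tau> * (R * (2 * R + norm z))"
proof -
  have R0: "R \<ge> 0" by (simp add: R_def)
  have hk: "h * real i \<le> T" if "i \<le> l" for i
    using that assms(1,3) by (meson mult_left_mono of_nat_mono order_trans)
  define A where "A = (X h k - z) \<bullet> X h k + \<tau> * (R * (2 * R + norm z))"
  have main: "(norm (X h i - z))\<^sup>2 - (norm (X h k - z))\<^sup>2 \<le> 2 * (h * (real i - real k)) * A"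
    if "k \<le> i" "i \<le> l" for i
    using that
  proof (induction i rule: dec_induct)
    case (step i)
    have il: "i \<le> l" "Suc i \<le> l" using step by auto
    let ?q = "X h (Suc i)" and ?p = "X h i"
    have tau: "h * (real (Suc i) - real k) \<le> \<tau>" "h * (real i - real k) \<le> \<tau>" "0 \<le> \<tau>"
      unfolding \<tau>_def using il assms(1,2) by (auto intro!: mult_left_mono)
    have n: "norm ?p \<le> R" "norm ?q \<le> R" "norm (X h k) \<le> R"
      unfolding R_def using X_norm'[OF assms(1) hk] il assms(2) by blast+
    have d1: "norm (?q - X h k) \<le> \<tau> * R"
      using X_lip[OF assms(1) _ hk[OF il(2)], of k] step.hyps tau(1) R0 unfolding R_def[symmetric]
      by (meson le_SucI mult_right_mono order_trans)
    have d2: "norm (?p - X h k) \<le> \<tau> * R"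
      using X_lip[OF assms(1) _ hk[OF il(1)], of k] step.hyps tau(2) R0 unfolding R_def[symmetric]
      by (meson mult_right_mono order_trans)
    have "(?q - z) \<bullet> ?p = (X h k - z) \<bullet> X h k + (?q - X h k) \<bullet> ?p + (X h k - z) \<bullet> (?p - X h k)"
      by (simp add: algebra_simps del: X.simps)
    also have "\<dots> \<le> (X h k - z) \<bullet> X h k + (\<tau> * R) * R + (R + norm z) * (\<tau> * R)"
    proof -
      have "(?q - X h k) \<bullet> ?p \<le> norm (?q - X h k) * norm ?p" by (rule norm_cauchy_schwarz)
      also have "\<dots> \<le> (\<tau> * R) * R" using d1 n R0 tau by (intro mult_mono) auto
      finally have 1: "(?q - X h k) \<bullet> ?p \<le> (\<tau> * R) * R" .
      have "(X h k - z) \<bullet> (?p - X h k) \<le> norm (X h k - z) * norm (?p - X h k)" by (rule norm_cauchy_schwarz)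
      also have "\<dots> \<le> (R + norm z) * (\<tau> * R)"
        using d2 n R0 tau norm_triangle_ineq4[of "X h k" z] by (intro mult_mono) auto
      finally show ?thesis using 1 by simp
    qed
    also have "\<dots> = A" by (simp add: A_def algebra_simps)
    finally have le: "(?q - z) \<bullet> ?p \<le> A" .
    have "(norm (?q - z))\<^sup>2 - (norm (?p - z))\<^sup>2 = 2 * ((?q - z) \<bullet> (?q - ?p)) - (norm (?q - ?p))\<^sup>2"
      unfolding power2_norm_eq_inner by (simp add: algebra_simps inner_commute del: X.simps)
    also have "\<dots> \<le> 2 * ((?q - z) \<bullet> (?q - ?p))" by simp
    also have "\<dots> \<le> 2 * (h * ((?q - z) \<bullet> ?p))"
      using X_VI[OF assms(4), of h i] by (simp add: algebra_simps inner_commute del: X.simps)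
    also have "\<dots> \<le> 2 * h * A" using le assms(1) mult_left_mono by (simp del: X.simps)
    finally show ?case using step by (simp add: algebra_simps del: X.simps)
  qed simp
  show ?thesis using main[OF assms(2) order_refl] unfolding A_def \<tau>_def
    by (simp add: algebra_simps)
qed

text \<open>By polarisation \<open>X_step_sq\<close> bounds each squared step by h/2 times the
  increment of |x|^2. These increments telescope, and Cauchy-Schwarz over the l - k steps bounds the
  squared total displacement. The factor 1/2 is what later yields |x'|^2 <= <x, x'> with constant
  1.\<close>

lemma X_energy: assumes "h \<ge> 0" "k \<le> l"
  shows "(norm (X h l - X h k))\<^sup>2 \<le> h * (real l - real k) * ((norm (X h l))\<^sup>2 - (norm (X h k))\<^sup>2) / 2"
proof -
  have a: "(\<Sum>i=k..<l. (norm (X h (Suc i) - X h i))\<^sup>2) \<le> h * ((norm (X h l))\<^sup>2 - (norm (X h k))\<^sup>2) / 2"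
    using assms(2)
  proof (induction l rule: dec_induct)
    case (step i)
    let ?q = "X h (Suc i)" and ?p = "X h i"
    have "?p \<bullet> (?q - ?p) = ((norm ?q)\<^sup>2 - (norm ?p)\<^sup>2 - (norm (?q - ?p))\<^sup>2) / 2"
      unfolding power2_norm_eq_inner by (simp add: algebra_simps inner_commute del: X.simps)
    also have "\<dots> \<le> ((norm ?q)\<^sup>2 - (norm ?p)\<^sup>2) / 2" by simp
    finally have "(norm (?q - ?p))\<^sup>2 \<le> h * (((norm ?q)\<^sup>2 - (norm ?p)\<^sup>2) / 2)"
      using X_step_sq[of h i] assms(1) mult_left_mono order_trans by blast
    then show ?case using step by (simp add: algebra_simps del: X.simps)
  qed simp
  have "norm (X h l - X h k) = norm (\<Sum>i=k..<l. X h (Suc i) - X h i)"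
    using assms(2) by (simp add: sum_Suc_diff' del: X.simps)
  also have "\<dots> \<le> (\<Sum>i=k..<l. norm (X h (Suc i) - X h i))" by (rule norm_sum)
  finally have "(norm (X h l - X h k))\<^sup>2 \<le> (\<Sum>i=k..<l. norm (X h (Suc i) - X h i))\<^sup>2"
    by (simp add: power_mono del: X.simps)
  also have "\<dots> \<le> real (card {k..<l}) * (\<Sum>i=k..<l. (norm (X h (Suc i) - X h i))\<^sup>2)"
    using sum_squared_le_sum_of_squares[of "\<lambda>i. norm (X h (Suc i) - X h i)" "{k..<l}"] by (simp add: mult.commute)
  also have "\<dots> \<le> (real l - real k) * (h * ((norm (X h l))\<^sup>2 - (norm (X h k))\<^sup>2) / 2)"
    using mult_left_mono[OF a, of "real l - real k"] assms(2) by (simp add: of_nat_diff del: X.simps)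
  finally show ?thesis by (simp add: algebra_simps)
qed

text \<open>One step of size \<open>h\<close> against two steps of size \<open>h / 2\<close>: monotonicity of the normal cone leaves only a
  defect of order \<open>h\<^sup>2\<close>.\<close>

lemma X_halve: assumes "h \<ge> 0" "h * real k \<le> T"
  defines "R \<equiv> exp T * norm x0"
  shows "(norm (X h k - X (h/2) (2*k)))\<^sup>2 \<le> 10 * h * h * real k * R\<^sup>2 * exp (2 * h * k)"
  using assms(2)
proof (induction k)
  case (Suc k)
  have R0: "R \<ge> 0" by (simp add: R_def)
  let ?p = "X h k" and ?q = "X h (Suc k)"
    and ?y = "X (h/2) (2*k)" and ?u = "X (h/2) (Suc (2*k))" and ?v = "X (h/2) (Suc (Suc (2*k)))"
  have h2: "h/2 \<ge> 0" using assms(1) by simp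
  have b: "h * real k \<le> T" "h / 2 * real (2*k) \<le> T" "h / 2 * real (Suc (2*k)) \<le> T" "h / 2 * real (Suc (Suc (2*k))) \<le> T"
    using Suc.prems assms(1) by (auto simp: algebra_simps)
  have n: "norm ?p \<le> R" "norm ?q \<le> R" "norm ?y \<le> R" "norm ?u \<le> R" "norm ?v \<le> R"
    unfolding R_def using X_norm'[OF assms(1) b(1)] X_norm'[OF assms(1) Suc.prems]
      X_norm'[OF h2 b(2)] X_norm'[OF h2 b(3)] X_norm'[OF h2 b(4)] by blast+
  have s: "norm (?q - ?p) \<le> h * R" "norm (?u - ?y) \<le> h/2 * R" "norm (?v - ?u) \<le> h/2 * R"
    using X_step[OF assms(1), of k] X_step[OF h2, of "2*k"] X_step[OF h2, of "Suc (2*k)"] n assms(1)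
    by (meson mult_left_mono order_trans h2)+
  \<comment> \<open>\<open>G\<close> is the normal vector at \<open>?u\<close> produced by the first
    half step, but the error equation tests it against \<open>?q - ?v\<close>. The mismatch
    \<open>G \<bullet> (?u - ?v)\<close> is of order h^2, as both factors are of order h.\<close>
  define G where "G = (1 + h/2) *\<^sub>R ?y - ?u"
  have nG: "norm G \<le> h * R"
  proof -
    have "G = (?y - ?u) + (h/2) *\<^sub>R ?y" by (simp add: G_def algebra_simps del: X.simps)
    then have "norm G \<le> norm (?u - ?y) + (h/2) * norm ?y"
      using norm_triangle_ineq[of "?y - ?u" "(h/2) *\<^sub>R ?y"] assms(1) by (simp add: norm_minus_commute del: X.simps)
    also have "\<dots> \<le> h/2 * R + h/2 * R" using s n h2 by (intro add_mono mult_left_mono) auto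
    finally show ?thesis by (simp add: mult.commute)
  qed
  define e where "e = ?p - ?y"
  define e' where "e' = ?q - ?v"
  have v1: "((1 + h) *\<^sub>R ?p - ?q) \<bullet> (?v - ?q) \<le> 0" by (rule X_VI[OF X_in])
  have v2: "G \<bullet> (?q - ?u) \<le> 0" unfolding G_def by (rule X_VI[OF X_in])
  have v3: "((1 + h/2) *\<^sub>R ?u - ?v) \<bullet> (?q - ?v) \<le> 0" by (rule X_VI[OF X_in])
  \<comment> \<open>An exact identity. The three variational inequalities contribute nonpositive
    terms, \<open>e' \<bullet> e\<close> drives the Gronwall growth, and the remaining two terms are
    of order h^2.\<close>
  have ee: "e' \<bullet> (e' - e) = h * (e' \<bullet> e) + h/2 * (e' \<bullet> (?y - ?u))
     + (((1 + h) *\<^sub>R ?p - ?q) \<bullet> (?v - ?q)) + G \<bullet> (?q - ?u) + G \<bullet> (?u - ?v) + ((1 + h/2) *\<^sub>R ?u - ?v) \<bullet> (?q - ?v)"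
    unfolding e_def e'_def G_def 
    by (simp add: inner_diff_left inner_diff_right inner_add_left inner_add_right del: X.simps) (simp add: field_simps inner_commute del: X.simps)
  have "e' - e = (?q - ?p) - (?v - ?u) - (?u - ?y)" by (simp add: e_def e'_def del: X.simps)
  then have ed: "norm (e' - e) \<le> 2 * h * R"
    using norm_triangle_ineq4[of "?q - ?p" "?v - ?u"] norm_triangle_ineq4[of "(?q - ?p) - (?v - ?u)" "?u - ?y"] s by (simp del: X.simps)
  have ne: "norm e \<le> 2 * R" "norm e' \<le> 2 * R" unfolding e_def e'_def
    using n norm_triangle_ineq4[of ?p ?y] norm_triangle_ineq4[of ?q ?v] by (linarith)+
  have i1: "e' \<bullet> e \<le> (norm e)\<^sup>2 + (2 * h * R) * (2 * R)"
  proof -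
    have "e' \<bullet> e = (norm e)\<^sup>2 + (e' - e) \<bullet> e" by (simp add: power2_norm_eq_inner inner_diff_left)
    also have "(e' - e) \<bullet> e \<le> norm (e' - e) * norm e" by (rule norm_cauchy_schwarz)
    also have "\<dots> \<le> (2 * h * R) * (2 * R)" using ed ne R0 assms(1) by (intro mult_mono) auto
    finally show ?thesis by simp
  qed
  have i2: "e' \<bullet> (?y - ?u) \<le> (2 * R) * (h/2 * R)"
    using norm_cauchy_schwarz[of e' "?y - ?u"] mult_mono[OF ne(2) s(2)] R0
    by (simp add: norm_minus_commute del: X.simps)
  have i3: "G \<bullet> (?u - ?v) \<le> (h * R) * (h/2 * R)"
    using norm_cauchy_schwarz[of G "?u - ?v"] mult_mono[OF nG s(3)] R0 assms(1)
    by (simp add: norm_minus_commute del: X.simps)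
  have "e' \<bullet> (e' - e) \<le> h * ((norm e)\<^sup>2 + (2 * h * R) * (2 * R)) + h/2 * ((2 * R) * (h/2 * R)) + (h * R) * (h/2 * R)"
    unfolding ee using v1 v2 v3 i3 mult_left_mono[OF i1 assms(1)] mult_left_mono[OF i2 h2] by linarith
  \<comment> \<open>The defects add up to 4 + 1/2 + 1/2 = 5 times (h R)^2. Doubled in the expansion
    of the square, they give the 10 of the claim.\<close>
  also have "\<dots> = h * (norm e)\<^sup>2 + 5 * h * h * R\<^sup>2" by (simp add: algebra_simps power2_eq_square)
  finally have est: "e' \<bullet> (e' - e) \<le> h * (norm e)\<^sup>2 + 5 * h * h * R\<^sup>2" .
  have "(norm e')\<^sup>2 = (norm e)\<^sup>2 + 2 * (e' \<bullet> (e' - e)) - (norm (e' - e))\<^sup>2"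
    unfolding power2_norm_eq_inner by (simp add: algebra_simps inner_commute)
  also have "\<dots> \<le> (norm e)\<^sup>2 + 2 * (h * (norm e)\<^sup>2 + 5 * h * h * R\<^sup>2) - 0"
    using est by (intro add_mono diff_mono mult_left_mono) auto
  also have "\<dots> = (1 + 2 * h) * (norm e)\<^sup>2 + 10 * h * h * R\<^sup>2" by (simp add: algebra_simps)
  also have "\<dots> \<le> exp (2 * h) * (10 * h * h * real k * R\<^sup>2 * exp (2 * h * k)) + 10 * h * h * R\<^sup>2 * exp (2 * h * Suc k)"
  proof (rule add_mono[OF mult_mono])
    show "1 + 2 * h \<le> exp (2 * h)" by (rule exp_ge_add_one_self)
    show "(norm e)\<^sup>2 \<le> 10 * h * h * real k * R\<^sup>2 * exp (2 * h * k)"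
      using Suc.IH[OF b(1)] by (simp add: e_def)
    have "10 * h * h * R\<^sup>2 * 1 \<le> 10 * h * h * R\<^sup>2 * exp (2 * h * Suc k)"
      using assms(1) by (intro mult_left_mono) auto
    then show "10 * h * h * R\<^sup>2 \<le> 10 * h * h * R\<^sup>2 * exp (2 * h * Suc k)" by simp
  qed auto
  also have "\<dots> = 10 * h * h * real (Suc k) * R\<^sup>2 * exp (2 * h * Suc k)"
    by (simp add: algebra_simps exp_add)
  finally show ?case by (simp add: e'_def del: X.simps)
qed simp

text \<open>Up to time t there are at most t / h steps, so \<open>X_halve\<close> gives a squared
  error of order h = 2^-n. Consecutive approximations thus differ by a multiple of sqrt (1/2)^n,
  which is summable. All bounds on the scheme are uniform in h and are closed under pointwise limits
  in t.\<close>

lemma flow_exists: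
  "\<exists>x. x 0 = x0 \<and> (\<forall>t\<ge>0. x t \<in> K \<and> norm (x t) \<le> exp t * norm x0)
    \<and> (\<forall>a b. 0 \<le> a \<longrightarrow> a \<le> b \<longrightarrow> norm (x b - x a) \<le> (b - a) * (exp b * norm x0))
    \<and> (\<forall>a b. 0 \<le> a \<longrightarrow> a \<le> b \<longrightarrow> (\<forall>z\<in>K. (norm (x b - z))\<^sup>2 - (norm (x a - z))\<^sup>2
        \<le> 2 * (b - a) * ((x a - z) \<bullet> x a) + 2 * (b - a) * (b - a) * ((exp b * norm x0) * (2 * (exp b * norm x0) + norm z))))
    \<and> (\<forall>a b. 0 \<le> a \<longrightarrow> a \<le> b \<longrightarrow> (norm (x b - x a))\<^sup>2 \<le> (b - a) * ((norm (x b))\<^sup>2 - (norm (x a))\<^sup>2) / 2)"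
proof -
  define h :: "nat \<Rightarrow> real" where "h n = 1 / 2 ^ n" for n
  define j :: "nat \<Rightarrow> real \<Rightarrow> nat" where "j n t = nat \<lfloor>t * 2 ^ n\<rfloor>" for n t
  define y where "y n t = X (h n) (j n t)" for n t
  have h0: "h n \<ge> 0" "h n > 0" for n by (auto simp: h_def)
  have hS: "h (Suc n) = h n / 2" for n by (simp add: h_def)
  have j_le: "h n * j n t \<le> t" if "t \<ge> 0" for n t
  proof -
    have "real (j n t) \<le> t * 2 ^ n" using that by (simp add: j_def)
    then show ?thesis by (simp add: h_def field_simps)
  qed
  have j_ge: "t - h n \<le> h n * j n t" if "t \<ge> 0" for n t
  proof -
    have "t * 2 ^ n - 1 \<le> real (j n t)" using that by (simp add: j_def)
    then have "(t * 2 ^ n - 1) / 2 ^ n \<le> real (j n t) / 2 ^ n" by (rule divide_right_mono) simp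
    then show ?thesis by (simp add: h_def diff_divide_distrib)
  qed
  have j_mono: "j n a \<le> j n b" if "a \<le> b" for n a b
    using that by (auto simp: j_def intro!: nat_mono floor_mono)
  \<comment> \<open>Halving the step doubles the index up to one extra half step, which costs a
    further error of order \<open>h n\<close>.\<close>
  have jS: "j (Suc n) t = 2 * j n t \<or> j (Suc n) t = Suc (2 * j n t)" if "t \<ge> 0" for n t
  proof -
    have "\<lfloor>t * 2 ^ Suc n\<rfloor> = 2 * \<lfloor>t * 2 ^ n\<rfloor> \<or> \<lfloor>t * 2 ^ Suc n\<rfloor> = 2 * \<lfloor>t * 2 ^ n\<rfloor> + 1"
      by (simp add: algebra_simps) linarith
    moreover have "\<lfloor>t * 2 ^ n\<rfloor> \<ge> 0" using that by simp
    ultimately show ?thesis unfolding j_def by (auto simp: nat_mult_distrib nat_add_distrib)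
  qed
  have jh: "(\<lambda>n. h n * j n t) \<longlonglongrightarrow> t" if "t \<ge> 0" for t
  proof (rule tendsto_sandwich[of "\<lambda>n. t - h n" _ _ "\<lambda>_. t"])
    have "(\<lambda>n. t - (1/2) ^ n) \<longlonglongrightarrow> t - 0" by (intro tendsto_intros) auto
    then show "(\<lambda>n. t - h n) \<longlonglongrightarrow> t" by (simp add: h_def power_one_over)
  qed (use j_le j_ge that in auto)
  have "\<exists>l\<in>K. (\<lambda>n. y n t) \<longlonglongrightarrow> l" if t: "t \<ge> 0" for t
  proof -
    define R where "R = exp t * norm x0"
    define D where "D = sqrt (10 * t * R\<^sup>2 * exp (2 * t)) + R"
    have R0: "R \<ge> 0" by (simp add: R_def)
    have step: "norm (y (Suc n) t - y n t) \<le> D * sqrt (1/2) ^ n" for n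
    proof -
      have "(norm (X (h n) (j n t) - X (h n / 2) (2 * j n t)))\<^sup>2 \<le> 10 * h n * h n * real (j n t) * R\<^sup>2 * exp (2 * h n * j n t)"
        unfolding R_def by (rule X_halve[OF h0(1) j_le[OF t]])
      also have "\<dots> = h n * (10 * (h n * real (j n t)) * R\<^sup>2 * exp (2 * (h n * j n t)))" by (simp add: mult_ac)
      also have "\<dots> \<le> h n * (10 * t * R\<^sup>2 * exp (2 * t))"
        using j_le[OF t, of n] h0[of n] t by (intro mult_left_mono mult_mono) auto
      finally have 1: "norm (X (h n) (j n t) - X (h n / 2) (2 * j n t)) \<le> sqrt (h n) * sqrt (10 * t * R\<^sup>2 * exp (2 * t))"
        by (simp add: real_le_rsqrt real_sqrt_mult[symmetric])
      have 2: "norm (X (h n / 2) (j (Suc n) t) - X (h n / 2) (2 * j n t)) \<le> h n * R"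
      proof (cases "j (Suc n) t = 2 * j n t")
        case True then show ?thesis using h0 R0 by simp
      next
        case False
        then have e: "j (Suc n) t = Suc (2 * j n t)" using jS[OF t] by blast
        have h2: "h n / 2 \<ge> 0" using h0[of n] by simp
        have "norm (X (h n / 2) (2 * j n t)) \<le> R" unfolding R_def
          by (rule X_norm'[OF h2]) (use j_le[OF t, of n] in simp)
        then have "h n / 2 * norm (X (h n / 2) (2 * j n t)) \<le> h n * R"
          using h0[of n] by (intro mult_mono) auto
        then show ?thesis unfolding e using X_step[OF h2, of "2 * j n t"] by linarith
      qed
      have sq: "sqrt (h n) = sqrt (1/2) ^ n" by (simp add: h_def real_sqrt_power[symmetric] power_one_over[symmetric])
      have "h n = sqrt (1/2) ^ n * sqrt (1/2) ^ n" using h0(1)[of n] by (simp add: sq[symmetric])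
      also have "\<dots> \<le> sqrt (1/2) ^ n * 1" by (intro mult_left_mono power_le_one) (auto simp: real_sqrt_le_1_iff)
      finally have hs: "h n \<le> sqrt (1/2) ^ n" by simp
      have "norm (y (Suc n) t - y n t) \<le> norm (X (h n / 2) (j (Suc n) t) - X (h n / 2) (2 * j n t)) + norm (X (h n) (j n t) - X (h n / 2) (2 * j n t))"
        unfolding y_def hS using norm_triangle_ineq4[of "X (h n / 2) (j (Suc n) t) - X (h n / 2) (2 * j n t)" "X (h n) (j n t) - X (h n / 2) (2 * j n t)"] by simp
      also have "\<dots> \<le> sqrt (1/2) ^ n * R + sqrt (1/2) ^ n * sqrt (10 * t * R\<^sup>2 * exp (2 * t))"
        using 1 2 mult_right_mono[OF hs R0] unfolding sq by linarith
      finally show ?thesis by (simp add: D_def algebra_simps)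
    qed
    have sum: "summable (\<lambda>n. D * sqrt (1/2) ^ n)"
      by (intro summable_mult summable_geometric) (simp add: real_sqrt_lt_1_iff)
    have "Cauchy (\<lambda>n. y n t)"
    proof (rule metric_CauchyI)
      fix e :: real assume "e > 0"
      then obtain N where N: "\<And>m n. m \<ge> N \<Longrightarrow> norm (\<Sum>i=m..<n. D * sqrt (1/2) ^ i) < e"
        using sum[unfolded summable_Cauchy] by blast
      have tel: "dist (y n t) (y m t) \<le> (\<Sum>i=m..<n. D * sqrt (1/2) ^ i)" if "m \<le> n" for m n
        using sum_norm_le[of "{m..<n}" "\<lambda>i. y (Suc i) t - y i t" "\<lambda>i. D * sqrt (1/2) ^ i", OF step] sum_Suc_diff'[OF that, of "\<lambda>i. y i t"]
        by (simp add: dist_norm)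
      show "\<exists>M. \<forall>m\<ge>M. \<forall>n\<ge>M. dist (y m t) (y n t) < e"
      proof (intro exI allI impI)
        fix m n assume mn: "m \<ge> N" "n \<ge> N"
        show "dist (y m t) (y n t) < e"
        proof (cases "m \<le> n")
          case True then show ?thesis using tel[OF True] N[OF mn(1), of n] by (simp add: dist_commute)
        next
          case False then show ?thesis using tel[of n m] N[OF mn(2), of m] by simp
        qed
      qed
    qed
    moreover have "\<forall>n. y n t \<in> K" by (simp add: y_def X_in)
    ultimately show ?thesis using complete[unfolded complete_def, rule_format, of "\<lambda>n. y n t"] by simp
  qed
  then have "\<forall>t. \<exists>l. t \<ge> 0 \<longrightarrow> l \<in> K \<and> (\<lambda>n. y n t) \<longlonglongrightarrow> l" by blast
  from choice[OF this] obtain x where x: "\<And>t. t \<ge> 0 \<Longrightarrow> x t \<in> K" "\<And>t. t \<ge> 0 \<Longrightarrow> (\<lambda>n. y n t) \<longlonglongrightarrow> x t"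
    by blast
  have lim: "(\<lambda>n. h n * (real (j n b) - real (j n a))) \<longlonglongrightarrow> b - a" if "0 \<le> a" "a \<le> b" for a b
    using tendsto_diff[OF jh[of b] jh[of a]] that by (simp add: right_diff_distrib)
  show ?thesis
  proof (intro exI[of _ x] conjI allI impI ballI)
    have "y n 0 = x0" for n by (simp add: y_def j_def)
    then have "(\<lambda>n::nat. x0) \<longlonglongrightarrow> x 0" using x(2)[of 0] by simp
    then show "x 0 = x0" by (simp add: LIMSEQ_const_iff)
  next
    fix t :: real assume t: "0 \<le> t"
    show "x t \<in> K" by (rule x(1)[OF t])
    show "norm (x t) \<le> exp t * norm x0"
      by (rule LIMSEQ_le_const2[OF tendsto_norm[OF x(2)[OF t]]])
        (use X_norm'[OF h0(1) j_le[OF t]] in \<open>auto simp: y_def\<close>)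
  next
    fix a b :: real assume a: "0 \<le> a" and ab: "a \<le> b"
    then have b: "0 \<le> b" by simp
    have l: "(\<lambda>n. y n b) \<longlonglongrightarrow> x b" "(\<lambda>n. y n a) \<longlonglongrightarrow> x a" using x a b by auto
    show "norm (x b - x a) \<le> (b - a) * (exp b * norm x0)"
    proof (rule LIMSEQ_le)
      show "(\<lambda>n. norm (y n b - y n a)) \<longlonglongrightarrow> norm (x b - x a)" by (intro tendsto_intros l)
      show "(\<lambda>n. h n * (real (j n b) - real (j n a)) * (exp b * norm x0)) \<longlonglongrightarrow> (b - a) * (exp b * norm x0)"
        by (intro tendsto_intros lim a ab)
      show "\<exists>N. \<forall>n\<ge>N. norm (y n b - y n a) \<le> h n * (real (j n b) - real (j n a)) * (exp b * norm x0)"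
        using X_lip[OF h0(1) j_mono[OF ab] j_le[OF b]] by (auto simp: y_def)
    qed
    show "(norm (x b - x a))\<^sup>2 \<le> (b - a) * ((norm (x b))\<^sup>2 - (norm (x a))\<^sup>2) / 2"
    proof (rule LIMSEQ_le)
      show "(\<lambda>n. (norm (y n b - y n a))\<^sup>2) \<longlonglongrightarrow> (norm (x b - x a))\<^sup>2" by (intro tendsto_intros l)
      show "(\<lambda>n. h n * (real (j n b) - real (j n a)) * ((norm (y n b))\<^sup>2 - (norm (y n a))\<^sup>2) / 2) \<longlonglongrightarrow> (b - a) * ((norm (x b))\<^sup>2 - (norm (x a))\<^sup>2) / 2"
        by (intro tendsto_intros lim a ab l) auto
      show "\<exists>N. \<forall>n\<ge>N. (norm (y n b - y n a))\<^sup>2 \<le> h n * (real (j n b) - real (j n a)) * ((norm (y n b))\<^sup>2 - (norm (y n a))\<^sup>2) / 2"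
        using X_energy[OF h0(1) j_mono[OF ab]] by (auto simp: y_def)
    qed
    fix z assume z: "z \<in> K"
    show "(norm (x b - z))\<^sup>2 - (norm (x a - z))\<^sup>2
        \<le> 2 * (b - a) * ((x a - z) \<bullet> x a) + 2 * (b - a) * (b - a) * ((exp b * norm x0) * (2 * (exp b * norm x0) + norm z))"
    proof (rule LIMSEQ_le)
      show "(\<lambda>n. (norm (y n b - z))\<^sup>2 - (norm (y n a - z))\<^sup>2) \<longlonglongrightarrow> (norm (x b - z))\<^sup>2 - (norm (x a - z))\<^sup>2"
        by (intro tendsto_intros l)
      let ?d = "\<lambda>n. h n * (real (j n b) - real (j n a))"
      let ?C = "(exp b * norm x0) * (2 * (exp b * norm x0) + norm z)"
      show "(\<lambda>n. 2 * ?d n * ((y n a - z) \<bullet> y n a) + 2 * ?d n * ?d n * ?C) \<longlonglongrightarrow>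
         2 * (b - a) * ((x a - z) \<bullet> x a) + 2 * (b - a) * (b - a) * ?C"
        by (intro tendsto_intros lim a ab l)
      show "\<exists>N. \<forall>n\<ge>N. (norm (y n b - z))\<^sup>2 - (norm (y n a - z))\<^sup>2 \<le> 2 * ?d n * ((y n a - z) \<bullet> y n a) + 2 * ?d n * ?d n * ?C"
        using X_EVI[OF h0(1) j_mono[OF ab] j_le[OF b] z] by (auto simp: y_def)
    qed
  qed
qed

end

section \<open>Dyadic difference quotients\<close>

lemma norm_add_sq_le: "(norm (a + b))\<^sup>2 \<le> 2 * (norm a)\<^sup>2 + 2 * (norm (b::'a::real_normed_vector))\<^sup>2"
proof -
  have "(norm (a + b))\<^sup>2 \<le> (norm a + norm b)\<^sup>2"
    by (simp add: norm_triangle_ineq power_mono)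
  also have "\<dots> \<le> 2 * (norm a)\<^sup>2 + 2 * (norm b)\<^sup>2"
    using sum_squares_bound[of "norm a" "norm b"] by (simp add: power2_sum)
  finally show ?thesis .
qed

text \<open>Besides convergence almost everywhere, the squared errors along the subsequence are
  summable. On a product measure this is stronger than L2 convergence in an essential way: Tonelli
  turns it into L2 convergence on almost every slice, in either variable.\<close>

lemma riesz_fischer:
  fixes u :: "nat \<Rightarrow> 'a \<Rightarrow> 'b::euclidean_space"
  assumes [measurable]: "\<And>n. u n \<in> borel_measurable N"
    and Cauchy: "\<And>e::real. e > 0 \<Longrightarrow> \<exists>n0. \<forall>m\<ge>n0. \<forall>n\<ge>n0. (\<integral>\<^sup>+x. ennreal ((norm (u m x - u n x))\<^sup>2) \<partial>N) \<le> ennreal e"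
  obtains r g where "strict_mono (r::nat \<Rightarrow> nat)" "g \<in> borel_measurable N"
    "AE x in N. (\<lambda>k. u (r k) x) \<longlonglongrightarrow> g x"
    "(\<Sum>k. \<integral>\<^sup>+x. ennreal ((norm (u (r k) x - g x))\<^sup>2) \<partial>N) < \<infinity>"
proof -
  \<comment> \<open>The rate 1/8 leaves room for the weight 4^k: the weighted errors still sum like
    (1/2)^k, and boundedness of 4^k (d k)^2 makes d k decay like (1/2)^k.\<close>
  define Q where "Q k n0 \<longleftrightarrow> (\<forall>m\<ge>n0. \<forall>n\<ge>n0. (\<integral>\<^sup>+x. ennreal ((norm (u m x - u n x))\<^sup>2) \<partial>N) \<le> ennreal ((1/8)^k))" for k n0
  have exQ: "\<exists>n0. Q k n0" for k unfolding Q_def by (rule Cauchy) simp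
  have mono: "Q k m" if "Q k n" "n \<le> m" for k n m using that unfolding Q_def by auto
  have "\<exists>r. \<forall>k. Q k (r k) \<and> r k < r (Suc k)"
  proof (rule dependent_nat_choice)
    show "\<exists>x. Q 0 x" by (rule exQ)
    fix x n
    obtain y where "Q (Suc n) y" using exQ by blast
    then show "\<exists>y. Q (Suc n) y \<and> x < y" using mono[of "Suc n" y "max y (Suc x)"]
      by (intro exI[of _ "max y (Suc x)"]) auto
  qed
  then obtain r where r: "\<And>k. Q k (r k)" "\<And>k. r k < r (Suc k)" by blast
  have sm: "strict_mono r" using r(2) by (simp add: strict_mono_Suc_iff)
  have le: "(\<integral>\<^sup>+x. ennreal ((norm (u (r k) x - u (r l) x))\<^sup>2) \<partial>N) \<le> ennreal ((1/8)^k)" if "k \<le> l" for k l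
    using r(1)[of k] strict_mono_leD[OF sm that] unfolding Q_def by blast
  define S where "S x = (\<Sum>k. ennreal (4^k * (norm (u (r k) x - u (r (Suc k)) x))\<^sup>2))" for x
  have "(\<integral>\<^sup>+x. S x \<partial>N) = (\<Sum>k. \<integral>\<^sup>+x. ennreal (4^k * (norm (u (r k) x - u (r (Suc k)) x))\<^sup>2) \<partial>N)"
    unfolding S_def by (rule nn_integral_suminf) measurable
  also have "\<dots> \<le> (\<Sum>k. ennreal ((1/2)^k))"
  proof (rule suminf_le)
    fix k
    have "(\<integral>\<^sup>+x. ennreal (4^k * (norm (u (r k) x - u (r (Suc k)) x))\<^sup>2) \<partial>N)
      = ennreal (4^k) * (\<integral>\<^sup>+x. ennreal ((norm (u (r k) x - u (r (Suc k)) x))\<^sup>2) \<partial>N)"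
      by (subst nn_integral_cmult[symmetric]) (auto simp: ennreal_mult)
    also have "\<dots> \<le> ennreal (4^k) * ennreal ((1/8)^k)" by (intro mult_left_mono le) auto
    also have "\<dots> = ennreal ((1/2)^k)"
      by (simp add: ennreal_mult[symmetric] power_mult_distrib[symmetric])
    finally show "(\<integral>\<^sup>+x. ennreal (4^k * (norm (u (r k) x - u (r (Suc k)) x))\<^sup>2) \<partial>N) \<le> ennreal ((1/2)^k)" .
  qed auto
  also have "\<dots> = ennreal (\<Sum>k. (1/2)^k)"
    by (rule suminf_ennreal2) auto
  also have "\<dots> < \<infinity>" by simp
  finally have "AE x in N. S x \<noteq> \<infinity>"
    by (intro nn_integral_PInf_AE) (auto simp: S_def)
  then have conv: "AE x in N. convergent (\<lambda>k. u (r k) x)"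
  proof eventually_elim
    case (elim x)
    define d where "d k = norm (u (r k) x - u (r (Suc k)) x)" for k
    have sumd: "summable (\<lambda>k. 4^k * (d k)\<^sup>2)"
      using elim unfolding S_def d_def by (intro summable_suminf_not_top) (auto simp: infinity_ennreal_def)
    then have "Bseq (\<lambda>k. 4^k * (d k)\<^sup>2)"
      using summable_LIMSEQ_zero convergent_imp_Bseq convergent_def by blast
    then obtain C where C: "C > 0" "\<And>k. norm (4^k * (d k)\<^sup>2) \<le> C" by (auto simp: Bseq_def)
    have "d k \<le> sqrt C * (1/2)^k" for k
    proof -
      have "(2 ^ k)\<^sup>2 = (4::real) ^ k" by (simp add: power2_eq_square flip: power_mult_distrib)
      then have "(2 ^ k * d k)\<^sup>2 \<le> C" using C(2)[of k] by (simp add: power_mult_distrib)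
      then have "2^k * d k \<le> sqrt C" by (rule real_le_rsqrt)
      then show ?thesis by (simp add: field_simps power_one_over)
    qed
    then have "summable d"
      by (intro summable_comparison_test'[of "\<lambda>k. sqrt C * (1/2)^k" 0 d])
        (auto simp: d_def intro!: summable_mult summable_geometric)
    moreover have "(\<lambda>k. norm (u (r (Suc k)) x - u (r k) x)) = d"
      by (simp add: d_def fun_eq_iff norm_minus_commute)
    ultimately have "summable (\<lambda>k. norm (u (r (Suc k)) x - u (r k) x))" by simp
    then have "summable (\<lambda>k. u (r (Suc k)) x - u (r k) x)" by (rule summable_norm_cancel)
    then obtain L where "(\<lambda>n. \<Sum>k<n. u (r (Suc k)) x - u (r k) x) \<longlonglongrightarrow> L"
      unfolding summable_iff_convergent convergent_def by blast
    then have "(\<lambda>n. u (r n) x - u (r 0) x) \<longlonglongrightarrow> L"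
      using sum_lessThan_telescope[of "\<lambda>k. u (r k) x"] by simp
    from tendsto_add[OF this tendsto_const[of "u (r 0) x"]]
    show ?case by (auto simp: convergent_def)
  qed
  define g where "g x = lim (\<lambda>k. u (r k) x)" for x
  have [measurable]: "g \<in> borel_measurable N" unfolding g_def by measurable
  have ae: "AE x in N. (\<lambda>k. u (r k) x) \<longlonglongrightarrow> g x"
    using conv by eventually_elim (simp add: g_def convergent_LIMSEQ_iff)
  have "(\<integral>\<^sup>+x. ennreal ((norm (u (r k) x - g x))\<^sup>2) \<partial>N) \<le> ennreal ((1/8)^k)" for k
  proof -
    have "(\<integral>\<^sup>+x. ennreal ((norm (u (r k) x - g x))\<^sup>2) \<partial>N)
       = (\<integral>\<^sup>+x. liminf (\<lambda>l. ennreal ((norm (u (r k) x - u (r l) x))\<^sup>2)) \<partial>N)"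
    proof (rule nn_integral_cong_AE)
      show "AE x in N. ennreal ((norm (u (r k) x - g x))\<^sup>2) = liminf (\<lambda>l. ennreal ((norm (u (r k) x - u (r l) x))\<^sup>2))"
        using ae
      proof eventually_elim
        case (elim x)
        have "(\<lambda>l. ennreal ((norm (u (r k) x - u (r l) x))\<^sup>2)) \<longlonglongrightarrow> ennreal ((norm (u (r k) x - g x))\<^sup>2)"
          by (intro tendsto_intros elim)
        from lim_imp_Liminf[OF _ this] show ?case by simp
      qed
    qed
    also have "\<dots> \<le> liminf (\<lambda>l. \<integral>\<^sup>+x. ennreal ((norm (u (r k) x - u (r l) x))\<^sup>2) \<partial>N)"
      by (rule nn_integral_liminf) measurable
    also have "\<dots> \<le> liminf (\<lambda>l. ennreal ((1/8)^k))"
      by (rule Liminf_mono) (use le in \<open>auto simp: eventually_sequentially\<close>)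
    also have "\<dots> = ennreal ((1/8)^k)" by (simp add: Liminf_const)
    finally show ?thesis .
  qed
  then have "(\<Sum>k. \<integral>\<^sup>+x. ennreal ((norm (u (r k) x - g x))\<^sup>2) \<partial>N) \<le> (\<Sum>k. ennreal ((1/8)^k))"
    by (intro suminf_le) auto
  also have "\<dots> = ennreal (\<Sum>k. (1/8)^k)" by (rule suminf_ennreal2) auto
  also have "\<dots> < \<infinity>" by simp
  finally show ?thesis using that sm ae \<open>g \<in> borel_measurable N\<close> by blast
qed

section \<open>Lebesgue measure on the unit interval, as a finite measure on the whole line\<close>

definition I01 :: "real measure" where
  "I01 = density lborel (\<lambda>x. indicator {0..1} x)"

lemma sets_I01 [measurable_cong, simp]: "sets I01 = sets borel" by (simp add: I01_def)
lemma space_I01 [simp]: "space I01 = UNIV" by (simp add: I01_def)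

lemma emeasure_I01: "A \<in> sets borel \<Longrightarrow> emeasure I01 A = emeasure lborel (A \<inter> {0..1})"
  unfolding I01_def by (subst emeasure_density) (auto simp flip: indicator_inter_arith intro!: arg_cong2[where f=emeasure])

lemma measure_I01_UNIV: "measure I01 UNIV = 1"
  by (simp add: measure_def emeasure_I01)

interpretation I01: finite_measure I01
  by standard (simp add: emeasure_I01)

lemma AE_I01: "(AE x in I01. P x) \<longleftrightarrow> (AE x in lborel. x \<in> {0..1} \<longrightarrow> P x)"
  unfolding I01_def by (subst AE_density) (auto simp: indicator_def)

lemma integrable_I01: "f \<in> borel_measurable borel \<Longrightarrow> integrable I01 (f :: real \<Rightarrow> 'b::euclidean_space) \<longleftrightarrow> set_integrable lborel {0..1} f"
  unfolding I01_def set_integrable_def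
  using integrable_density[of f lborel "indicator {0..1}"] by (simp add: ennreal_indicator)

lemma integral_I01: "f \<in> borel_measurable borel \<Longrightarrow> integral\<^sup>L I01 (f :: real \<Rightarrow> 'b::euclidean_space) = (LINT x:{0..1}|lborel. f x)"
  unfolding I01_def set_lebesgue_integral_def
  using integral_density[of f lborel "indicator {0..1}"] by (simp add: ennreal_indicator)

lemma nn_integral_I01: "f \<in> borel_measurable borel \<Longrightarrow> (\<integral>\<^sup>+x. f x \<partial>I01) = (\<integral>\<^sup>+x. f x * indicator {0..1} x \<partial>lborel)"
  unfolding I01_def by (subst nn_integral_density) (auto simp: mult.commute)

lemma AE_I01_ivl: "AE x in I01. x \<in> {0<..<1}"
proof -
  have "AE x in lborel. x \<noteq> (0::real)" "AE x in lborel. x \<noteq> (1::real)" by (auto simp: AE_lborel_singleton)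
  then show ?thesis unfolding AE_I01 by eventually_elim auto
qed

text \<open>\<open>dq n u\<close> is the difference quotient of \<open>u\<close> over the dyadic cell of length \<open>2^-n\<close> containing
  the argument; as a function of \<open>n\<close> it is a martingale on the unit interval.\<close>

definition dq :: "nat \<Rightarrow> (real \<Rightarrow> 'b::real_vector) \<Rightarrow> real \<Rightarrow> 'b" where
  "dq n u x = 2 ^ n *\<^sub>R (u ((real_of_int \<lfloor>2 ^ n * x\<rfloor> + 1) / 2 ^ n) - u (real_of_int \<lfloor>2 ^ n * x\<rfloor> / 2 ^ n))"

text \<open>Measurability with respect to the dyadic partition of level n, encoded by evaluation at
  the left endpoint of the half-open cell.\<close>

definition cellwise :: "nat \<Rightarrow> (real \<Rightarrow> 'b) \<Rightarrow> bool" where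
  "cellwise n F \<longleftrightarrow> (\<forall>x. F x = F (real_of_int \<lfloor>2 ^ n * x\<rfloor> / 2 ^ n))"

text \<open>The martingale is adapted: rounding down at level m first does not change the cell of
  level n, by the rule for floors of quotients.\<close>

lemma cellwise_dq: "n \<le> m \<Longrightarrow> cellwise m (dq n u)"
proof -
  assume nm: "n \<le> m"
  have "\<lfloor>2 ^ n * (real_of_int \<lfloor>2 ^ m * x\<rfloor> / 2 ^ m)\<rfloor> = \<lfloor>2 ^ n * x\<rfloor>" for x :: real
  proof -
    obtain k where m: "m = n + k" using nm le_Suc_ex by blast
    have e: "2 ^ n * (real_of_int \<lfloor>2 ^ m * x\<rfloor> / 2 ^ m) = real_of_int \<lfloor>2 ^ m * x\<rfloor> / real_of_int (2 ^ k)"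
      by (simp add: m power_add)
    have "\<lfloor>2 ^ n * x\<rfloor> = \<lfloor>(2 ^ m * x) / real_of_int (2 ^ k)\<rfloor>"
      by (simp add: m power_add)
    also have "\<dots> = \<lfloor>2 ^ m * x\<rfloor> div 2 ^ k" by (rule floor_divide_real_eq_div) simp
    also have "\<dots> = \<lfloor>real_of_int \<lfloor>2 ^ m * x\<rfloor> / real_of_int (2 ^ k)\<rfloor>" by (simp only: floor_divide_of_int_eq)
    finally show ?thesis unfolding e by simp
  qed
  then show ?thesis unfolding cellwise_def dq_def by simp
qed

lemma dq_at: "dq n u (real j / 2 ^ n) = 2 ^ n *\<^sub>R (u (real (Suc j) / 2 ^ n) - u (real j / 2 ^ n))"
  by (simp add: dq_def add.commute)

lemma cellwise_integral:
  fixes F :: "real \<Rightarrow> 'b::euclidean_space"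
  assumes "cellwise m F"
  shows "has_bochner_integral lborel (\<lambda>x. indicator {0..<real i / 2 ^ m} x *\<^sub>R F x) (\<Sum>j<i. (1 / 2 ^ m) *\<^sub>R F (real j / 2 ^ m))"
proof (induction i)
  case 0 then show ?case by (simp add: has_bochner_integral_zero)
next
  case (Suc i)
  let ?c = "{real i / 2 ^ m..<real (Suc i) / 2 ^ m}"
  have split: "{0..<real (Suc i) / 2 ^ m} = {0..<real i / 2 ^ m} \<union> ?c"
    by (rule ivl_disj_un_two(3)[symmetric]) (auto simp: divide_simps)
  have c: "F x = F (real i / 2 ^ m)" if "x \<in> ?c" for x
  proof -
    have "real i \<le> 2 ^ m * x" "2 ^ m * x < real i + 1" using that by (auto simp: field_simps)
    then have "\<lfloor>2 ^ m * x\<rfloor> = int i" by linarith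
    then show ?thesis using assms unfolding cellwise_def by (metis of_int_of_nat_eq)
  qed
  have eq: "(\<lambda>x. indicator {0..<real (Suc i) / 2 ^ m} x *\<^sub>R F x)
     = (\<lambda>x. indicator {0..<real i / 2 ^ m} x *\<^sub>R F x + indicator ?c x *\<^sub>R F (real i / 2 ^ m))"
  proof
    fix x
    define A where "A = {0..<real i / 2 ^ m}"
    define C where "C = ?c"
    have "x \<notin> A \<or> x \<notin> C" unfolding A_def C_def by (metis atLeastLessThan_iff not_le)
    then show "indicator {0..<real (Suc i) / 2 ^ m} x *\<^sub>R F x =
        indicator {0..<real i / 2 ^ m} x *\<^sub>R F x + indicator ?c x *\<^sub>R F (real i / 2 ^ m)"
      using c[of x] unfolding split A_def[symmetric] C_def[symmetric] by (auto simp: indicator_def)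
  qed
  have "emeasure lborel ?c = ennreal (1 / 2 ^ m)"
    by (subst emeasure_lborel_Ico) (auto simp: divide_simps diff_divide_distrib[symmetric])
  then have "has_bochner_integral lborel (\<lambda>x. indicator ?c x *\<^sub>R F (real i / 2 ^ m)) (measure lborel ?c *\<^sub>R F (real i / 2 ^ m))"
    by (intro has_bochner_integral_indicator) auto
  moreover have "measure lborel ?c = 1 / 2 ^ m"
    using \<open>emeasure lborel ?c = _\<close> by (simp add: measure_def)
  ultimately show ?case unfolding eq using has_bochner_integral_add[OF Suc] by simp
qed

lemma cellwise_nn_integral:
  fixes F :: "real \<Rightarrow> real"
  assumes "cellwise m F" "\<And>x. F x \<ge> 0" and [measurable]: "F \<in> borel_measurable borel"
  shows "(\<integral>\<^sup>+x. ennreal (F x) \<partial>I01) = ennreal (\<Sum>j<2 ^ m. F (real j / 2 ^ m) / 2 ^ m)"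
proof -
  have "(\<integral>\<^sup>+x. ennreal (F x) \<partial>I01) = (\<integral>\<^sup>+x. ennreal (F x) * indicator {0..1} x \<partial>lborel)"
    by (rule nn_integral_I01) measurable
  also have "\<dots> = (\<integral>\<^sup>+x. ennreal (indicator {0..<1} x *\<^sub>R F x) \<partial>lborel)"
  proof (rule nn_integral_cong_AE)
    have "AE x in lborel. x \<noteq> (1::real)" by (simp add: AE_lborel_singleton)
    then show "AE x in lborel. ennreal (F x) * indicator {0..1} x = ennreal (indicator {0..<1} x *\<^sub>R F x)"
      by eventually_elim (auto simp: indicator_def)
  qed
  also have "\<dots> = ennreal (\<Sum>j<2 ^ m. F (real j / 2 ^ m) / 2 ^ m)"
    using cellwise_integral[OF assms(1), of "2 ^ m"] assms(2)
    by (intro nn_integral_eq_integral[THEN trans]) (auto simp: has_bochner_integral_iff)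
  finally show ?thesis .
qed

text \<open>Joint measurability needs only measurability in the parameter: \<open>dq\<close> reads
  \<open>u\<close> at countably many dyadic points, and the floor is a measurable integer
  index.\<close>

lemma borel_measurable_dq:
  fixes u :: "'a \<Rightarrow> real \<Rightarrow> 'b::euclidean_space"
  assumes [measurable]: "\<And>x. (\<lambda>y. u y x) \<in> borel_measurable M" and [measurable]: "f \<in> N \<rightarrow>\<^sub>M M" "h \<in> borel_measurable N"
  shows "(\<lambda>p. dq n (u (f p)) (h p)) \<in> borel_measurable N"
proof -
  have "(\<lambda>p. (\<lambda>i::int. \<lambda>p. 2 ^ n *\<^sub>R (u (f p) ((real_of_int i + 1) / 2 ^ n) - u (f p) (real_of_int i / 2 ^ n))) \<lfloor>2 ^ n * h p\<rfloor> p) \<in> borel_measurable N"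
    by (rule measurable_compose_countable) measurable
  then show ?thesis by (simp add: dq_def)
qed

text \<open>The hypothesis makes \<open>a\<close> the mean of the family, so this is the variance
  decomposition.\<close>

lemma sum_sq_dev:
  fixes A :: "nat \<Rightarrow> 'b::real_inner"
  assumes "(\<Sum>i\<in>S. A i) = real (card S) *\<^sub>R a"
  shows "(\<Sum>i\<in>S. (norm (A i - a))\<^sup>2) + real (card S) * (norm a)\<^sup>2 = (\<Sum>i\<in>S. (norm (A i))\<^sup>2)"
proof -
  have "(\<Sum>i\<in>S. (norm (A i - a))\<^sup>2) = (\<Sum>i\<in>S. (norm (A i))\<^sup>2 - 2 * (A i \<bullet> a) + (norm a)\<^sup>2)"
    by (rule sum.cong) (auto simp: power2_norm_eq_inner algebra_simps inner_commute)
  also have "\<dots> = (\<Sum>i\<in>S. (norm (A i))\<^sup>2) - 2 * ((\<Sum>i\<in>S. A i) \<bullet> a) + real (card S) * (norm a)\<^sup>2"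
    by (simp add: sum.distrib sum_subtractf sum_distrib_left inner_sum_left)
  finally show ?thesis unfolding assms by (simp add: power2_norm_eq_inner)
qed

text \<open>Orthogonality of martingale increments: the finer quotients inside a coarse cell average
  to the coarse quotient, because the increments of \<open>u\<close> telescope.\<close>

lemma dq_pythagoras:
  fixes u :: "real \<Rightarrow> 'b::euclidean_space"
  assumes "n \<le> m"
  shows "(\<integral>\<^sup>+x. ennreal ((norm (dq m u x - dq n u x))\<^sup>2) \<partial>I01) + (\<integral>\<^sup>+x. ennreal ((norm (dq n u x))\<^sup>2) \<partial>I01)
     = (\<integral>\<^sup>+x. ennreal ((norm (dq m u x))\<^sup>2) \<partial>I01)"
proof -
  obtain k where m: "m = n + k" using assms le_Suc_ex by blast
  have dqm [measurable]: "dq n u \<in> borel_measurable borel" for n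
    by (rule borel_measurable_dq[of "\<lambda>_. u" "count_space UNIV" "\<lambda>_. ()" borel "\<lambda>x. x" n]) auto
  have c: "cellwise m (dq m u)" "cellwise m (dq n u)" using cellwise_dq assms by auto
  then have c': "cellwise m (\<lambda>x. (norm (dq m u x - dq n u x))\<^sup>2)" "cellwise m (\<lambda>x. (norm (dq n u x))\<^sup>2)" "cellwise m (\<lambda>x. (norm (dq m u x))\<^sup>2)"
    unfolding cellwise_def by metis+
  let ?A = "\<lambda>j. dq m u (real j / 2 ^ m)" and ?B = "\<lambda>j. dq n u (real j / 2 ^ m)"
  \<comment> \<open>Cell l of level n consists of the 2^k cells of level m with indices from l * 2^k
    on; there the coarse quotient is a constant and the fine ones have it as their mean.\<close>
  have grp: "(\<Sum>j\<in>{l * 2 ^ k..<l * 2 ^ k + 2 ^ k}. (norm (?A j - ?B j))\<^sup>2) + (\<Sum>j\<in>{l * 2 ^ k..<l * 2 ^ k + 2 ^ k}. (norm (?B j))\<^sup>2)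
     = (\<Sum>j\<in>{l * 2 ^ k..<l * 2 ^ k + 2 ^ k}. (norm (?A j))\<^sup>2)" for l
  proof -
    let ?S = "{l * 2 ^ k..<l * 2 ^ k + 2 ^ k}"
    define b where "b = dq n u (real l / 2 ^ n)"
    have B: "?B j = b" if "j \<in> ?S" for j
    proof -
      have "real j / real (2 ^ k) \<ge> real l" "real j / real (2 ^ k) < real l + 1"
        using that by (auto simp: field_simps simp flip: of_nat_add of_nat_mult of_nat_power of_nat_Suc)
      moreover have "2 ^ n * (real j / 2 ^ m) = real j / real (2 ^ k)" by (simp add: m power_add)
      ultimately have "\<lfloor>2 ^ n * (real j / 2 ^ m)\<rfloor> = int l" by linarith
      then show ?thesis using cellwise_dq[OF order_refl, of n u] unfolding b_def cellwise_def by (metis of_int_of_nat_eq)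
    qed
    have "(\<Sum>j\<in>?S. ?A j) = 2 ^ m *\<^sub>R (\<Sum>j\<in>?S. u (real (Suc j) / 2 ^ m) - u (real j / 2 ^ m))"
      unfolding dq_at by (simp add: scaleR_sum_right)
    also have "(\<Sum>j\<in>?S. u (real (Suc j) / 2 ^ m) - u (real j / 2 ^ m)) = u (real (l * 2 ^ k + 2 ^ k) / 2 ^ m) - u (real (l * 2 ^ k) / 2 ^ m)"
      using sum_Suc_diff'[of "l * 2 ^ k" "l * 2 ^ k + 2 ^ k" "\<lambda>j. u (real j / 2 ^ m)"] by simp
    also have "real (l * 2 ^ k + 2 ^ k) / 2 ^ m = real (Suc l) / 2 ^ n" by (simp add: m power_add field_simps)
    also have "real (l * 2 ^ k) / 2 ^ m = real l / 2 ^ n" by (simp add: m power_add field_simps)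
    also have "2 ^ m *\<^sub>R (u (real (Suc l) / 2 ^ n) - u (real l / 2 ^ n)) = real (card ?S) *\<^sub>R b"
      unfolding b_def dq_at by (simp add: m power_add mult.commute)
    finally have "(\<Sum>j\<in>?S. (norm (?A j - b))\<^sup>2) + real (card ?S) * (norm b)\<^sup>2 = (\<Sum>j\<in>?S. (norm (?A j))\<^sup>2)"
      by (rule sum_sq_dev)
    then show ?thesis using B by simp
  qed
  have two: "{..<2 ^ m} = {..<2 ^ n * 2 ^ k :: nat}" by (simp add: m power_add)
  have sums: "(\<Sum>j<2 ^ m. (norm (?A j - ?B j))\<^sup>2) + (\<Sum>j<2 ^ m. (norm (?B j))\<^sup>2) = (\<Sum>j<2 ^ m. (norm (?A j))\<^sup>2)"
    unfolding two sum.nat_group[symmetric] sum.distrib[symmetric] 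
    by (rule sum.cong[OF refl]) (use grp in \<open>simp add: sum.distrib\<close>)
  have "(\<integral>\<^sup>+x. ennreal ((norm (dq m u x - dq n u x))\<^sup>2) \<partial>I01) = ennreal (\<Sum>j<2 ^ m. (norm (?A j - ?B j))\<^sup>2 / 2 ^ m)"
    by (rule cellwise_nn_integral[OF c'(1)]) (simp, measurable)
  moreover have "(\<integral>\<^sup>+x. ennreal ((norm (dq n u x))\<^sup>2) \<partial>I01) = ennreal (\<Sum>j<2 ^ m. (norm (?B j))\<^sup>2 / 2 ^ m)"
    by (rule cellwise_nn_integral[OF c'(2)]) (simp, measurable)
  moreover have "(\<integral>\<^sup>+x. ennreal ((norm (dq m u x))\<^sup>2) \<partial>I01) = ennreal (\<Sum>j<2 ^ m. (norm (?A j))\<^sup>2 / 2 ^ m)"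
    by (rule cellwise_nn_integral[OF c'(3)]) (simp, measurable)
  moreover have "(\<Sum>j<2 ^ m. (norm (?A j - ?B j))\<^sup>2 / 2 ^ m) + (\<Sum>j<2 ^ m. (norm (?B j))\<^sup>2 / 2 ^ m) = (\<Sum>j<2 ^ m. (norm (?A j))\<^sup>2 / 2 ^ m)"
    by (simp only: sums[symmetric] sum_divide_distrib[symmetric] add_divide_distrib[symmetric])
  ultimately show ?thesis by (simp add: sum_nonneg flip: ennreal_plus)
qed

text \<open>The L2 martingale convergence theorem with a parameter. By Pythagoras the energies
  increase, and being bounded they make the martingale Cauchy on the product space. Working there
  rather than slice by slice gives a jointly measurable limit and one subsequence that serves almost
  every slice in both directions.\<close>

lemma dyadic_derivative:
  fixes u :: "'a \<Rightarrow> real \<Rightarrow> 'b::euclidean_space"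
  assumes "sigma_finite_measure M"
    and meas: "\<And>x. (\<lambda>y. u y x) \<in> borel_measurable M"
    and bound: "\<And>n. (\<integral>\<^sup>+y. \<integral>\<^sup>+x. ennreal ((norm (dq n (u y) x))\<^sup>2) \<partial>I01 \<partial>M) \<le> ennreal B"
  obtains r g where "strict_mono (r::nat \<Rightarrow> nat)" "(\<lambda>p. g (fst p) (snd p)) \<in> borel_measurable (M \<Otimes>\<^sub>M borel)"
    "AE y in M. (\<lambda>k. \<integral>\<^sup>+x. ennreal ((norm (dq (r k) (u y) x - g y x))\<^sup>2) \<partial>I01) \<longlonglongrightarrow> 0"
    "AE x in I01. (\<lambda>k. \<integral>\<^sup>+y. ennreal ((norm (dq (r k) (u y) x - g y x))\<^sup>2) \<partial>M) \<longlonglongrightarrow> 0"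
    "AE y in M. AE x in I01. (\<lambda>k. dq (r k) (u y) x) \<longlonglongrightarrow> g y x"
    "AE x in I01. AE y in M. (\<lambda>k. dq (r k) (u y) x) \<longlonglongrightarrow> g y x"
proof -
  interpret M: sigma_finite_measure M by fact
  interpret pair_sigma_finite M I01 ..
  define U where "U n p = dq n (u (fst p)) (snd p)" for n p
  have U [measurable]: "U n \<in> borel_measurable (M \<Otimes>\<^sub>M I01)" for n
    unfolding U_def by (rule borel_measurable_dq[OF meas]) measurable
  define e where "e n = (\<integral>\<^sup>+p. ennreal ((norm (U n p))\<^sup>2) \<partial>(M \<Otimes>\<^sub>M I01))" for n
  have e: "e n = (\<integral>\<^sup>+y. \<integral>\<^sup>+x. ennreal ((norm (dq n (u y) x))\<^sup>2) \<partial>I01 \<partial>M)" for n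
  proof -
    have "(\<integral>\<^sup>+y. \<integral>\<^sup>+x. ennreal ((norm (U n (y, x)))\<^sup>2) \<partial>I01 \<partial>M) = e n"
      unfolding e_def by (rule I01.nn_integral_fst) measurable
    then show ?thesis by (simp add: U_def)
  qed
  have pyth: "(\<integral>\<^sup>+p. ennreal ((norm (U m p - U n p))\<^sup>2) \<partial>(M \<Otimes>\<^sub>M I01)) + e n = e m" if "n \<le> m" for n m
  proof -
    have "(\<integral>\<^sup>+p. ennreal ((norm (U m p - U n p))\<^sup>2) \<partial>(M \<Otimes>\<^sub>M I01)) + e n
       = (\<integral>\<^sup>+p. ennreal ((norm (U m p - U n p))\<^sup>2) + ennreal ((norm (U n p))\<^sup>2) \<partial>(M \<Otimes>\<^sub>M I01))"
      unfolding e_def by (rule nn_integral_add[symmetric]) measurable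
    also have "\<dots> = (\<integral>\<^sup>+y. \<integral>\<^sup>+x. ennreal ((norm (U m (y, x) - U n (y, x)))\<^sup>2) + ennreal ((norm (U n (y, x)))\<^sup>2) \<partial>I01 \<partial>M)"
      by (rule I01.nn_integral_fst[symmetric]) measurable
    also have "\<dots> = (\<integral>\<^sup>+y. \<integral>\<^sup>+x. ennreal ((norm (U m (y, x)))\<^sup>2) \<partial>I01 \<partial>M)"
    proof (rule nn_integral_cong)
      fix y assume [measurable]: "y \<in> space M"
      have "(\<integral>\<^sup>+x. ennreal ((norm (U m (y, x) - U n (y, x)))\<^sup>2) + ennreal ((norm (U n (y, x)))\<^sup>2) \<partial>I01)
        = (\<integral>\<^sup>+x. ennreal ((norm (U m (y, x) - U n (y, x)))\<^sup>2) \<partial>I01) + (\<integral>\<^sup>+x. ennreal ((norm (U n (y, x)))\<^sup>2) \<partial>I01)"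
        by (rule nn_integral_add) measurable
      also have "\<dots> = (\<integral>\<^sup>+x. ennreal ((norm (U m (y, x)))\<^sup>2) \<partial>I01)"
        unfolding U_def fst_conv snd_conv by (rule dq_pythagoras[OF that])
      finally show "(\<integral>\<^sup>+x. ennreal ((norm (U m (y, x) - U n (y, x)))\<^sup>2) + ennreal ((norm (U n (y, x)))\<^sup>2) \<partial>I01)
        = (\<integral>\<^sup>+x. ennreal ((norm (U m (y, x)))\<^sup>2) \<partial>I01)" .
    qed
    also have "\<dots> = e m" unfolding e_def by (rule I01.nn_integral_fst) measurable
    finally show ?thesis .
  qed
  have e_le: "e n \<le> ennreal B" for n unfolding e by (rule bound)
  have mono: "mono e"
    by (rule monoI) (metis pyth le_add_same_cancel2 zero_le add.commute le_iff_add)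
  define L where "L = (SUP n. e n)"
  have "L \<le> ennreal B" unfolding L_def using e_le by (auto intro!: SUP_least)
  then have L: "L < \<infinity>" by (simp add: le_less_trans)
  have eL: "e n \<le> L" for n unfolding L_def by (rule SUP_upper) simp
  \<comment> \<open>From an index on where the energy is within \<open>d\<close> of its supremum,
    Pythagoras leaves at most \<open>d\<close> for the squared distance of any two members.\<close>
  have cauchy: "\<exists>n0. \<forall>m\<ge>n0. \<forall>n\<ge>n0. (\<integral>\<^sup>+p. ennreal ((norm (U m p - U n p))\<^sup>2) \<partial>(M \<Otimes>\<^sub>M I01)) \<le> ennreal d"
    if "d > 0" for d :: real
  proof -
    have "\<exists>n0. L \<le> e n0 + ennreal d"
    \<comment> \<open>For \<open>L = 0\<close> the strict inequality used in the other case fails,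
      while the bound is trivial.\<close>
    proof (cases "L = 0")
      case False
      then have "L - ennreal d < L" using L \<open>d > 0\<close>
        by (metis ennreal_eq_0_iff ennreal_minus_eq_top ennreal_between infinity_ennreal_def leD not_gr_zero top.not_eq_extremum ennreal_less_zero_iff)
      then obtain n0 where "L - ennreal d < e n0" unfolding L_def by (auto simp: less_SUP_iff)
      then show ?thesis by (metis add.commute ennreal_minus_le_iff less_imp_le)
    qed auto
    then obtain n0 where n0: "L \<le> e n0 + ennreal d" by blast
    have le: "(\<integral>\<^sup>+p. ennreal ((norm (U m p - U n p))\<^sup>2) \<partial>(M \<Otimes>\<^sub>M I01)) \<le> ennreal d" if "n0 \<le> n" "n \<le> m" for m n
    proof -
      have fin: "e n < top" using eL[of n] L by (simp add: le_less_trans)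
      have "(\<integral>\<^sup>+p. ennreal ((norm (U m p - U n p))\<^sup>2) \<partial>(M \<Otimes>\<^sub>M I01)) + e n \<le> ennreal d + e n"
        unfolding pyth[OF that(2)] using eL[of m] n0 monoD[OF mono that(1)]
        by (metis add.commute add_left_mono order_trans)
      then show ?thesis using fin by (metis ennreal_add_left_cancel_le add.commute less_irrefl infinity_ennreal_def)
    qed
    show ?thesis
    proof (intro exI[of _ n0] allI impI)
      fix m n assume "n0 \<le> m" "n0 \<le> n"
      then show "(\<integral>\<^sup>+p. ennreal ((norm (U m p - U n p))\<^sup>2) \<partial>(M \<Otimes>\<^sub>M I01)) \<le> ennreal d"
        using le[of n m] le[of m n] by (cases "n \<le> m") (auto simp: norm_minus_commute)
    qed
  qed
  obtain r G where rG: "strict_mono (r::nat\<Rightarrow>nat)" "G \<in> borel_measurable (M \<Otimes>\<^sub>M I01)"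
      "AE p in M \<Otimes>\<^sub>M I01. (\<lambda>k. U (r k) p) \<longlonglongrightarrow> G p"
      "(\<Sum>k. \<integral>\<^sup>+p. ennreal ((norm (U (r k) p - G p))\<^sup>2) \<partial>(M \<Otimes>\<^sub>M I01)) < \<infinity>"
    using riesz_fischer[OF U cauchy] by blast
  note [measurable] = rG(2)
  define g where "g y x = G (y, x)" for y x
  have sets: "sets (M \<Otimes>\<^sub>M I01) = sets (M \<Otimes>\<^sub>M borel)" by (rule sets_pair_measure_cong) auto
  \<comment> \<open>The squared errors are summable under the double integral, hence summable on
    almost every slice by Tonelli, and so they tend to zero there.\<close>
  define a where "a k p = ennreal ((norm (U (r k) p - G p))\<^sup>2)" for k p
  have [measurable]: "a k \<in> borel_measurable (M \<Otimes>\<^sub>M I01)" for k unfolding a_def by measurable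
  have fin: "(\<integral>\<^sup>+p. (\<Sum>k. a k p) \<partial>(M \<Otimes>\<^sub>M I01)) < \<infinity>"
    using rG(4) by (subst nn_integral_suminf) (auto simp: a_def[abs_def])
  have tend: "f \<longlonglongrightarrow> 0" if "(\<Sum>k. f k) \<noteq> \<infinity>" for f :: "nat \<Rightarrow> ennreal"
  proof -
    have "summable (\<lambda>k. enn2real (f k))" and ff: "\<And>k. f k = ennreal (enn2real (f k))"
    proof -
      have ft: "f k < top" for k
        using sum_le_suminf[of f "{k}"] that by (auto simp: top.not_eq_extremum dest: le_less_trans)
      then show ff: "\<And>k. f k = ennreal (enn2real (f k))" by simp
      have "(\<Sum>k. ennreal (enn2real (f k))) \<noteq> top" using that ff by (simp add: infinity_ennreal_def)
      then show "summable (\<lambda>k. enn2real (f k))" by (intro summable_suminf_not_top) auto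
    qed
    then have "(\<lambda>k. ennreal (enn2real (f k))) \<longlonglongrightarrow> ennreal 0" by (intro tendsto_ennrealI summable_LIMSEQ_zero)
    then show ?thesis using ff by simp
  qed
  have "(\<integral>\<^sup>+y. (\<Sum>k. \<integral>\<^sup>+x. a k (y, x) \<partial>I01) \<partial>M) = (\<integral>\<^sup>+y. \<integral>\<^sup>+x. (\<Sum>k. a k (y, x)) \<partial>I01 \<partial>M)"
    by (intro nn_integral_cong nn_integral_suminf[symmetric]) measurable
  also have "\<dots> = (\<integral>\<^sup>+p. (\<Sum>k. a k p) \<partial>(M \<Otimes>\<^sub>M I01))" by (rule I01.nn_integral_fst) measurable
  finally have "AE y in M. (\<Sum>k. \<integral>\<^sup>+x. a k (y, x) \<partial>I01) \<noteq> \<infinity>"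
    using fin by (intro nn_integral_PInf_AE) auto
  then have 1: "AE y in M. (\<lambda>k. \<integral>\<^sup>+x. a k (y, x) \<partial>I01) \<longlonglongrightarrow> 0"
    by eventually_elim (rule tend)
  have "(\<integral>\<^sup>+x. (\<Sum>k. \<integral>\<^sup>+y. a k (y, x) \<partial>M) \<partial>I01) = (\<integral>\<^sup>+x. \<integral>\<^sup>+y. (\<Sum>k. a k (y, x)) \<partial>M \<partial>I01)"
    by (intro nn_integral_cong nn_integral_suminf[symmetric]) measurable
  also have "\<dots> = (\<integral>\<^sup>+p. (\<Sum>k. a k p) \<partial>(M \<Otimes>\<^sub>M I01))" by (rule nn_integral_snd) measurable
  finally have ae2: "AE x in I01. (\<Sum>k. \<integral>\<^sup>+y. a k (y, x) \<partial>M) \<noteq> \<infinity>"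
    using fin by (intro nn_integral_PInf_AE) auto
  then have 2: "AE x in I01. (\<lambda>k. \<integral>\<^sup>+y. a k (y, x) \<partial>M) \<longlonglongrightarrow> 0"
    by eventually_elim (rule tend)
  have 4: "AE x in I01. AE y in M. (\<lambda>k. U (r k) (y, x)) \<longlonglongrightarrow> G (y, x)"
    using ae2
  proof eventually_elim
    case (elim x)
    have "(\<integral>\<^sup>+y. (\<Sum>k. a k (y, x)) \<partial>M) = (\<Sum>k. \<integral>\<^sup>+y. a k (y, x) \<partial>M)"
      by (rule nn_integral_suminf) measurable
    with elim have "AE y in M. (\<Sum>k. a k (y, x)) \<noteq> \<infinity>"
      by (intro nn_integral_PInf_AE) auto
    then show ?case
    proof eventually_elim
      case (elim y)
      have "(\<lambda>k. ennreal ((norm (U (r k) (y, x) - G (y, x)))\<^sup>2)) \<longlonglongrightarrow> ennreal 0"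
        using tend[OF elim] by (simp add: a_def)
      then have "(\<lambda>k. (norm (U (r k) (y, x) - G (y, x)))\<^sup>2) \<longlonglongrightarrow> 0"
        by (subst (asm) tendsto_ennreal_iff) auto
      then have "(\<lambda>k. sqrt ((norm (U (r k) (y, x) - G (y, x)))\<^sup>2)) \<longlonglongrightarrow> sqrt 0" by (rule tendsto_real_sqrt)
      then have "(\<lambda>k. norm (U (r k) (y, x) - G (y, x))) \<longlonglongrightarrow> 0" by simp
      then have "(\<lambda>k. U (r k) (y, x) - G (y, x)) \<longlonglongrightarrow> 0" by (rule tendsto_norm_zero_cancel)
      then show ?case by (rule LIM_zero_cancel)
    qed
  qed
  have 3: "AE y in M. AE x in I01. (\<lambda>k. U (r k) (y, x)) \<longlonglongrightarrow> G (y, x)"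
    using AE_pair[OF rG(3)] by simp
  show ?thesis
  proof (rule that[of r g])
    show "(\<lambda>p. g (fst p) (snd p)) \<in> borel_measurable (M \<Otimes>\<^sub>M borel)"
      using rG(2) measurable_cong_sets[OF sets refl] unfolding g_def by auto
  qed (use rG(1) 1 2 3 4 in \<open>simp_all add: a_def U_def g_def\<close>)
qed

text \<open>Pointwise |f| <= e + |f|^2 / e. A squared integral below e^2 therefore forces a first
  moment of order e.\<close>

lemma I01_le_sq:
  fixes f :: "real \<Rightarrow> 'b::euclidean_space"
  assumes [measurable]: "f \<in> borel_measurable borel" and "e > 0"
  shows "(\<integral>\<^sup>+x. ennreal (norm (f x)) \<partial>I01) \<le> ennreal e + ennreal (1/e) * (\<integral>\<^sup>+x. ennreal ((norm (f x))\<^sup>2) \<partial>I01)"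
proof -
  have "norm (f x) \<le> e + 1/e * (norm (f x))\<^sup>2" for x
  proof -
    have "0 \<le> (norm (f x) - e)\<^sup>2" "0 \<le> e * norm (f x)" using assms(2) by auto
    then have "e * norm (f x) \<le> e * e + (norm (f x))\<^sup>2"
      unfolding power2_diff by (simp add: power2_eq_square algebra_simps)
    then show ?thesis using assms(2) by (simp add: field_simps)
  qed
  then have "(\<integral>\<^sup>+x. ennreal (norm (f x)) \<partial>I01) \<le> (\<integral>\<^sup>+x. ennreal e + ennreal (1/e) * ennreal ((norm (f x))\<^sup>2) \<partial>I01)"
    using assms(2) by (intro nn_integral_mono) (simp flip: ennreal_mult ennreal_plus)
  also have "\<dots> = (\<integral>\<^sup>+x. ennreal e \<partial>I01) + ennreal (1/e) * (\<integral>\<^sup>+x. ennreal ((norm (f x))\<^sup>2) \<partial>I01)"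
    by (subst nn_integral_add) (auto simp: nn_integral_cmult)
  also have "(\<integral>\<^sup>+x. ennreal e \<partial>I01) = ennreal e" by (simp add: emeasure_I01)
  finally show ?thesis .
qed

lemma I01_sq_integrable:
  fixes f :: "real \<Rightarrow> 'b::euclidean_space"
  assumes [measurable]: "f \<in> borel_measurable borel" and "(\<integral>\<^sup>+x. ennreal ((norm (f x))\<^sup>2) \<partial>I01) < \<infinity>"
  shows "integrable I01 f"
proof (rule integrableI_bounded)
  show "(\<integral>\<^sup>+x. ennreal (norm (f x)) \<partial>I01) < \<infinity>"
    using I01_le_sq[OF assms(1), of 1] assms(2) by (simp add: le_less_trans)
qed simp

lemma dq_measurable: "dq n u \<in> borel_measurable borel" for u :: "real \<Rightarrow> 'b::euclidean_space"
  by (rule borel_measurable_dq[of "\<lambda>_. u" "count_space UNIV" "\<lambda>_. ()" borel "\<lambda>x. x" n]) auto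

lemma dq_integral:
  fixes u :: "real \<Rightarrow> 'b::euclidean_space"
  assumes "n \<le> m"
  shows "has_bochner_integral lborel (\<lambda>x. indicator {0..<real i / 2 ^ n} x *\<^sub>R dq m u x) (u (real i / 2 ^ n) - u 0)"
proof -
  obtain k where m: "m = n + k" using assms le_Suc_ex by blast
  have "(\<Sum>j<i * 2 ^ k. (1 / 2 ^ m) *\<^sub>R dq m u (real j / 2 ^ m)) = (\<Sum>j<i * 2 ^ k. u (real (Suc j) / 2 ^ m) - u (real j / 2 ^ m))"
    by (simp add: dq_at)
  also have "\<dots> = u (real (i * 2 ^ k) / 2 ^ m) - u 0"
    using sum_lessThan_telescope[of "\<lambda>j. u (real j / 2 ^ m)" "i * 2 ^ k"] by simp
  also have "real (i * 2 ^ k) / 2 ^ m = real i / 2 ^ n" by (simp add: m power_add)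
  finally show ?thesis
    using cellwise_integral[OF cellwise_dq[OF order_refl, of m u], of "i * 2 ^ k"]
    by (simp add: m power_add)
qed

text \<open>At a dyadic point the integral of \<open>dq\<close> equals the increment of
  \<open>u\<close> exactly, at every finer level. So the identity passes to the L2 limit at dyadic
  points, and continuity of \<open>u\<close> carries it to all others.\<close>

lemma dyadic_FTC:
  fixes u :: "real \<Rightarrow> 'b::euclidean_space"
  assumes cont: "continuous_on {0..1} u" and sm: "strict_mono (r::nat \<Rightarrow> nat)"
    and gm [measurable]: "g \<in> borel_measurable borel"
    and lim: "(\<lambda>k. \<integral>\<^sup>+x. ennreal ((norm (dq (r k) u x - g x))\<^sup>2) \<partial>I01) \<longlonglongrightarrow> 0"
    and int: "integrable I01 g"
    and b: "b \<in> {0..1}"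
  shows "(LINT x:{0..b}|lborel. g x) = u b - u 0"
proof -
  note [measurable] = dq_measurable
  have int01: "integrable lborel (\<lambda>x. indicator {0..1} x *\<^sub>R g x)"
    using int by (simp add: integrable_I01 set_integrable_def)
  have intA: "integrable lborel (\<lambda>x. indicator A x *\<^sub>R g x)" if "A \<subseteq> {0..1}" "A \<in> sets borel" for A
    using set_integrable_subset[of lborel "{0..1}" g A] int01 that by (simp add: set_integrable_def)
  have dy: "(\<integral>x. indicator {0..<real i / 2 ^ n} x *\<^sub>R g x \<partial>lborel) = u (real i / 2 ^ n) - u 0" if "i \<le> 2 ^ n" for i n
  proof -
    let ?b = "real i / 2 ^ n"
    let ?I = "\<integral>x. indicator {0..<?b} x *\<^sub>R g x \<partial>lborel"
    have b1: "?b \<le> 1" using that by simp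
    have sub: "{0..<?b} \<subseteq> {0..1}"
    proof
      fix x assume "x \<in> {0..<?b}"
      then have "0 \<le> x" "x < ?b" by auto
      then show "x \<in> {0..1}" unfolding atLeastAtMost_iff using b1 by linarith
    qed
    have bd: "norm (u ?b - u 0 - ?I) \<le> e" if "e > 0" for e
    proof -
      \<comment> \<open>With the threshold (e/2)^2, the bound \<open>I01_le_sq\<close> at e/2 yields
        e/2 + e/2.\<close>
      have ev: "eventually (\<lambda>k. (\<integral>\<^sup>+x. ennreal ((norm (dq (r k) u x - g x))\<^sup>2) \<partial>I01) < ennreal ((e/2) * (e/2))) sequentially"
        using order_tendstoD(2)[OF lim] \<open>e > 0\<close> by simp
      have "eventually (\<lambda>k. k \<ge> n) sequentially" by (rule eventually_ge_at_top)
      with ev obtain k where k: "k \<ge> n" "(\<integral>\<^sup>+x. ennreal ((norm (dq (r k) u x - g x))\<^sup>2) \<partial>I01) < ennreal ((e/2) * (e/2))"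
        using eventually_happens'[OF sequentially_bot eventually_conj] by blast
      have rk: "n \<le> r k" using k(1) seq_suble[OF sm, of k] by simp
      note h = dq_integral[OF rk, of i u]
      have eq: "u ?b - u 0 - ?I = (\<integral>x. indicator {0..<?b} x *\<^sub>R dq (r k) u x - indicator {0..<?b} x *\<^sub>R g x \<partial>lborel)"
        using h intA[OF sub] by (subst Bochner_Integration.integral_diff) (auto simp: has_bochner_integral_iff)
      have "ennreal (norm (u ?b - u 0 - ?I)) \<le> (\<integral>\<^sup>+x. norm (indicator {0..<?b} x *\<^sub>R dq (r k) u x - indicator {0..<?b} x *\<^sub>R g x) \<partial>lborel)"
        unfolding eq using h intA[OF sub] by (intro integral_norm_bound_ennreal Bochner_Integration.integrable_diff) (auto simp: has_bochner_integral_iff)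
      also have "\<dots> \<le> (\<integral>\<^sup>+x. ennreal (norm (dq (r k) u x - g x)) * indicator {0..1} x \<partial>lborel)"
        using subsetD[OF sub] by (intro nn_integral_mono) (simp add: indicator_def del: atLeastLessThan_iff atLeastAtMost_iff)
      also have "\<dots> = (\<integral>\<^sup>+x. ennreal (norm (dq (r k) u x - g x)) \<partial>I01)"
        by (rule nn_integral_I01[symmetric]) measurable
      also have "\<dots> \<le> ennreal (e/2) + ennreal (1/(e/2)) * (\<integral>\<^sup>+x. ennreal ((norm (dq (r k) u x - g x))\<^sup>2) \<partial>I01)"
        using \<open>e > 0\<close> by (intro I01_le_sq) auto
      also have "\<dots> \<le> ennreal (e/2) + ennreal (1/(e/2)) * ennreal ((e/2) * (e/2))"
        using k by (intro add_left_mono mult_left_mono) auto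
      also have "\<dots> = ennreal e" using \<open>e > 0\<close> by (simp flip: ennreal_mult ennreal_plus)
      finally show ?thesis using \<open>e > 0\<close> by simp
    qed
    have "norm (u ?b - u 0 - ?I) \<le> 0" by (rule field_le_epsilon) (use bd in auto)
    then show ?thesis by simp
  qed
  \<comment> \<open>Dyadic points approaching \<open>b\<close> from below.\<close>
  define c where "c n = real (nat \<lfloor>2 ^ n * b\<rfloor>) / 2 ^ n" for n
  have c: "nat \<lfloor>2 ^ n * b\<rfloor> \<le> 2 ^ n" "c n \<le> b" "b - (1/2) ^ n \<le> c n" "c n \<in> {0..1}" for n
  proof -
    have fl: "real (nat \<lfloor>2 ^ n * b\<rfloor>) \<le> 2 ^ n * b" "2 ^ n * b - 1 \<le> real (nat \<lfloor>2 ^ n * b\<rfloor>)" using b by (auto)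
    have "2 ^ n * b \<le> 2 ^ n * 1" using b by (intro mult_left_mono) auto
    then have "real (nat \<lfloor>2 ^ n * b\<rfloor>) \<le> real (2 ^ n)"
      unfolding of_nat_power of_nat_numeral using fl(1) by linarith
    then show "nat \<lfloor>2 ^ n * b\<rfloor> \<le> 2 ^ n" by (simp only: of_nat_le_iff)
    show cb: "c n \<le> b" using fl(1) unfolding c_def by (simp add: field_simps)
    have "(2 ^ n * b - 1) / 2 ^ n \<le> c n" unfolding c_def using fl(2) by (intro divide_right_mono) auto
    then show "b - (1/2) ^ n \<le> c n" by (simp add: diff_divide_distrib power_one_over)
    show "c n \<in> {0..1}" proof -
      have "0 \<le> c n" by (simp add: c_def)
      then show ?thesis using cb b by simp
    qed
  qed
  have clim: "c \<longlonglongrightarrow> b"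
  proof (rule tendsto_sandwich[of "\<lambda>n. b - (1/2) ^ n" _ _ "\<lambda>_. b"])
    have "(\<lambda>n. b - (1/2) ^ n) \<longlonglongrightarrow> b - 0" by (intro tendsto_intros) auto
    then show "(\<lambda>n. b - (1/2) ^ n) \<longlonglongrightarrow> b" by simp
  qed (use c in auto)
  have "(\<lambda>n. u (c n)) \<longlonglongrightarrow> u b"
    using cont b c(4) clim unfolding continuous_on_sequentially comp_def by blast
  then have "(\<lambda>n. u (c n) - u 0) \<longlonglongrightarrow> u b - u 0" by (intro tendsto_intros)
  moreover have "u (c n) - u 0 = (\<integral>x. indicator {0..<c n} x *\<^sub>R g x \<partial>lborel)" for n
    unfolding c_def using dy[OF c(1)] by simp
  ultimately have 1: "(\<lambda>n. \<integral>x. indicator {0..<c n} x *\<^sub>R g x \<partial>lborel) \<longlonglongrightarrow> u b - u 0" by simp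
  have 2: "(\<lambda>n. \<integral>x. indicator {0..<c n} x *\<^sub>R g x \<partial>lborel) \<longlonglongrightarrow> (\<integral>x. indicator {0..b} x *\<^sub>R g x \<partial>lborel)"
  proof (rule integral_dominated_convergence[where w="\<lambda>x. norm (indicator {0..1} x *\<^sub>R g x)"])
    show "integrable lborel (\<lambda>x. norm (indicator {0..1} x *\<^sub>R g x))" using int01 by (rule integrable_norm)
    have "AE x in lborel. x \<noteq> b" by (rule AE_lborel_singleton)
    then show "AE x in lborel. (\<lambda>n. indicator {0..<c n} x *\<^sub>R g x) \<longlonglongrightarrow> indicator {0..b} x *\<^sub>R g x"
    proof eventually_elim
      case (elim x)
      have "eventually (\<lambda>n. indicator {0..<c n} x *\<^sub>R g x = indicator {0..b} x *\<^sub>R g x) sequentially"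
      proof (cases "x < b")
        case True
        then have "eventually (\<lambda>n. x < c n) sequentially" using order_tendstoD(1)[OF clim] by simp
        then show ?thesis by eventually_elim (use True in \<open>auto simp: indicator_def\<close>)
      next
        case False
        then have "b < x" using elim by simp
        have "indicator {0..<c n} x *\<^sub>R g x = indicator {0..b} x *\<^sub>R g x" for n
          using c(2)[of n] \<open>b < x\<close> by (simp add: indicator_def)
        then show ?thesis by simp
      qed
      then show ?case by (rule tendsto_eventually)
    qed
    show "AE x in lborel. norm (indicator {0..<c n} x *\<^sub>R g x) \<le> norm (indicator {0..1} x *\<^sub>R g x)" for n
      using c(4)[of n] by (auto simp: indicator_def)
  qed measurable
  show ?thesis unfolding set_lebesgue_integral_def using LIMSEQ_unique[OF 1 2] by simp
qed

text \<open>Fatou along the subsequence: an energy bound uniform in the level survives the limit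
  with the same constant.\<close>

lemma dyadic_sq_bound:
  fixes u :: "real \<Rightarrow> 'b::euclidean_space"
  assumes gm [measurable]: "g \<in> borel_measurable borel"
    and lim: "AE x in I01. (\<lambda>k. dq (r k) u x) \<longlonglongrightarrow> g x"
    and C: "\<And>n. (\<integral>\<^sup>+x. ennreal ((norm (dq n u x))\<^sup>2) \<partial>I01) \<le> C"
  shows "(\<integral>\<^sup>+x. ennreal ((norm (g x))\<^sup>2) \<partial>I01) \<le> C"
proof -
  note [measurable] = dq_measurable
  have "(\<integral>\<^sup>+x. ennreal ((norm (g x))\<^sup>2) \<partial>I01) = (\<integral>\<^sup>+x. liminf (\<lambda>k. ennreal ((norm (dq (r k) u x))\<^sup>2)) \<partial>I01)"
  proof (rule nn_integral_cong_AE)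
    show "AE x in I01. ennreal ((norm (g x))\<^sup>2) = liminf (\<lambda>k. ennreal ((norm (dq (r k) u x))\<^sup>2))"
      using lim
    proof eventually_elim
      case (elim x)
      have "(\<lambda>k. ennreal ((norm (dq (r k) u x))\<^sup>2)) \<longlonglongrightarrow> ennreal ((norm (g x))\<^sup>2)"
        by (intro tendsto_intros elim)
      from lim_imp_Liminf[OF _ this] show ?case by simp
    qed
  qed
  also have "\<dots> \<le> liminf (\<lambda>k. \<integral>\<^sup>+x. ennreal ((norm (dq (r k) u x))\<^sup>2) \<partial>I01)"
    by (rule nn_integral_liminf) measurable
  also have "\<dots> \<le> liminf (\<lambda>k::nat. C)" by (rule Liminf_mono) (use C in auto)
  also have "\<dots> = C" by (simp add: Liminf_const)
  finally show ?thesis .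
qed

section \<open>Integration by parts\<close>

lemma integrable_lborel_tensor:
  fixes f g :: "real \<Rightarrow> real"
  assumes f: "integrable lborel f" and g: "integrable lborel g"
  shows "integrable (lborel \<Otimes>\<^sub>M lborel) (\<lambda>(r, s). f r * g s)"
proof (rule lborel_pair.Fubini_integrable)
  have [measurable]: "f \<in> borel_measurable borel" "g \<in> borel_measurable borel"
    using borel_measurable_integrable[OF f] borel_measurable_integrable[OF g] by simp_all
  show "(\<lambda>(r, s). f r * g s) \<in> borel_measurable (lborel \<Otimes>\<^sub>M lborel)" by measurable
  have "(\<lambda>r. \<integral>s. norm (case (r, s) of (r, s) \<Rightarrow> f r * g s) \<partial>lborel) = (\<lambda>r. \<bar>f r\<bar> * (\<integral>s. \<bar>g s\<bar> \<partial>lborel))"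
    by (auto simp: abs_mult)
  then show "integrable lborel (\<lambda>r. \<integral>s. norm (case (r, s) of (r, s) \<Rightarrow> f r * g s) \<partial>lborel)"
    using f by auto
  show "AE r in lborel. integrable lborel (\<lambda>s. case (r, s) of (r, s) \<Rightarrow> f r * g s)"
    using g by auto
qed

text \<open>Fubini on the two triangles r <= s and s <= r, which overlap only in the null diagonal.
  This is integration by parts for primitives of integrable functions, with no differentiation at
  points.\<close>

lemma integral_product_split:
  fixes f g :: "real \<Rightarrow> real"
  assumes f: "integrable lborel f" and g: "integrable lborel g"
  shows "integrable lborel (\<lambda>s. (\<integral>r. indicator {..s} r * f r \<partial>lborel) * g s)"
    and "integrable lborel (\<lambda>r. f r * (\<integral>s. indicator {..r} s * g s \<partial>lborel))"
    and "(\<integral>s. (\<integral>r. indicator {..s} r * f r \<partial>lborel) * g s \<partial>lborel)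
       + (\<integral>r. f r * (\<integral>s. indicator {..r} s * g s \<partial>lborel) \<partial>lborel) = (\<integral>r. f r \<partial>lborel) * (\<integral>s. g s \<partial>lborel)"
proof -
  have [measurable]: "f \<in> borel_measurable borel" "g \<in> borel_measurable borel"
    using borel_measurable_integrable[OF f] borel_measurable_integrable[OF g] by simp_all
  let ?P = "lborel \<Otimes>\<^sub>M lborel :: (real \<times> real) measure"
  let ?H = "\<lambda>(r, s). f r * g s"
  let ?H1 = "\<lambda>(r, s). indicator {..s} r * (f r * g s)"
  let ?H2 = "\<lambda>(r, s). indicator {..r} s * (f r * g s)"
  note H = integrable_lborel_tensor[OF f g]
  have [measurable]: "(\<lambda>p::real\<times>real. indicator {..snd p} (fst p) :: real) \<in> borel_measurable (borel \<Otimes>\<^sub>M borel)"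
       "(\<lambda>p::real\<times>real. indicator {..fst p} (snd p) :: real) \<in> borel_measurable (borel \<Otimes>\<^sub>M borel)"
    unfolding indicator_def atMost_iff by measurable
  have H1: "integrable ?P ?H1"
    by (rule Bochner_Integration.integrable_bound[OF H]) (auto simp: case_prod_beta indicator_def)
  have H2: "integrable ?P ?H2"
    by (rule Bochner_Integration.integrable_bound[OF H]) (auto simp: case_prod_beta indicator_def)
  have e1: "(\<lambda>s. \<integral>r. indicator {..s} r * (f r * g s) \<partial>lborel) = (\<lambda>s. (\<integral>r. indicator {..s} r * f r \<partial>lborel) * g s)"
    by (simp add: mult.assoc[symmetric])
  have e2: "(\<lambda>r. \<integral>s. indicator {..r} s * (f r * g s) \<partial>lborel) = (\<lambda>r. f r * (\<integral>s. indicator {..r} s * g s \<partial>lborel))"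
    by (simp add: mult.left_commute)
  show i1: "integrable lborel (\<lambda>s. (\<integral>r. indicator {..s} r * f r \<partial>lborel) * g s)"
    using lborel_pair.integrable_snd[OF H1] unfolding e1 .
  show i2: "integrable lborel (\<lambda>r. f r * (\<integral>s. indicator {..r} s * g s \<partial>lborel))"
    using lborel_pair.integrable_fst[OF H2] unfolding e2 .
  have "(\<integral>s. (\<integral>r. indicator {..s} r * f r \<partial>lborel) * g s \<partial>lborel) = integral\<^sup>L ?P ?H1"
    using lborel_pair.integral_snd[OF H1] unfolding e1 .
  moreover have "(\<integral>r. f r * (\<integral>s. indicator {..r} s * g s \<partial>lborel) \<partial>lborel) = integral\<^sup>L ?P ?H2"
    using lborel_pair.integral_fst[OF H2] unfolding e2 .
  moreover have "integral\<^sup>L ?P ?H1 + integral\<^sup>L ?P ?H2 = integral\<^sup>L ?P ?H"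
  proof (subst Bochner_Integration.integral_add[OF H1 H2, symmetric], rule integral_cong_AE)
    have "AE p in ?P. fst p \<noteq> snd p"
    proof (rule lborel_pair.AE_pair_measure)
      show "{p \<in> space ?P. fst p \<noteq> snd p} \<in> sets ?P" by measurable
      have "AE s in lborel. r \<noteq> s" for r :: real
        using AE_lborel_singleton[of r] by eventually_elim simp
      then show "AE r in lborel. AE s in lborel. fst (r, s) \<noteq> snd (r, s :: real)" by simp
    qed
    then show "AE p in ?P. ?H1 p + ?H2 p = ?H p"
      by eventually_elim (auto simp: case_prod_beta indicator_def)
  qed measurable
  moreover have "integral\<^sup>L ?P ?H = (\<integral>r. f r \<partial>lborel) * (\<integral>s. g s \<partial>lborel)"
    using lborel_pair.integral_fst[OF H] by simp
  ultimately show "(\<integral>s. (\<integral>r. indicator {..s} r * f r \<partial>lborel) * g s \<partial>lborel)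
       + (\<integral>r. f r * (\<integral>s. indicator {..r} s * g s \<partial>lborel) \<partial>lborel) = (\<integral>r. f r \<partial>lborel) * (\<integral>s. g s \<partial>lborel)"
    by simp
qed

text \<open>Extension of \<open>f\<close> and \<open>g\<close> by zero reduces the claim to the two
  triangles; the constants \<open>F 0\<close> and \<open>G 0\<close> account for the boundary
  terms.\<close>

lemma ibp_real:
  fixes f g F G :: "real \<Rightarrow> real"
  assumes f: "set_integrable lborel {0..b} f" and g: "set_integrable lborel {0..b} g" and b: "0 \<le> b"
    and F: "\<And>x. x \<in> {0..b} \<Longrightarrow> F x = F 0 + (LINT r:{0..x}|lborel. f r)"
    and G: "\<And>x. x \<in> {0..b} \<Longrightarrow> G x = G 0 + (LINT r:{0..x}|lborel. g r)"
  shows "set_integrable lborel {0..b} (\<lambda>x. F x * g x)" (is ?A) "set_integrable lborel {0..b} (\<lambda>x. f x * G x)" (is ?B)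
    and "(LINT x:{0..b}|lborel. F x * g x) + (LINT x:{0..b}|lborel. f x * G x) = F b * G b - F 0 * G 0" (is ?C)
proof -
  define f' where "f' x = indicator {0..b} x * f x" for x
  define g' where "g' x = indicator {0..b} x * g x" for x
  have f': "integrable lborel f'" and g': "integrable lborel g'"
    using f g unfolding set_integrable_def f'_def g'_def by simp_all
  have F': "(\<integral>r. indicator {..x} r * f' r \<partial>lborel) = F x - F 0" if "x \<in> {0..b}" for x
  proof -
    have "(\<integral>r. indicator {..x} r * f' r \<partial>lborel) = (LINT r:{0..x}|lborel. f r)"
      unfolding set_lebesgue_integral_def f'_def
      by (rule Bochner_Integration.integral_cong) (use that in \<open>auto simp: indicator_def\<close>)
    then show ?thesis using F[OF that] by simp
  qed
  have G': "(\<integral>r. indicator {..x} r * g' r \<partial>lborel) = G x - G 0" if "x \<in> {0..b}" for x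
  proof -
    have "(\<integral>r. indicator {..x} r * g' r \<partial>lborel) = (LINT r:{0..x}|lborel. g r)"
      unfolding set_lebesgue_integral_def g'_def
      by (rule Bochner_Integration.integral_cong) (use that in \<open>auto simp: indicator_def\<close>)
    then show ?thesis using G[OF that] by simp
  qed
  have If: "(\<integral>r. f' r \<partial>lborel) = F b - F 0" and Ig: "(\<integral>r. g' r \<partial>lborel) = G b - G 0"
    using F[of b] G[of b] b by (simp_all add: f'_def g'_def set_lebesgue_integral_def)
  have e1: "(\<lambda>s. (\<integral>r. indicator {..s} r * f' r \<partial>lborel) * g' s) = (\<lambda>s. indicator {0..b} s * (F s * g s) - F 0 * g' s)"
  proof
    fix s
    show "(\<integral>r. indicator {..s} r * f' r \<partial>lborel) * g' s = indicator {0..b} s * (F s * g s) - F 0 * g' s"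
      by (cases "s \<in> {0..b}") (simp_all add: F' g'_def left_diff_distrib del: atLeastAtMost_iff)
  qed
  have e2: "(\<lambda>s. f' s * (\<integral>r. indicator {..s} r * g' r \<partial>lborel)) = (\<lambda>s. indicator {0..b} s * (f s * G s) - G 0 * f' s)"
  proof
    fix s
    show "f' s * (\<integral>r. indicator {..s} r * g' r \<partial>lborel) = indicator {0..b} s * (f s * G s) - G 0 * f' s"
      by (cases "s \<in> {0..b}") (simp_all add: G' f'_def right_diff_distrib del: atLeastAtMost_iff)
  qed
  note P = integral_product_split[OF f' g', unfolded e1 e2]
  have A: "integrable lborel (\<lambda>s. indicator {0..b} s * (F s * g s))"
    using Bochner_Integration.integrable_add[OF P(1) integrable_mult_right[OF g', of "F 0"]] by simp
  have B: "integrable lborel (\<lambda>s. indicator {0..b} s * (f s * G s))"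
    using Bochner_Integration.integrable_add[OF P(2) integrable_mult_right[OF f', of "G 0"]] by simp
  show ?A ?B using A B by (simp_all add: set_integrable_def)
  have "(LINT x:{0..b}|lborel. F x * g x) - F 0 * (G b - G 0) + ((LINT x:{0..b}|lborel. f x * G x) - G 0 * (F b - F 0)) = (F b - F 0) * (G b - G 0)"
    using P(3) f' g' A B unfolding If Ig set_lebesgue_integral_def by (simp add: If Ig)
  then show ?C by (simp add: algebra_simps)
qed

lemma ibp_scaleR:
  fixes f F :: "real \<Rightarrow> real" and g G :: "real \<Rightarrow> 'a::euclidean_space"
  assumes f: "set_integrable lborel {0..b} f" and g: "set_integrable lborel {0..b} g" and b: "0 \<le> b"
    and F: "\<And>x. x \<in> {0..b} \<Longrightarrow> F x = F 0 + (LINT r:{0..x}|lborel. f r)"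
    and G: "\<And>x. x \<in> {0..b} \<Longrightarrow> G x = G 0 + (LINT r:{0..x}|lborel. g r)"
  shows "set_integrable lborel {0..b} (\<lambda>x. F x *\<^sub>R g x)" (is ?A) "set_integrable lborel {0..b} (\<lambda>x. f x *\<^sub>R G x)" (is ?B)
    and "(LINT x:{0..b}|lborel. F x *\<^sub>R g x) + (LINT x:{0..b}|lborel. f x *\<^sub>R G x) = F b *\<^sub>R G b - F 0 *\<^sub>R G 0" (is ?C)
proof -
  have gi: "set_integrable lborel {0..b} (\<lambda>x. g x \<bullet> i)" for i
  proof -
    have "integrable lborel (\<lambda>x. (indicator {0..b} x *\<^sub>R g x) \<bullet> i)"
      by (intro integrable_inner_left) (use g in \<open>simp add: set_integrable_def\<close>)
    then show ?thesis by (simp add: set_integrable_def)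
  qed
  have Gi: "G x \<bullet> i = G 0 \<bullet> i + (LINT r:{0..x}|lborel. g r \<bullet> i)" if "x \<in> {0..b}" for x i
  proof -
    have "set_integrable lborel {0..x} g" by (rule set_integrable_subset[OF g]) (use that in auto)
    then have "(LINT r:{0..x}|lborel. g r) \<bullet> i = (LINT r:{0..x}|lborel. g r \<bullet> i)"
      unfolding set_integrable_def set_lebesgue_integral_def by (subst integral_inner_left[symmetric]) auto
    then show ?thesis by (subst G[OF that]) (simp add: inner_add_left)
  qed
  note I = ibp_real[OF f gi b F Gi]
  have comp: "integrable lborel h" if "\<And>i. integrable lborel (\<lambda>x. h x \<bullet> i)" for h :: "real \<Rightarrow> 'a"
  proof -
    have "integrable lborel (\<lambda>x. \<Sum>i\<in>Basis. (h x \<bullet> i) *\<^sub>R i)"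
      by (intro Bochner_Integration.integrable_sum integrable_scaleR_left that)
    then show ?thesis by (simp add: euclidean_representation)
  qed
  show A: ?A unfolding set_integrable_def
    by (rule comp) (use I(1) in \<open>simp add: set_integrable_def mult.assoc\<close>)
  show B: ?B unfolding set_integrable_def
    by (rule comp) (use I(2) in \<open>simp add: set_integrable_def mult.assoc\<close>)
  show ?C
  proof (rule euclidean_eqI)
    fix i :: 'a
    have "(LINT x:{0..b}|lborel. F x *\<^sub>R g x) \<bullet> i = (LINT x:{0..b}|lborel. F x * (g x \<bullet> i))"
      using A unfolding set_integrable_def set_lebesgue_integral_def
      by (subst integral_inner_left[symmetric]) (auto simp: mult.assoc)
    moreover have "(LINT x:{0..b}|lborel. f x *\<^sub>R G x) \<bullet> i = (LINT x:{0..b}|lborel. f x * (G x \<bullet> i))"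
      using B unfolding set_integrable_def set_lebesgue_integral_def
      by (subst integral_inner_left[symmetric]) (auto simp: mult.assoc)
    ultimately show "((LINT x:{0..b}|lborel. F x *\<^sub>R g x) + (LINT x:{0..b}|lborel. f x *\<^sub>R G x)) \<bullet> i = (F b *\<^sub>R G b - F 0 *\<^sub>R G 0) \<bullet> i"
      using I(3)[of i] by (simp add: inner_add_left inner_diff_left)
  qed
qed

lemma ibp_inner:
  fixes f F g G :: "real \<Rightarrow> 'a::euclidean_space"
  assumes f: "set_integrable lborel {0..b} f" and g: "set_integrable lborel {0..b} g" and b: "0 \<le> b"
    and F: "\<And>x. x \<in> {0..b} \<Longrightarrow> F x = F 0 + (LINT r:{0..x}|lborel. f r)"
    and G: "\<And>x. x \<in> {0..b} \<Longrightarrow> G x = G 0 + (LINT r:{0..x}|lborel. g r)"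
  shows "set_integrable lborel {0..b} (\<lambda>x. F x \<bullet> g x)" (is ?A) "set_integrable lborel {0..b} (\<lambda>x. f x \<bullet> G x)" (is ?B)
    and "(LINT x:{0..b}|lborel. F x \<bullet> g x) + (LINT x:{0..b}|lborel. f x \<bullet> G x) = F b \<bullet> G b - F 0 \<bullet> G 0" (is ?C)
proof -
  have comp: "set_integrable lborel {0..b} (\<lambda>x. h x \<bullet> i)"
    "x \<in> {0..b} \<Longrightarrow> H x \<bullet> i = H 0 \<bullet> i + (LINT r:{0..x}|lborel. h r \<bullet> i)"
    if h: "set_integrable lborel {0..b} h" and H: "\<And>x. x \<in> {0..b} \<Longrightarrow> H x = H 0 + (LINT r:{0..x}|lborel. h r)"
    for h H :: "real \<Rightarrow> 'a" and i x
  proof -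
    have "integrable lborel (\<lambda>x. (indicator {0..b} x *\<^sub>R h x) \<bullet> i)"
      by (intro integrable_inner_left) (use h in \<open>simp add: set_integrable_def\<close>)
    then show "set_integrable lborel {0..b} (\<lambda>x. h x \<bullet> i)" by (simp add: set_integrable_def)
    assume x: "x \<in> {0..b}"
    have "set_integrable lborel {0..x} h" by (rule set_integrable_subset[OF h]) (use x in auto)
    then have "(LINT r:{0..x}|lborel. h r) \<bullet> i = (LINT r:{0..x}|lborel. h r \<bullet> i)"
      unfolding set_integrable_def set_lebesgue_integral_def by (subst integral_inner_left[symmetric]) auto
    then show "H x \<bullet> i = H 0 \<bullet> i + (LINT r:{0..x}|lborel. h r \<bullet> i)" by (subst H[OF x]) (simp add: inner_add_left)
  qed
  note I = ibp_real[OF comp(1)[OF f F] comp(1)[OF g G] b comp(2)[OF f F] comp(2)[OF g G]]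
  have e: "x \<bullet> y = (\<Sum>i\<in>Basis. (x \<bullet> i) * (y \<bullet> i))" for x y :: 'a by (rule euclidean_inner)
  have eF: "F x \<bullet> g x = (\<Sum>i\<in>Basis. (F x \<bullet> i) * (g x \<bullet> i))" for x by (rule e)
  have ef: "f x \<bullet> G x = (\<Sum>i\<in>Basis. (f x \<bullet> i) * (G x \<bullet> i))" for x by (rule e)
  show A: ?A unfolding set_integrable_def eF sum_distrib_left real_scaleR_def
    by (intro Bochner_Integration.integrable_sum) (use I(1) in \<open>simp add: set_integrable_def\<close>)
  show B: ?B unfolding set_integrable_def ef sum_distrib_left real_scaleR_def
    by (intro Bochner_Integration.integrable_sum) (use I(2) in \<open>simp add: set_integrable_def\<close>)
  have "(LINT x:{0..b}|lborel. F x \<bullet> g x) = (\<Sum>i\<in>Basis. LINT x:{0..b}|lborel. (F x \<bullet> i) * (g x \<bullet> i))"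
    unfolding eF set_lebesgue_integral_def sum_distrib_left real_scaleR_def
    by (rule Bochner_Integration.integral_sum) (use I(1) in \<open>simp add: set_integrable_def\<close>)
  moreover have "(LINT x:{0..b}|lborel. f x \<bullet> G x) = (\<Sum>i\<in>Basis. LINT x:{0..b}|lborel. (f x \<bullet> i) * (G x \<bullet> i))"
    unfolding ef set_lebesgue_integral_def sum_distrib_left real_scaleR_def
    by (rule Bochner_Integration.integral_sum) (use I(2) in \<open>simp add: set_integrable_def\<close>)
  ultimately show ?C using I(3)
    by (simp add: e[of "F b" "G b"] e[of "F 0" "G 0"] sum.distrib[symmetric] sum_subtractf[symmetric])
qed

section \<open>The pre-Hilbert space of continuous closed curves\<close>

lemma continuous_integrable_I01:
  fixes f :: "real \<Rightarrow> 'b::euclidean_space"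
  assumes "continuous_on UNIV f"
  shows "integrable I01 f"
proof -
  have [measurable]: "f \<in> borel_measurable borel" by (rule borel_measurable_continuous_onI[OF assms])
  show ?thesis
    unfolding integrable_I01[OF \<open>f \<in> _\<close>] set_integrable_def
    by (rule borel_integrable_compact) (auto intro: continuous_on_subset[OF assms])
qed

lemma periodic_frac:
  assumes "\<And>s. f (s + 1) = f s"
  shows "f (s::real) = f (frac s)"
proof -
  interpret periodic_fun_simple' f by unfold_locales (rule assms)
  show ?thesis by (metis frac_def minus_of_int)
qed

text \<open>Continuous representatives make the L2 form definite, so that the type becomes an inner
  product space without a quotient by null functions. Point evaluation remains available.\<close>

typedef (overloaded) ('a::euclidean_space) cper =
  "{f :: real \<Rightarrow> 'a. continuous_on UNIV f \<and> (\<forall>s. f (s + 1) = f s)}"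
  morphisms ev Cper
  by (rule exI[of _ "\<lambda>_. 0"]) auto

setup_lifting type_definition_cper

lemma ev_cont: "continuous_on A (ev f)"
  using ev[of f] by (auto intro: continuous_on_subset)

lemma ev_periodic: "ev f (s + 1) = ev f s"
  using ev[of f] by auto

lemma ev_frac: "ev f s = ev f (frac s)"
  by (rule periodic_frac) (rule ev_periodic)

lemma borel_measurable_ev [measurable]: "ev f \<in> borel_measurable borel"
  by (rule borel_measurable_continuous_onI[OF ev_cont])

lemma integrable_ev_inner: "integrable I01 (\<lambda>s. ev f s \<bullet> ev g s)"
  by (intro continuous_integrable_I01 continuous_intros ev_cont)

lemma integral_sq_eq_0:
  fixes f :: "real \<Rightarrow> 'b::euclidean_space"
  assumes "continuous_on UNIV f" "(\<integral>s. f s \<bullet> f s \<partial>I01) = 0" "s \<in> {0..1}"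
  shows "f s = 0"
proof -
  have [measurable]: "f \<in> borel_measurable borel" by (rule borel_measurable_continuous_onI[OF assms(1)])
  have c: "continuous_on UNIV (\<lambda>s. f s \<bullet> f s)" by (intro continuous_intros assms)
  have "(LINT s:{0..1}|lborel. f s \<bullet> f s) = 0"
    using assms(2) by (subst (asm) integral_I01) auto
  moreover have "set_integrable lborel {0..1} (\<lambda>s. f s \<bullet> f s)"
    using continuous_integrable_I01[OF c] by (subst (asm) integrable_I01) auto
  ultimately have "((\<lambda>s. f s \<bullet> f s) has_integral 0) {0..1}"
    using set_borel_integral_eq_integral[of "{0..1}" "\<lambda>s. f s \<bullet> f s"] by (simp add: has_integral_iff)
  then have "f s \<bullet> f s = 0"
    by (intro has_integral_0_cbox_imp_0[of 0 1 "\<lambda>s. f s \<bullet> f s"])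
      (use assms(3) in \<open>auto intro: continuous_on_subset[OF c]\<close>)
  then show ?thesis by simp
qed

instantiation cper :: (euclidean_space) real_vector
begin

lift_definition zero_cper :: "'a cper" is "\<lambda>_. 0" by simp
lift_definition plus_cper :: "'a cper \<Rightarrow> 'a cper \<Rightarrow> 'a cper" is "\<lambda>f g s. f s + g s"
  by (auto intro: continuous_intros)
lift_definition minus_cper :: "'a cper \<Rightarrow> 'a cper \<Rightarrow> 'a cper" is "\<lambda>f g s. f s - g s"
  by (auto intro: continuous_intros)
lift_definition uminus_cper :: "'a cper \<Rightarrow> 'a cper" is "\<lambda>f s. - f s"
  by (auto intro: continuous_intros)
lift_definition scaleR_cper :: "real \<Rightarrow> 'a cper \<Rightarrow> 'a cper" is "\<lambda>r f s. r *\<^sub>R f s"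
  by (auto intro: continuous_intros)
instance
proof
  fix f g h :: "'a cper" and a b :: real
  show "f + g + h = f + (g + h)" by transfer (simp add: algebra_simps)
  show "f + g = g + f" by transfer (simp add: algebra_simps)
  show "0 + f = f" by transfer simp
  show "- f + f = 0" by transfer simp
  show "f - g = f + - g" by transfer simp
  show "a *\<^sub>R (f + g) = a *\<^sub>R f + a *\<^sub>R g" by transfer (simp add: algebra_simps)
  show "(a + b) *\<^sub>R f = a *\<^sub>R f + b *\<^sub>R f" by transfer (simp add: algebra_simps)
  show "a *\<^sub>R b *\<^sub>R f = (a * b) *\<^sub>R f" by transfer (simp add: algebra_simps)
  show "1 *\<^sub>R f = f" by transfer simp
qed

end

instantiation cper :: (euclidean_space) real_inner
begin

definition inner_cper :: "'a cper \<Rightarrow> 'a cper \<Rightarrow> real" where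
  "inner_cper f g = (\<integral>s. ev f s \<bullet> ev g s \<partial>I01)"
definition norm_cper :: "'a cper \<Rightarrow> real" where "norm_cper f = sqrt (\<integral>s. ev f s \<bullet> ev f s \<partial>I01)"
definition dist_cper :: "'a cper \<Rightarrow> 'a cper \<Rightarrow> real" where "dist_cper f g = norm (f - g)"
definition sgn_cper :: "'a cper \<Rightarrow> 'a cper" where "sgn_cper f = f /\<^sub>R norm f"
definition uniformity_cper :: "('a cper \<times> 'a cper) filter" where
  "uniformity_cper = (INF e\<in>{0 <..}. principal {(x, y). dist x y < e})"
definition open_cper :: "'a cper set \<Rightarrow> bool" where
  "open_cper U \<longleftrightarrow> (\<forall>x\<in>U. eventually (\<lambda>(x', y). x' = x \<longrightarrow> y \<in> U) uniformity)"

instance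
proof
  fix f g h :: "'a cper" and a b :: real and U :: "'a cper set"
  show "dist f g = norm (f - g)" by (rule dist_cper_def)
  show "sgn f = f /\<^sub>R norm f" by (rule sgn_cper_def)
  show "uniformity = (INF e\<in>{0 <..}. principal {(x, y :: 'a cper). dist x y < e})" by (rule uniformity_cper_def)
  show "open U = (\<forall>x\<in>U. eventually (\<lambda>(x', y). x' = x \<longrightarrow> y \<in> U) uniformity)" by (rule open_cper_def)
  show "f \<bullet> g = g \<bullet> f" by (simp add: inner_cper_def inner_commute)
  show "(f + g) \<bullet> h = f \<bullet> h + g \<bullet> h"
    unfolding inner_cper_def plus_cper.rep_eq inner_add_left
    by (rule Bochner_Integration.integral_add) (rule integrable_ev_inner)+
  show "a *\<^sub>R f \<bullet> g = a * (f \<bullet> g)" by (simp add: inner_cper_def scaleR_cper.rep_eq)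
  show "0 \<le> f \<bullet> f" by (simp add: inner_cper_def)
  show "(f \<bullet> f = 0) = (f = 0)"
  proof
    assume "f \<bullet> f = 0"
    then have "ev f s = 0" if "s \<in> {0..1}" for s
      using integral_sq_eq_0[OF ev_cont _ that, of f] by (simp add: inner_cper_def)
    then have "ev f (frac s) = 0" for s
      by (simp add: frac_ge_0 less_imp_le[OF frac_lt_1])
    then have "ev f s = 0" for s using ev_frac[of f s] by simp
    then have "ev f = ev 0" by (simp add: fun_eq_iff zero_cper.rep_eq)
    then show "f = 0" by (simp add: ev_inject)
  next
    assume "f = 0" then show "f \<bullet> f = 0" by (simp add: inner_cper_def zero_cper.rep_eq)
  qed
  show "norm f = sqrt (f \<bullet> f)" by (simp add: norm_cper_def inner_cper_def)
qed

end

lemmas ev_simps = zero_cper.rep_eq plus_cper.rep_eq minus_cper.rep_eq uminus_cper.rep_eq scaleR_cper.rep_eq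

lemma norm_cper_sq: "(norm f)\<^sup>2 = (\<integral>s. (norm (ev f s))\<^sup>2 \<partial>I01)"
  unfolding power2_norm_eq_inner by (simp add: inner_cper_def)

lemma ev_bounded:
  fixes y :: "'a::euclidean_space cper"
  obtains C where "\<And>s. norm (ev y s) \<le> C"
proof -
  have "compact (ev y ` {0..1})" by (intro compact_continuous_image ev_cont) simp
  then have "bounded (ev y ` {0..1})" by (rule compact_imp_bounded)
  then obtain C where C: "\<forall>x\<in>ev y ` {0..1}. norm x \<le> C" unfolding bounded_iff by blast
  have "norm (ev y s) \<le> C" for s
  proof -
    have "ev y (frac s) \<in> ev y ` {0..1}" by (simp add: frac_ge_0 less_imp_le[OF frac_lt_1])
    then show ?thesis using bspec[OF C] ev_frac[of y s] by metis
  qed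
  then show ?thesis by (rule that)
qed

lemma integrable_inner_ev:
  fixes h :: "real \<Rightarrow> 'a::euclidean_space"
  assumes "integrable I01 h"
  shows "integrable I01 (\<lambda>s. h s \<bullet> ev y s)"
proof -
  obtain C where C: "\<And>s. norm (ev y s) \<le> C" using ev_bounded[of y] by blast
  have [measurable]: "h \<in> borel_measurable borel" using borel_measurable_integrable[OF assms] by simp
  show ?thesis
  proof (rule Bochner_Integration.integrable_bound)
    show "integrable I01 (\<lambda>s. C * norm (h s))" using assms by simp
    show "AE s in I01. norm (h s \<bullet> ev y s) \<le> norm (C * norm (h s))"
    proof (rule AE_I2)
      fix s
      have "norm (h s \<bullet> ev y s) \<le> norm (h s) * norm (ev y s)" using Cauchy_Schwarz_ineq2[of "h s"] by simp
      also have "\<dots> \<le> norm (h s) * C" by (intro mult_left_mono C) auto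
      also have "\<dots> \<le> norm (C * norm (h s))" by (simp add: mult.commute)
      finally show "norm (h s \<bullet> ev y s) \<le> norm (C * norm (h s))" .
    qed
  qed measurable
qed

section \<open>The constraint set of 1-Lipschitz closed curves\<close>

definition Lip1 :: "'a::euclidean_space cper set" where
  "Lip1 = {f. \<forall>s s'. norm (ev f s - ev f s') \<le> \<bar>s - s'\<bar>}"

lemma Lip1_convex: "convex Lip1"
proof (rule convexI)
  fix f g :: "'a cper" and u v :: real
  assume fg: "f \<in> Lip1" "g \<in> Lip1" and uv: "0 \<le> u" "0 \<le> v" "u + v = 1"
  have "norm (ev (u *\<^sub>R f + v *\<^sub>R g) s - ev (u *\<^sub>R f + v *\<^sub>R g) s') \<le> \<bar>s - s'\<bar>" for s s'
  proof -
    have "ev (u *\<^sub>R f + v *\<^sub>R g) s - ev (u *\<^sub>R f + v *\<^sub>R g) s' = u *\<^sub>R (ev f s - ev f s') + v *\<^sub>R (ev g s - ev g s')"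
      by (simp add: ev_simps algebra_simps)
    also have "norm \<dots> \<le> u * norm (ev f s - ev f s') + v * norm (ev g s - ev g s')"
      using uv norm_triangle_ineq[of "u *\<^sub>R (ev f s - ev f s')" "v *\<^sub>R (ev g s - ev g s')"] by simp
    also have "\<dots> \<le> u * \<bar>s - s'\<bar> + v * \<bar>s - s'\<bar>"
      using fg uv by (intro add_mono mult_left_mono) (auto simp: Lip1_def)
    also have "\<dots> = \<bar>s - s'\<bar>" using uv by (simp flip: distrib_right)
    finally show ?thesis .
  qed
  then show "u *\<^sub>R f + v *\<^sub>R g \<in> Lip1" by (simp add: Lip1_def)
qed

lemma Lip1_zero: "0 \<in> Lip1"
  by (simp add: Lip1_def ev_simps)

text \<open>The difference is 2-Lipschitz. If it reaches size e at a point, it stays above e/2 on an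
  interval of length min (1/2) (e/4), which alone contributes that length times (e/2)^2 to the
  squared norm. On \<open>Lip1\<close> the L2 norm thus controls the uniform norm.\<close>

lemma sup_bound_L2:
  assumes fg: "f \<in> Lip1" "g \<in> Lip1" and e: "e > 0"
    and le: "(norm (f - g))\<^sup>2 < (e / 2)\<^sup>2 * min (1/2) (e / 4)"
  shows "norm (ev f s - ev g s) < e"
proof (rule ccontr)
  define u where "u = ev (f - g)"
  define m where "m = min (1/2) (e / 4)"
  assume neg: "\<not> ?thesis"
  define s0 where "s0 = frac s"
  have s0: "0 \<le> s0" "s0 \<le> 1" by (auto simp: s0_def frac_ge_0 less_imp_le[OF frac_lt_1])
  have "norm (u s0) = norm (ev f s - ev g s)"
    unfolding u_def s0_def by (simp add: ev_frac[symmetric] ev_simps)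
  then have u0: "norm (u s0) \<ge> e" using neg by simp
  have lip: "norm (u a - u b) \<le> 2 * \<bar>a - b\<bar>" for a b
  proof -
    have "u a - u b = (ev f a - ev f b) - (ev g a - ev g b)" by (simp add: u_def ev_simps)
    also have "norm \<dots> \<le> norm (ev f a - ev f b) + norm (ev g a - ev g b)" by (rule norm_triangle_ineq4)
    also have "\<dots> \<le> \<bar>a - b\<bar> + \<bar>a - b\<bar>" using fg by (intro add_mono) (auto simp: Lip1_def)
    finally show ?thesis by simp
  qed
  have m: "0 < m" "m \<le> 1/2" "m \<le> e / 4" using e by (auto simp: m_def)
  \<comment> \<open>The interval extends to the right or to the left of \<open>s0\<close>, whichever
    keeps it inside [0,1]; this is why its length is capped by 1/2.\<close>
  define a where "a = (if s0 \<le> 1/2 then s0 else s0 - m)"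
  have a: "0 \<le> a" "a + m \<le> 1" using s0 m by (auto simp: a_def)
  have big: "e / 2 \<le> norm (u x)" if "x \<in> {a..a + m}" for x
  proof -
    have "\<bar>s0 - x\<bar> \<le> m" using that m by (auto simp: a_def split: if_splits)
    then have "2 * \<bar>s0 - x\<bar> \<le> e / 2" using m(3) by simp
    with lip[of s0 x] have "norm (u s0 - u x) \<le> e / 2" by (rule order_trans)
    then show ?thesis using u0 norm_triangle_ineq2[of "u s0" "u x"] by linarith
  qed
  have "(e / 2)\<^sup>2 * m = (\<integral>x. indicator {a..a+m} x * (e/2)\<^sup>2 \<partial>I01)"
  proof -
    have "emeasure I01 {a..a+m} = ennreal m"
    proof -
      have "{a..a+m} \<inter> {0..1} = {a..a+m}" using a by auto
      then show ?thesis using m by (simp add: emeasure_I01)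
    qed
    then have "measure I01 {a..a+m} = m" using m by (simp add: measure_def)
    then show ?thesis by simp
  qed
  also have "\<dots> \<le> (\<integral>x. (norm (u x))\<^sup>2 \<partial>I01)"
  proof (rule integral_mono)
    show "integrable I01 (\<lambda>x. (norm (u x))\<^sup>2)"
      unfolding u_def by (intro continuous_integrable_I01 continuous_intros ev_cont)
    show "integrable I01 (\<lambda>x. indicator {a..a+m} x * (e/2)\<^sup>2)"
      by (intro integrable_mult_left integrable_real_indicator) (auto simp: emeasure_I01 less_top[symmetric] I01.emeasure_eq_measure)
    show "indicator {a..a+m} x * (e/2)\<^sup>2 \<le> (norm (u x))\<^sup>2" for x
      using big[of x] e by (auto simp: indicator_def intro!: power_mono)
  qed
  also have "\<dots> = (norm (f - g))\<^sup>2" by (simp add: norm_cper_sq u_def)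
  finally show False using le by (simp add: m_def)
qed

lemma norm_cper_le_sup:
  assumes "\<And>s. norm (ev f s) \<le> e"
  shows "norm f \<le> e"
proof -
  have e: "0 \<le> e" using assms[of 0] norm_ge_zero order_trans by blast
  have "(norm f)\<^sup>2 \<le> (\<integral>s. e\<^sup>2 \<partial>I01)"
    unfolding norm_cper_sq
  proof (rule integral_mono)
    show "integrable I01 (\<lambda>x. (norm (ev f x))\<^sup>2)"
      by (intro continuous_integrable_I01 continuous_intros ev_cont)
  qed (auto intro!: power_mono assms)
  also have "\<dots> = e\<^sup>2" by (simp add: measure_def emeasure_I01)
  finally show ?thesis using e by (rule power2_le_imp_le)
qed

lemma Lip1_ev_tendsto:
  assumes "\<And>n. f n \<in> Lip1" "l \<in> Lip1" "f \<longlonglongrightarrow> l" "e > 0"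
  shows "eventually (\<lambda>n. \<forall>s. norm (ev (f n) s - ev l s) < e) sequentially"
proof -
  have "(\<lambda>n. (norm (f n - l))\<^sup>2) \<longlonglongrightarrow> 0"
    using assms(3) by (simp add: LIM_zero tendsto_norm_zero tendsto_null_power)
  then have "eventually (\<lambda>n. (norm (f n - l))\<^sup>2 < (e / 2)\<^sup>2 * min (1/2) (e / 4)) sequentially"
    by (rule order_tendstoD(2)) (use assms(4) in simp)
  then show ?thesis
    by eventually_elim (use sup_bound_L2 assms in blast)
qed

lemma Lip1_continuous:
  fixes F :: "real \<Rightarrow> 'a::real_normed_vector"
  assumes "\<And>s s'. norm (F s - F s') \<le> \<bar>s - s'\<bar>"
  shows "continuous_on UNIV F"
proof (rule continuous_onI)
  fix x e :: real assume "0 < e"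
  then show "\<exists>d>0. \<forall>x'\<in>UNIV. dist x' x < d \<longrightarrow> dist (F x') (F x) \<le> e"
    using order_trans[OF assms] by (intro exI[of _ e]) (auto simp: dist_norm real_norm_def)
qed

text \<open>By \<open>sup_bound_L2\<close> an L2 Cauchy sequence in the set is uniformly Cauchy, so
  its pointwise limit is again a 1-Lipschitz closed curve and is also the L2 limit.\<close>

lemma Lip1_complete: "complete (Lip1 :: 'a::euclidean_space cper set)"
  unfolding complete_def
proof (intro allI impI, elim conjE)
  fix f :: "nat \<Rightarrow> 'a cper"
  assume K: "\<forall>n. f n \<in> Lip1" and C: "Cauchy f"
  have sup: "\<exists>N. \<forall>m\<ge>N. \<forall>n\<ge>N. \<forall>s. norm (ev (f m) s - ev (f n) s) < e" if "e > 0" for e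
  proof -
    let ?d = "sqrt ((e / 2)\<^sup>2 * min (1/2) (e / 4))"
    have "?d > 0" using that by simp
    then obtain N where N: "\<And>m n. m \<ge> N \<Longrightarrow> n \<ge> N \<Longrightarrow> norm (f m - f n) < ?d"
      using C unfolding Cauchy_def dist_norm by blast
    have "(norm (f m - f n))\<^sup>2 < (e / 2)\<^sup>2 * min (1/2) (e / 4)" if "m \<ge> N" "n \<ge> N" for m n
    proof -
      have "(norm (f m - f n))\<^sup>2 < ?d\<^sup>2" using N[OF that] by (intro power_strict_mono) auto
      then show ?thesis using \<open>e > 0\<close> by simp
    qed
    then show ?thesis using sup_bound_L2 K that by blast
  qed
  have "Cauchy (\<lambda>n. ev (f n) s)" for s
    unfolding Cauchy_def dist_norm using sup by blast
  then have conv: "(\<lambda>n. ev (f n) s) \<longlonglongrightarrow> lim (\<lambda>n. ev (f n) s)" for s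
    by (simp add: Cauchy_convergent_iff convergent_LIMSEQ_iff)
  define F where "F s = lim (\<lambda>n. ev (f n) s)" for s
  note lim = conv[folded F_def]
  have lip: "norm (F s - F s') \<le> \<bar>s - s'\<bar>" for s s'
    by (rule LIMSEQ_le_const2[OF tendsto_norm[OF tendsto_diff[OF lim lim]]]) (use K in \<open>auto simp: Lip1_def\<close>)
  have "continuous_on UNIV F"
    using lip by (rule Lip1_continuous)
  moreover have "F (s + 1) = F s" for s by (simp add: F_def ev_periodic)
  ultimately have ev: "ev (Cper F) = F" by (intro Cper_inverse) auto
  have "Cper F \<in> Lip1" using lip by (simp add: Lip1_def ev)
  moreover have "f \<longlonglongrightarrow> Cper F"
  proof (rule LIMSEQ_I)
    fix e :: real assume "e > 0"
    then obtain N where N: "\<And>m n s. m \<ge> N \<Longrightarrow> n \<ge> N \<Longrightarrow> norm (ev (f m) s - ev (f n) s) < e/2"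
      using sup[of "e/2"] by (meson half_gt_zero)
    have "norm (f m - Cper F) < e" if m: "m \<ge> N" for m
    proof -
      have "norm (ev (f m - Cper F) s) \<le> e/2" for s
        unfolding ev_simps ev
        by (rule LIMSEQ_le_const2[OF tendsto_norm[OF tendsto_diff[OF tendsto_const lim]]])
          (use N[OF m] less_imp_le in blast)
      then have "norm (f m - Cper F) \<le> e/2" by (rule norm_cper_le_sup)
      then show ?thesis using \<open>e > 0\<close> by simp
    qed
    then show "\<exists>N. \<forall>m\<ge>N. norm (f m - Cper F) < e" by blast
  qed
  ultimately show "\<exists>l\<in>Lip1. f \<longlonglongrightarrow> l" by blast
qed

text \<open>Two points in different period cells have an integer between them, where the pieces
  agree because \<open>G 1 = G 0\<close>. Splitting there adds up the two Lipschitz bounds.\<close>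

lemma periodic_Lip1_exists:
  fixes G :: "real \<Rightarrow> 'a::euclidean_space"
  assumes lip: "\<And>s s'. s \<in> {0..1} \<Longrightarrow> s' \<in> {0..1} \<Longrightarrow> norm (G s - G s') \<le> \<bar>s - s'\<bar>" and per: "G 1 = G 0"
  obtains z where "z \<in> Lip1" "\<And>s. s \<in> {0..1} \<Longrightarrow> ev z s = G s"
proof -
  define F where "F s = G (frac s)" for s
  \<comment> \<open>The right end of the cell is included, although \<open>frac\<close> jumps to 0
    there; \<open>per\<close> makes up for it.\<close>
  have FG: "F s = G (s - of_int k)" if "of_int k \<le> s" "s \<le> of_int k + 1" for s and k :: int
  proof (cases "s = of_int k + 1")
    case True
    then have "frac s = 0" by (simp add: frac_def)
    then show ?thesis using True per by (simp add: F_def)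
  next
    case False
    then have "\<lfloor>s\<rfloor> = k" using that by (simp add: floor_eq_iff)
    then show ?thesis by (simp add: F_def frac_def)
  qed
  have le: "norm (F s - F s') \<le> s' - s" if "s \<le> s'" for s s'
  proof (cases "s' \<le> of_int \<lfloor>s\<rfloor> + 1")
    case True
    have k: "of_int \<lfloor>s\<rfloor> \<le> s" "s \<le> of_int \<lfloor>s\<rfloor> + 1" "of_int \<lfloor>s\<rfloor> \<le> s'" using that by linarith+
    have "F s = G (s - of_int \<lfloor>s\<rfloor>)" "F s' = G (s' - of_int \<lfloor>s\<rfloor>)" using FG k True by blast+
    then show ?thesis using lip[of "s - of_int \<lfloor>s\<rfloor>" "s' - of_int \<lfloor>s\<rfloor>"] k True that by simp
  next
    case False
    define a where "a = real_of_int \<lfloor>s\<rfloor>"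
    define b where "b = real_of_int \<lfloor>s'\<rfloor>"
    have k: "a \<le> s" "s \<le> a + 1" "b \<le> s'" "s' \<le> b + 1" unfolding a_def b_def by linarith+
    have "\<lfloor>s\<rfloor> + 1 \<le> \<lfloor>s'\<rfloor>" using False by (simp add: le_floor_iff)
    then have ab: "a + 1 \<le> b" unfolding a_def b_def by linarith
    have "F s = G (s - a)" "F s' = G (s' - b)" using FG k unfolding a_def b_def by blast+
    then have "F s - F s' = (G (s - a) - G 1) + (G 0 - G (s' - b))" using per by simp
    also have "norm \<dots> \<le> norm (G (s - a) - G 1) + norm (G 0 - G (s' - b))" by (rule norm_triangle_ineq)
    also have "\<dots> \<le> \<bar>s - a - 1\<bar> + \<bar>0 - (s' - b)\<bar>" using k by (intro add_mono lip) auto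
    also have "\<dots> \<le> s' - s" using k ab by simp
    finally show ?thesis .
  qed
  have lipF: "norm (F s - F s') \<le> \<bar>s - s'\<bar>" for s s'
    using le[of s s'] le[of s' s] by (cases "s \<le> s'") (auto simp: norm_minus_commute)
  have "continuous_on UNIV F"
    using lipF by (rule Lip1_continuous)
  moreover have "F (s + 1) = F s" for s by (simp add: F_def frac_1_eq)
  ultimately have ev: "ev (Cper F) = F" by (intro Cper_inverse) auto
  show ?thesis
    by (rule that[of "Cper F"]) (use lipF FG[of 0] in \<open>auto simp: Lip1_def ev\<close>)
qed

section \<open>The Lagrange multiplier at a fixed time\<close>

text \<open>On the unit interval \<open>kap f\<close> is the primitive of \<open>- f\<close>; integrating against \<open>I01\<close> makes it
  constant outside, hence continuous on the whole line.\<close>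

definition kap :: "(real \<Rightarrow> 'a::euclidean_space) \<Rightarrow> real \<Rightarrow> 'a" where
  "kap f s = - (\<integral>r. indicator {..s} r *\<^sub>R f r \<partial>I01)"

lemma integrable_kap: "integrable I01 f \<Longrightarrow> integrable I01 (\<lambda>r. indicator {..s} r *\<^sub>R f r)" for f :: "real \<Rightarrow> 'a::euclidean_space"
  by (rule integrable_mult_indicator) auto

lemma kap_eq:
  assumes [measurable]: "f \<in> borel_measurable borel" and "s \<in> {0..1}"
  shows "kap f s = - (LINT r:{0..s}|lborel. f r)"
  unfolding kap_def by (subst integral_I01)
    (use assms(2) in \<open>auto simp: set_lebesgue_integral_def indicator_def intro!: Bochner_Integration.integral_cong\<close>)

lemma kap_0: "kap f 0 = 0"
proof -
  have "AE r in I01. indicator {..0} r *\<^sub>R f r = 0"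
    using AE_I01_ivl by eventually_elim simp
  then show ?thesis unfolding kap_def by (simp add: integral_eq_zero_AE)
qed

lemma kap_bound: "norm (kap f s) \<le> (\<integral>r. norm (f r) \<partial>I01)" if "integrable I01 f" for f :: "real \<Rightarrow> 'a::euclidean_space"
proof -
  have "norm (kap f s) \<le> (\<integral>r. norm (indicator {..s} r *\<^sub>R f r) \<partial>I01)"
    unfolding kap_def norm_minus_cancel by (rule integral_norm_bound)
  also have "\<dots> \<le> (\<integral>r. norm (f r) \<partial>I01)"
    by (intro integral_mono integrable_norm integrable_kap that) (auto simp: indicator_def)
  finally show ?thesis .
qed

lemma kap_continuous:
  fixes f :: "real \<Rightarrow> 'a::euclidean_space"
  assumes f: "integrable I01 f"
  shows "continuous_on UNIV (kap f)"
  unfolding continuous_on_sequentially comp_def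
proof (intro ballI allI impI, elim conjE)
  fix x :: "nat \<Rightarrow> real" and s assume "x \<longlonglongrightarrow> s"
  have [measurable]: "f \<in> borel_measurable borel"
    using borel_measurable_integrable[OF f] by simp
  have "(\<lambda>n. \<integral>r. indicator {..x n} r *\<^sub>R f r \<partial>I01) \<longlonglongrightarrow> (\<integral>r. indicator {..s} r *\<^sub>R f r \<partial>I01)"
  proof (rule integral_dominated_convergence[where w="\<lambda>r. norm (f r)"])
    show "integrable I01 (\<lambda>r. norm (f r))" using f by (rule integrable_norm)
    have "AE r in lborel. r \<noteq> s" by (rule AE_lborel_singleton)
    then have "AE r in I01. r \<noteq> s" unfolding AE_I01 by eventually_elim simp
    then show "AE r in I01. (\<lambda>n. indicator {..x n} r *\<^sub>R f r) \<longlonglongrightarrow> indicator {..s} r *\<^sub>R f r"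
    proof eventually_elim
      case (elim r)
      have "eventually (\<lambda>n. indicator {..x n} r *\<^sub>R f r = indicator {..s} r *\<^sub>R f r) sequentially"
      proof (cases "r < s")
        case True
        from order_tendstoD(1)[OF \<open>x \<longlonglongrightarrow> s\<close> this] show ?thesis
          by eventually_elim (use True in \<open>auto simp: indicator_def\<close>)
      next
        case False
        then have "s < r" using elim by simp
        from order_tendstoD(2)[OF \<open>x \<longlonglongrightarrow> s\<close> this] show ?thesis
          by eventually_elim (use \<open>s < r\<close> in \<open>auto simp: indicator_def\<close>)
      qed
      then show ?case by (rule tendsto_eventually)
    qed
  qed (auto simp: indicator_def)
  then show "(\<lambda>n. kap f (x n)) \<longlonglongrightarrow> kap f s" unfolding kap_def by (rule tendsto_minus)
qed

text \<open>From 2 |p| |p + q| <= |p|^2 + |p + q|^2. An upper bound for the norm by its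
  linearisation with a quadratic remainder, which replaces differentiation under the integral in
  \<open>approx_median\<close>.\<close>

lemma norm_add_le_quadratic:
  fixes p q :: "'a::real_inner"
  assumes "p \<noteq> 0"
  shows "norm (p + q) \<le> norm p + (2 * (p \<bullet> q) + (norm q)\<^sup>2) / (2 * norm p)"
proof -
  have n: "norm p > 0" using assms by simp
  have "(norm (p + q))\<^sup>2 = (norm p)\<^sup>2 + 2 * (p \<bullet> q) + (norm q)\<^sup>2"
    by (simp add: power2_norm_eq_inner inner_add_left inner_add_right inner_commute)
  moreover have "2 * norm p * norm (p + q) \<le> (norm p)\<^sup>2 + (norm (p + q))\<^sup>2" by (rule sum_squares_bound)
  ultimately have "norm (p + q) * (2 * norm p) \<le> norm p * (2 * norm p) + (2 * (p \<bullet> q) + (norm q)\<^sup>2)"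
    by (simp add: power2_eq_square mult.commute)
  then have "norm (p + q) \<le> (norm p * (2 * norm p) + (2 * (p \<bullet> q) + (norm q)\<^sup>2)) / (2 * norm p)"
    using n by (subst pos_le_divide_eq) auto
  also have "\<dots> = norm p + (2 * (p \<bullet> q) + (norm q)\<^sup>2) / (2 * norm p)"
    using n by (simp add: add_divide_distrib)
  finally show ?thesis .
qed

text \<open>Mean zero makes the primitive close up, and the bound on \<open>w\<close> makes it
  1-Lipschitz. This converts admissible derivative fields into competitors for the variational
  inequality, and it also recovers the initial curve from its weak derivative.\<close>

lemma Lip1_primitive:
  fixes w :: "real \<Rightarrow> 'a::euclidean_space"
  assumes w[measurable]: "w \<in> borel_measurable borel" and w1: "AE s in I01. norm (w s) \<le> 1" and w0: "(\<integral>s. w s \<partial>I01) = 0"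
  obtains z where "z \<in> Lip1" "\<And>b. b \<in> {0..1} \<Longrightarrow> (LINT r:{0..b}|lborel. w r) = ev z b" "ev z 0 = 0"
proof -
  have w_int: "integrable I01 w"
    by (rule I01.integrable_const_bound[of _ 1]) (use w1 in auto)
  define G where "G s = - kap w s" for s
  have G: "G s = (LINT r:{0..s}|lborel. w r)" if "s \<in> {0..1}" for s
    using kap_eq[OF w that] by (simp add: G_def)
  have lipG: "norm (G s - G s') \<le> s' - s" if "s \<le> s'" for s s'
  proof -
    have "G s' - G s = (\<integral>r. indicator {..s'} r *\<^sub>R w r - indicator {..s} r *\<^sub>R w r \<partial>I01)"
      unfolding G_def kap_def using integrable_kap[OF w_int] by simp
    also have "norm \<dots> \<le> (\<integral>r. norm (indicator {..s'} r *\<^sub>R w r - indicator {..s} r *\<^sub>R w r) \<partial>I01)"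
      by (rule integral_norm_bound)
    also have "\<dots> \<le> (\<integral>r. indicator {s<..s'} r \<partial>I01)"
    proof (rule integral_mono_AE)
      show "integrable I01 (\<lambda>r. norm (indicator {..s'} r *\<^sub>R w r - indicator {..s} r *\<^sub>R w r))"
        by (intro integrable_norm Bochner_Integration.integrable_diff integrable_kap w_int)
      show "integrable I01 (indicator {s<..s'} :: real \<Rightarrow> real)"
        by (intro integrable_real_indicator) (auto simp: less_top[symmetric] I01.emeasure_eq_measure)
      show "AE r in I01. norm (indicator {..s'} r *\<^sub>R w r - indicator {..s} r *\<^sub>R w r) \<le> indicator {s<..s'} r"
        using w1 by eventually_elim (use that in \<open>auto simp: indicator_def\<close>)
    qed
    also have "\<dots> = measure I01 {s<..s'}" by simp
    also have "\<dots> \<le> s' - s"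
    proof -
      have "emeasure I01 {s<..s'} \<le> emeasure lborel {s<..s'}"
        by (simp add: emeasure_I01 emeasure_mono del: emeasure_lborel_Ioc)
      then have "ennreal (measure I01 {s<..s'}) \<le> ennreal (s' - s)" using that by (simp add: I01.emeasure_eq_measure)
      then show ?thesis using that by (simp add: ennreal_le_iff)
    qed
    finally show ?thesis by (simp add: norm_minus_commute)
  qed
  have lipG': "norm (G s - G s') \<le> \<bar>s - s'\<bar>" for s s'
    using lipG[of s s'] lipG[of s' s] by (cases "s \<le> s'") (auto simp: norm_minus_commute)
  have "G 1 = 0" using G[of 1] w0 by (simp add: integral_I01)
  moreover have "G 0 = 0" by (simp add: G_def kap_0)
  ultimately obtain z where z: "z \<in> Lip1" "\<And>s. s \<in> {0..1} \<Longrightarrow> ev z s = G s"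
    using periodic_Lip1_exists[of G] lipG' by metis
  show ?thesis
  proof (rule that[OF z(1)])
    show "(LINT r:{0..b}|lborel. w r) = ev z b" if "b \<in> {0..1}" for b
      using z(2)[OF that] G[OF that] by simp
    show "ev z 0 = 0" using z(2)[of 0] \<open>G 0 = 0\<close> by simp
  qed
qed

text \<open>To be used at one fixed time with the curve \<open>x\<close>, its derivative
  \<open>v\<close> in s, and f = x - x_t. The assumption \<open>VI\<close> says that
  \<open>f\<close> lies in the normal cone of \<open>Lip1\<close> at \<open>x\<close>.\<close>

locale multiplier =
  fixes f v :: "real \<Rightarrow> 'a::euclidean_space" and x :: "'a cper"
  assumes f: "f \<in> borel_measurable borel" "(\<integral>\<^sup>+s. ennreal ((norm (f s))\<^sup>2) \<partial>I01) < \<infinity>"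
    and v: "v \<in> borel_measurable borel" "AE s in I01. norm (v s) \<le> 1"
    and x: "x \<in> Lip1" "\<And>b. b \<in> {0..1} \<Longrightarrow> (LINT r:{0..b}|lborel. v r) = ev x b - ev x 0"
    and VI: "\<And>z. z \<in> Lip1 \<Longrightarrow> (\<integral>s. f s \<bullet> (ev z s - ev x s) \<partial>I01) \<le> 0"
begin

lemmas [measurable] = f(1) v(1)

text \<open>\<open>\<Phi>\<close> is the duality gap of the geometric median problem for \<open>kap f\<close>: it is nonnegative, and it
  vanishes exactly when \<open>v\<close> is a unit vector field along \<open>kap f - c\<close>.\<close>

definition "B = (\<integral>r. norm (f r) \<partial>I01)"
definition "\<Phi> c = (\<integral>s. norm (kap f s - c) - (kap f s - c) \<bullet> v s \<partial>I01)"

lemma f_int: "integrable I01 f" by (rule I01_sq_integrable[OF f])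
lemma v_int: "integrable I01 v"
  by (rule I01.integrable_const_bound[of _ 1]) (use v in auto)

lemma B: "norm (kap f s) \<le> B" unfolding B_def by (rule kap_bound[OF f_int])
lemma B_nonneg: "B \<ge> 0" unfolding B_def by simp

lemma kap_cont: "continuous_on A (kap f)"
  using kap_continuous[OF f_int] by (rule continuous_on_subset) simp

lemma kap_measurable [measurable]: "kap f \<in> borel_measurable borel"
  by (rule borel_measurable_continuous_onI[OF kap_cont])

lemma integrable_cont_inner_v: "integrable I01 (\<lambda>s. h s \<bullet> v s)" if "continuous_on UNIV h"
proof (rule Bochner_Integration.integrable_bound)
  have [measurable]: "h \<in> borel_measurable borel" by (rule borel_measurable_continuous_onI[OF that])
  show "integrable I01 (\<lambda>s. norm (h s))" by (intro continuous_integrable_I01 continuous_intros that)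
  show "(\<lambda>s. h s \<bullet> v s) \<in> borel_measurable I01" by measurable
  show "AE s in I01. norm (h s \<bullet> v s) \<le> norm (norm (h s))"
    using v(2)
  proof eventually_elim
    case (elim s)
    have "norm (h s \<bullet> v s) \<le> norm (h s) * norm (v s)" using Cauchy_Schwarz_ineq2[of "h s" "v s"] by simp
    also have "\<dots> \<le> norm (h s) * 1" using elim by (intro mult_left_mono) auto
    finally show ?case by simp
  qed
qed

text \<open>The constraint does not see translations, so the curve moved by the mean of
  \<open>f\<close> is a competitor, and \<open>VI\<close> makes the squared length of that mean
  nonpositive.\<close>

lemma f_mean: "(\<integral>s. f s \<partial>I01) = 0"
proof -
  define c where "c = (\<integral>s. f s \<partial>I01)"
  have ev: "ev (Cper (\<lambda>s. ev x s + c)) = (\<lambda>s. ev x s + c)"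
    by (intro Cper_inverse) (auto intro!: continuous_intros ev_cont simp: ev_periodic)
  have "Cper (\<lambda>s. ev x s + c) \<in> Lip1" using x(1) by (simp add: Lip1_def ev)
  from VI[OF this] have "(\<integral>s. f s \<bullet> c \<partial>I01) \<le> 0" by (simp add: ev)
  then have "c \<bullet> c \<le> 0" using f_int by (simp add: c_def)
  then have "c = 0" by (metis inner_gt_zero_iff not_le)
  then show ?thesis by (simp add: c_def)
qed

lemma kap_1: "kap f 1 = 0"
  using f_mean by (subst kap_eq) (auto simp: f integral_I01)

lemma set_int: "set_integrable lborel {0..1} f" "set_integrable lborel {0..1} v"
  using f_int v_int by (simp_all add: integrable_I01 f v)

text \<open>There are no boundary terms, since \<open>kap f\<close> vanishes at 0 and, by
  \<open>f_mean\<close>, at 1.\<close>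

lemma by_parts:
  assumes z: "z \<in> Lip1" and w: "w \<in> borel_measurable borel" "integrable I01 w"
    and zw: "\<And>b. b \<in> {0..1} \<Longrightarrow> (LINT r:{0..b}|lborel. w r) = ev z b - ev z 0"
  shows "(\<integral>s. f s \<bullet> ev z s \<partial>I01) = (\<integral>s. kap f s \<bullet> w s \<partial>I01)"
proof -
  note [measurable] = w(1)
  have "(LINT s:{0..1}|lborel. kap f s \<bullet> w s) + (LINT s:{0..1}|lborel. (- f s) \<bullet> ev z s) = kap f 1 \<bullet> ev z 1 - kap f 0 \<bullet> ev z 0"
  proof (rule ibp_inner(3))
    show "set_integrable lborel {0..1} (\<lambda>s. - f s)" using set_int(1) by (simp add: set_integrable_def)
    show "set_integrable lborel {0..1} w" using w by (simp add: integrable_I01)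
    show "kap f s = kap f 0 + (LINT r:{0..s}|lborel. - f r)" if "s \<in> {0..1}" for s
      using kap_eq[OF f(1) that] by (simp add: kap_0 set_lebesgue_integral_def)
    show "ev z s = ev z 0 + (LINT r:{0..s}|lborel. w r)" if "s \<in> {0..1}" for s
      using zw[OF that] by simp
  qed simp
  then have "(LINT s:{0..1}|lborel. kap f s \<bullet> w s) = (LINT s:{0..1}|lborel. f s \<bullet> ev z s)"
    by (simp add: kap_0 kap_1 set_lebesgue_integral_def)
  then show ?thesis by (simp add: integral_I01)
qed

text \<open>After integration by parts the variational inequality depends on the competitor only
  through its derivative. So \<open>v\<close> beats every such field in the linear functional given
  by \<open>kap f\<close>, which is the dual of the geometric median problem.\<close>

lemma kap_v_max:
  assumes w: "continuous_on UNIV w" "\<And>s. norm (w s) \<le> 1" "(\<integral>s. w s \<partial>I01) = 0"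
  shows "(\<integral>s. kap f s \<bullet> w s \<partial>I01) \<le> (\<integral>s. kap f s \<bullet> v s \<partial>I01)"
proof -
  have [measurable]: "w \<in> borel_measurable borel" by (rule borel_measurable_continuous_onI[OF w(1)])
  have w_int: "integrable I01 w" by (rule continuous_integrable_I01[OF w(1)])
  obtain z where z: "z \<in> Lip1" "\<And>b. b \<in> {0..1} \<Longrightarrow> (LINT r:{0..b}|lborel. w r) = ev z b" "ev z 0 = 0"
    using Lip1_primitive[of w] w by auto
  have zw: "(LINT r:{0..b}|lborel. w r) = ev z b - ev z 0" if "b \<in> {0..1}" for b
    using z(2)[OF that] z(3) by simp
  have "(\<integral>s. f s \<bullet> ev z s \<partial>I01) - (\<integral>s. f s \<bullet> ev x s \<partial>I01) \<le> 0"
    using VI[OF z(1)] integrable_inner_ev[OF f_int, of z] integrable_inner_ev[OF f_int, of x] by (simp add: inner_diff_right)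
  then show ?thesis
    using by_parts[OF z(1) _ w_int zw] by_parts[OF x(1) v(1) v_int x(2)] by simp
qed

lemma v_mean: "(\<integral>s. v s \<partial>I01) = 0"
  using x(2)[of 1] ev_periodic[of x 0] by (simp add: integral_I01 v)

lemma \<Phi>_integrable: "integrable I01 (\<lambda>s. norm (kap f s - c) - (kap f s - c) \<bullet> v s)"
  by (intro Bochner_Integration.integrable_diff integrable_cont_inner_v continuous_integrable_I01 continuous_intros kap_cont)

lemma \<Phi>_nonneg_AE: "AE s in I01. 0 \<le> norm (kap f s - c) - (kap f s - c) \<bullet> v s"
  using v(2)
proof eventually_elim
  case (elim s)
  have "(kap f s - c) \<bullet> v s \<le> norm (kap f s - c) * norm (v s)" by (rule norm_cauchy_schwarz)
  also have "\<dots> \<le> norm (kap f s - c) * 1" using elim by (intro mult_left_mono) auto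
  finally show ?case by simp
qed

text \<open>Since \<open>v\<close> has mean zero, \<open>c\<close> drops out of the linear term: up
  to a constant, \<open>\<Phi>\<close> is the mean distance from \<open>kap f\<close> to
  \<open>c\<close>.\<close>

lemma \<Phi>_eq: "\<Phi> c = (\<integral>s. norm (kap f s - c) \<partial>I01) - (\<integral>s. kap f s \<bullet> v s \<partial>I01)"
proof -
  have "(\<integral>s. (kap f s - c) \<bullet> v s \<partial>I01) = (\<integral>s. kap f s \<bullet> v s \<partial>I01) - c \<bullet> (\<integral>s. v s \<partial>I01)"
    using integrable_cont_inner_v[OF kap_cont] v_int by (simp add: inner_diff_left)
  moreover have "integrable I01 (\<lambda>s. (kap f s - c) \<bullet> v s)"
    by (intro integrable_cont_inner_v continuous_intros kap_cont)
  moreover have "integrable I01 (\<lambda>s. norm (kap f s - c))"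
    by (intro continuous_integrable_I01 continuous_intros kap_cont)
  ultimately show ?thesis unfolding \<Phi>_def by (simp add: v_mean)
qed

lemma \<Phi>_lip: "\<bar>\<Phi> c - \<Phi> c'\<bar> \<le> norm (c - c')"
proof -
  have int: "integrable I01 (\<lambda>s. norm (kap f s - c))" for c by (intro continuous_integrable_I01 continuous_intros kap_cont)
  have le: "(\<integral>s. norm (kap f s - c) \<partial>I01) \<le> (\<integral>s. norm (kap f s - c') \<partial>I01) + norm (c - c')" for c c'
  proof -
    have "(\<integral>s. norm (kap f s - c) \<partial>I01) \<le> (\<integral>s. norm (kap f s - c') + norm (c - c') \<partial>I01)"
    proof (rule integral_mono)
      show "norm (kap f s - c) \<le> norm (kap f s - c') + norm (c - c')" for s
        using norm_triangle_ineq4[of "kap f s - c'" "c - c'"] by simp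
    qed (use int in auto)
    also have "\<dots> = (\<integral>s. norm (kap f s - c') \<partial>I01) + norm (c - c')"
      using int by (simp add: measure_I01_UNIV)
    finally show ?thesis .
  qed
  show ?thesis unfolding \<Phi>_eq using le[of c c'] le[of c' c] by (simp add: norm_minus_commute)
qed

text \<open>Choosing \<open>c\<close> as a limit of approximate medians avoids subgradients on the set where \<open>kap f = c\<close>.
  The norm of the pair \<open>(e, kap f s - c)\<close> is a smooth approximation of \<open>norm (kap f s - c)\<close>, so
  the minimiser in \<open>c\<close> of its integral yields an admissible competitor for \<open>v\<close>.\<close>

lemma approx_median:
  assumes e: "e > 0"
  obtains c where "\<Phi> c \<le> e" "norm c \<le> 2 * B + e"
proof -
  define N where "N c s = norm (e, kap f s - c)" for c s
  have Nc: "continuous_on UNIV (N c)" for c unfolding N_def by (intro continuous_intros kap_cont)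
  have Nint: "integrable I01 (N c)" for c by (rule continuous_integrable_I01[OF Nc])
  have Ne: "N c s \<ge> e" for c s unfolding N_def using norm_fst_le[of e "kap f s - c"] e by simp
  have Nn: "N c s \<ge> norm (kap f s - c)" for c s unfolding N_def using norm_snd_le[of "kap f s - c" e] by simp
  have Nle: "N c s \<le> e + norm (kap f s - c)" for c s
    unfolding N_def using norm_Pair_le[of e "kap f s - c"] e by simp
  define F where "F c = (\<integral>s. N c s \<partial>I01)" for c
  note one = measure_I01_UNIV
  have Flip: "F c \<le> F c' + norm (c - c')" for c c'
  proof -
    have "F c \<le> (\<integral>s. N c' s + norm (c - c') \<partial>I01)" unfolding F_def
    proof (rule integral_mono)
      show "N c s \<le> N c' s + norm (c - c')" for s
        unfolding N_def using norm_triangle_ineq[of "(e, kap f s - c')" "(0, c' - c)"]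
        by (simp add: norm_Pair norm_minus_commute)
    qed (use Nint in auto)
    also have "\<dots> = F c' + norm (c - c')" using Nint one by (simp add: F_def)
    finally show ?thesis .
  qed
  have "continuous_on UNIV F"
  proof (rule continuous_onI)
    fix c and d :: real assume "0 < d"
    then show "\<exists>r>0. \<forall>c'\<in>UNIV. dist c' c < r \<longrightarrow> dist (F c') (F c) \<le> d"
    proof (intro exI[of _ d] conjI ballI impI)
      fix c' assume "dist c' c < d"
      then show "dist (F c') (F c) \<le> d" using Flip[of c c'] Flip[of c' c] unfolding dist_norm real_norm_def
        by (simp add: norm_minus_commute)
    qed
  qed
  \<comment> \<open>Outside this ball \<open>F\<close> exceeds (2 B + e) - B = B + e, an upper bound
    for \<open>F 0\<close>, so the minimiser over the ball is global.\<close>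
  then have Fcont: "continuous_on (cball 0 (2 * B + e)) F" by (rule continuous_on_subset) simp
  obtain c where c: "c \<in> cball 0 (2 * B + e)" "\<And>c'. c' \<in> cball 0 (2 * B + e) \<Longrightarrow> F c \<le> F c'"
    using continuous_attains_inf[OF compact_cball _ Fcont] B_nonneg e by auto
  have F0: "F 0 \<le> e + B"
  proof -
    have "F 0 \<le> (\<integral>s. e + B \<partial>I01)" unfolding F_def
    proof (rule integral_mono)
      show "N 0 s \<le> e + B" for s using Nle[of 0 s] B[of s] by simp
    qed (use Nint in auto)
    then show ?thesis using one by simp
  qed
  have Fbig: "norm c' - B \<le> F c'" for c'
  proof -
    have "(\<integral>s. norm c' - B \<partial>I01) \<le> F c'" unfolding F_def
    proof (rule integral_mono)
      show "norm c' - B \<le> N c' s" for s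
        using Nn[of s c'] B[of s] norm_triangle_ineq3[of "kap f s" c'] by linarith
    qed (use Nint in auto)
    then show ?thesis using one by simp
  qed
  have min: "F c \<le> F c'" for c'
  proof (cases "c' \<in> cball 0 (2 * B + e)")
    case True then show ?thesis by (rule c(2))
  next
    case False
    then have "F 0 \<le> F c'" using F0 Fbig[of c'] by (simp add: not_le)
    moreover have "F c \<le> F 0" by (rule c(2)) (use B_nonneg e in simp)
    ultimately show ?thesis by simp
  qed
  \<comment> \<open>The negative gradient in \<open>c\<close> of the smoothed distance. It is
    continuous and shorter than 1, and stationarity of \<open>c\<close> will say that it has mean
    zero.\<close>
  define w where "w s = (1 / N c s) *\<^sub>R (kap f s - c)" for s
  have Npos: "N c s > 0" for s using Ne[of c s] e by simp
  have w_cont: "continuous_on UNIV w" unfolding w_def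
    by (intro continuous_intros Nc kap_cont) (use Npos in \<open>auto simp: less_imp_neq[symmetric]\<close>)
  have w1: "norm (w s) \<le> 1" for s using Nn[of s c] Npos[of s] by (simp add: w_def)
  have w_int: "integrable I01 w" by (rule continuous_integrable_I01[OF w_cont])
  \<comment> \<open>A one-sided comparison suffices: with \<open>h\<close> chosen as the mean of
    \<open>w\<close> it reads |h|^2 <= 0.\<close>
  have opt: "(\<integral>s. w s \<bullet> h \<partial>I01) \<le> 0" for h
  proof (rule field_le_epsilon)
    fix d :: real assume d: "d > 0"
    \<comment> \<open>Chosen so that the remainder \<open>t * (norm h)\<^sup>2 / (2 * e)\<close> is
      at most \<open>d\<close>; the added 1 covers \<open>h = 0\<close>.\<close>
    define t where "t = d * (2 * e) / ((norm h)\<^sup>2 + 1)"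
    have "(norm h)\<^sup>2 + 1 > 0" by (meson add_nonneg_pos zero_le_power2 zero_less_one)
    then have t: "t > 0" using d e by (simp add: t_def)
    have "F c \<le> F (c + t *\<^sub>R h)" by (rule min)
    also have "\<dots> \<le> (\<integral>s. N c s - t * (w s \<bullet> h) + t\<^sup>2 * (norm h)\<^sup>2 / (2 * e) \<partial>I01)"
      unfolding F_def
    proof (rule integral_mono)
      fix s
      have "(e, kap f s - (c + t *\<^sub>R h)) = (e, kap f s - c) + (0, - (t *\<^sub>R h))" by simp
      then have "N (c + t *\<^sub>R h) s \<le> N c s + (2 * ((e, kap f s - c) \<bullet> (0, - (t *\<^sub>R h))) + (norm (0::real, - (t *\<^sub>R h)))\<^sup>2) / (2 * N c s)"
        using norm_add_le_quadratic[of "(e, kap f s - c)" "(0, - (t *\<^sub>R h))"] e by (simp add: N_def zero_prod_def diff_diff_eq)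
      also have "\<dots> = N c s - t * (w s \<bullet> h) + t\<^sup>2 * (norm h)\<^sup>2 / (2 * N c s)"
      proof -
        have wh: "w s \<bullet> h = ((kap f s - c) \<bullet> h) / N c s" by (simp add: w_def)
        show ?thesis unfolding wh using Npos[of s] by (simp add: power_mult_distrib diff_divide_distrib add_divide_distrib)
      qed
      also have "\<dots> \<le> N c s - t * (w s \<bullet> h) + t\<^sup>2 * (norm h)\<^sup>2 / (2 * e)"
        using Ne[of c s] e by (intro add_left_mono divide_left_mono) auto
      finally show "N (c + t *\<^sub>R h) s \<le> N c s - t * (w s \<bullet> h) + t\<^sup>2 * (norm h)\<^sup>2 / (2 * e)" .
    qed (use Nint w_int in auto)
    also have "\<dots> = F c - t * (\<integral>s. w s \<bullet> h \<partial>I01) + t\<^sup>2 * (norm h)\<^sup>2 / (2 * e)"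
      using Nint w_int one by (simp add: F_def)
    finally have "t * (\<integral>s. w s \<bullet> h \<partial>I01) \<le> t * (t * (norm h)\<^sup>2 / (2 * e))" by (simp add: power2_eq_square)
    then have "(\<integral>s. w s \<bullet> h \<partial>I01) \<le> t * (norm h)\<^sup>2 / (2 * e)" using t by (simp only: mult_le_cancel_left_pos)
    also have "\<dots> = d * ((norm h)\<^sup>2 / ((norm h)\<^sup>2 + 1))" using e by (simp add: t_def)
    also have "\<dots> \<le> d * 1" using d \<open>(norm h)\<^sup>2 + 1 > 0\<close> by (intro mult_left_mono) auto
    finally show "(\<integral>s. w s \<bullet> h \<partial>I01) \<le> 0 + d" by simp
  qed
  have "(\<integral>s. w s \<partial>I01) \<bullet> (\<integral>s. w s \<partial>I01) \<le> 0"
    using opt[of "\<integral>s. w s \<partial>I01"] w_int by simp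
  then have w0: "(\<integral>s. w s \<partial>I01) = 0" by (metis inner_gt_zero_iff not_le)
  have "(\<integral>s. norm (kap f s - c) - e \<partial>I01) \<le> (\<integral>s. (kap f s - c) \<bullet> w s \<partial>I01)"
  proof (rule integral_mono)
    fix s
    let ?n = "norm (kap f s - c)"
    \<comment> \<open>Smoothing loses at most \<open>e\<close>: (n - e)(n + e) <= n^2, and the
      smoothed distance is at most n + e.\<close>
    have "?n - e \<le> ?n\<^sup>2 / N c s"
    proof (cases "?n \<le> e")
      case True then show ?thesis using Npos[of s] by (meson diff_le_0_iff_le divide_nonneg_pos order_trans zero_le_power2)
    next
      case False
      have "(?n - e) * N c s \<le> (?n - e) * (e + ?n)" using False Nle[of c s] by (intro mult_left_mono) auto
      also have "\<dots> = ?n\<^sup>2 - e\<^sup>2" by (simp add: power2_eq_square algebra_simps)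
      also have "\<dots> \<le> ?n\<^sup>2" by simp
      finally show ?thesis using Npos[of s] by (simp add: field_simps)
    qed
    also have "?n\<^sup>2 / N c s = (kap f s - c) \<bullet> w s" by (simp add: w_def power2_norm_eq_inner)
    finally show "?n - e \<le> (kap f s - c) \<bullet> w s" .
  qed (intro continuous_integrable_I01 continuous_intros kap_cont w_cont)+
  also have "(\<integral>s. (kap f s - c) \<bullet> w s \<partial>I01) = (\<integral>s. kap f s \<bullet> w s \<partial>I01) - c \<bullet> (\<integral>s. w s \<partial>I01)"
  proof -
    have "integrable I01 (\<lambda>s. kap f s \<bullet> w s)" by (intro continuous_integrable_I01 continuous_intros kap_cont w_cont)
    then show ?thesis using w_int by (simp add: inner_diff_left)
  qed
  also have "\<dots> \<le> (\<integral>s. kap f s \<bullet> v s \<partial>I01)" unfolding w0 using kap_v_max[OF w_cont w1 w0] by simp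
  finally have "(\<integral>s. norm (kap f s - c) - e \<partial>I01) \<le> (\<integral>s. kap f s \<bullet> v s \<partial>I01)" .
  moreover have "(\<integral>s. norm (kap f s - c) - e \<partial>I01) = (\<integral>s. norm (kap f s - c) \<partial>I01) - e"
  proof -
    have "integrable I01 (\<lambda>s. norm (kap f s - c))" by (intro continuous_integrable_I01 continuous_intros kap_cont)
    then show ?thesis using one by simp
  qed
  ultimately have "\<Phi> c \<le> e" unfolding \<Phi>_eq by simp
  then show ?thesis using that c(1) by simp
qed

text \<open>Approximate medians for e = 1 / (n + 1) stay in a fixed ball, and \<open>\<Phi>\<close>
  is continuous and nonnegative, so a limit point is an exact zero.\<close>

lemma median_exists: "\<exists>c. \<Phi> c = 0"
proof -
  have "\<exists>c. \<Phi> c \<le> 1 / real (Suc n) \<and> norm c \<le> 2 * B + 1 / real (Suc n)" for n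
    using approx_median[of "1 / real (Suc n)"] by (metis of_nat_0_less_iff zero_less_Suc zero_less_divide_1_iff)
  then obtain c where c: "\<And>n. \<Phi> (c n) \<le> 1 / real (Suc n)" "\<And>n. norm (c n) \<le> 2 * B + 1 / real (Suc n)" by metis
  have "c n \<in> cball 0 (2 * B + 1)" for n
  proof -
    have "1 / real (Suc n) \<le> 1" by simp
    then show ?thesis unfolding mem_cball_0 using c(2)[of n] by linarith
  qed
  then obtain l r where l: "strict_mono (r::nat\<Rightarrow>nat)" "(c \<circ> r) \<longlonglongrightarrow> l"
    using compact_cball[of "0::'a" "2*B+1", unfolded compact_def, rule_format, of c] by blast
  have "\<Phi> l \<le> 0"
  proof (rule LIMSEQ_le_const)
    have "(\<lambda>n. norm (l - c (r n))) \<longlonglongrightarrow> norm (l - l)" using l(2) by (intro tendsto_intros) (simp add: comp_def)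
    moreover have "(\<lambda>n. 1 / real (Suc (r n))) \<longlonglongrightarrow> 0"
      using LIMSEQ_subseq_LIMSEQ[OF LIMSEQ_inverse_real_of_nat l(1)] by (simp add: comp_def inverse_eq_divide)
    ultimately show "(\<lambda>n. norm (l - c (r n)) + 1 / real (Suc (r n))) \<longlonglongrightarrow> 0" using tendsto_add by fastforce
    have "\<Phi> l \<le> norm (l - c (r n)) + 1 / real (Suc (r n))" for n
      using \<Phi>_lip[of l "c (r n)"] c(1)[of "r n"] by linarith
    then show "\<exists>N. \<forall>n\<ge>N. \<Phi> l \<le> norm (l - c (r n)) + 1 / real (Suc (r n))" by blast
  qed
  moreover have "\<Phi> l \<ge> 0" unfolding \<Phi>_def by (rule integral_nonneg_AE[OF \<Phi>_nonneg_AE])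
  ultimately show ?thesis by (intro exI[of _ l]) simp
qed

text \<open>A nonnegative integrand with integral zero vanishes almost everywhere. This is equality
  in Cauchy-Schwarz between a = kap f - c and a vector \<open>v\<close> of length at most 1, which
  forces a = |a| v and, where a is not zero, |v| = 1.\<close>

lemma median_props:
  assumes "\<Phi> c = 0"
  shows "AE s in I01. kap f s - c = norm (kap f s - c) *\<^sub>R v s \<and> norm (kap f s - c) * ((norm (v s))\<^sup>2 - 1) = 0"
    and "norm (kap f s - c) \<le> 3 * B"
proof -
  have "AE s in I01. norm (kap f s - c) - (kap f s - c) \<bullet> v s = 0"
    using assms integral_nonneg_eq_0_iff_AE[OF \<Phi>_integrable \<Phi>_nonneg_AE] by (simp add: \<Phi>_def)
  then show "AE s in I01. kap f s - c = norm (kap f s - c) *\<^sub>R v s \<and> norm (kap f s - c) * ((norm (v s))\<^sup>2 - 1) = 0"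
    using v(2)
  proof eventually_elim
    case (elim s)
    define a where "a = kap f s - c"
    have av: "a \<bullet> v s = norm a" using elim(1) by (simp add: a_def)
    have "(norm (a - norm a *\<^sub>R v s))\<^sup>2 = (norm a)\<^sup>2 - 2 * norm a * (a \<bullet> v s) + (norm a)\<^sup>2 * (norm (v s))\<^sup>2"
    proof -
      have "(norm (a - b))\<^sup>2 = (norm a)\<^sup>2 - 2 * (a \<bullet> b) + (norm b)\<^sup>2" for b
        by (simp add: power2_norm_eq_inner inner_diff_left inner_diff_right inner_commute)
      from this[of "norm a *\<^sub>R v s"] show ?thesis by (simp add: power_mult_distrib)
    qed
    also have "\<dots> \<le> (norm a)\<^sup>2 - 2 * norm a * norm a + (norm a)\<^sup>2 * 1"
      unfolding av using elim(2) by (intro add_left_mono mult_left_mono) (auto simp: power_le_one)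
    also have "\<dots> = 0" by (simp add: power2_eq_square)
    finally have 1: "a = norm a *\<^sub>R v s" by simp
    have "norm a = norm a * norm (v s)" using arg_cong[OF 1, of norm] by simp
    then have "norm a = 0 \<or> norm (v s) = 1" by simp
    then have "norm a * ((norm (v s))\<^sup>2 - 1) = 0" by auto
    then show ?case using 1 unfolding a_def by blast
  qed
  have nint: "integrable I01 (\<lambda>s. norm (kap f s - c))"
    by (intro continuous_integrable_I01 continuous_intros kap_cont)
  note one = measure_I01_UNIV
  \<comment> \<open>With zero gap the mean distance to \<open>c\<close> equals the pairing of
    \<open>kap f\<close> with \<open>v\<close>, which is at most \<open>B\<close>. Hence |c| <= 2 B,
    and 3 B in total.\<close>
  have "norm c - B = (\<integral>s. norm c - B \<partial>I01)" by (simp add: one)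
  also have "\<dots> \<le> (\<integral>s. norm (kap f s - c) \<partial>I01)"
  proof (rule integral_mono)
    show "norm c - B \<le> norm (kap f s - c)" for s
      using B[of s] norm_triangle_ineq3[of "kap f s" c] by linarith
  qed (use nint in auto)
  also have "\<dots> = (\<integral>s. kap f s \<bullet> v s \<partial>I01)" using assms unfolding \<Phi>_eq by simp
  also have "\<dots> \<le> (\<integral>s. B \<partial>I01)"
  proof (rule integral_mono_AE)
    show "integrable I01 (\<lambda>s. kap f s \<bullet> v s)" by (rule integrable_cont_inner_v[OF kap_cont])
    show "AE s in I01. kap f s \<bullet> v s \<le> B" using v(2)
    proof eventually_elim
      case (elim s)
      have "kap f s \<bullet> v s \<le> norm (kap f s) * norm (v s)" by (rule norm_cauchy_schwarz)
      also have "\<dots> \<le> B * 1" using elim B B_nonneg by (intro mult_mono) auto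
      finally show ?case by simp
    qed
  qed simp
  finally have "norm c \<le> 2 * B" using one by simp
  then show "norm (kap f s - c) \<le> 3 * B" using B[of s] norm_triangle_ineq4[of "kap f s" c] by simp
qed

end

section \<open>Measurable selection\<close>

text \<open>Zeros of \<open>\<Phi> t\<close> need not be unique, so choosing one for each
  \<open>t\<close> separately could destroy measurability. The zero property is claimed only at
  parameters where the two conditions hold, while \<open>c\<close> is measurable on the whole
  space.\<close>

lemma measurable_zero_selection:
  fixes \<Phi> :: "'a \<Rightarrow> 'b::euclidean_space \<Rightarrow> real"
  assumes meas [measurable]: "\<And>c. (\<lambda>t. \<Phi> t c) \<in> borel_measurable M"
  obtains c where "c \<in> borel_measurable M"
    "\<And>t. (\<And>a b. \<bar>\<Phi> t a - \<Phi> t b\<bar> \<le> norm (a - b)) \<Longrightarrow> \<exists>a. \<Phi> t a = 0 \<Longrightarrow> \<Phi> t (c t) = 0"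
proof -
  obtain D :: "'b set" where D: "countable D" "\<And>X. open X \<Longrightarrow> X \<noteq> {} \<Longrightarrow> \<exists>d\<in>D. d \<in> X"
    using countable_dense_exists by blast
  define q where "q = from_nat_into D"
  have q: "\<exists>j. dist (q j) p < r" if "r > 0" for p r
  proof -
    have "ball p r \<noteq> {}" using that by simp
    then obtain d where "d \<in> D" "d \<in> ball p r" using D(2)[OF open_ball] by blast
    then show ?thesis unfolding q_def using from_nat_into_surj[OF D(1), of d] by (auto simp: dist_commute)
  qed
  txt \<open>\<open>Z t p r\<close> expresses by countably many conditions that the closed ball around \<open>p\<close> of radius \<open>r\<close>
    contains a zero of \<open>\<Phi> t\<close>; the selection is then that of Kuratowski and Ryll-Nardzewski.\<close>
  define Z where "Z t p r \<longleftrightarrow> (\<forall>m. \<exists>j. dist (q j) p < r + 1 / real (Suc m) \<and> \<bar>\<Phi> t (q j)\<bar> < 1 / real (Suc m))" for t p r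
  have Zm: "Measurable.pred M (\<lambda>t. Z t p r)" for p r unfolding Z_def by measurable
  define G where "G t \<longleftrightarrow> (\<forall>a b. \<bar>\<Phi> t a - \<Phi> t b\<bar> \<le> norm (a - b)) \<and> (\<exists>a. \<Phi> t a = 0)" for t
  have Z1: "Z t p r" if g: "G t" and z: "\<Phi> t a = 0" and d: "dist a p \<le> r" for t p r a
    unfolding Z_def
  proof
    fix m
    obtain j where j: "dist (q j) a < 1 / real (Suc m)" using q[of "1 / real (Suc m)" a] by auto
    have "\<bar>\<Phi> t (q j)\<bar> \<le> dist (q j) a" using g z unfolding G_def dist_norm by (metis diff_zero)
    moreover have "dist (q j) p \<le> dist (q j) a + r" using dist_triangle[of "q j" p a] d by simp
    ultimately show "\<exists>j. dist (q j) p < r + 1 / real (Suc m) \<and> \<bar>\<Phi> t (q j)\<bar> < 1 / real (Suc m)"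
      using j by (intro exI[of _ j]) linarith
  qed
  \<comment> \<open>The approximate zeros lie in the compact ball of radius r + 1; a limit point is
    a zero by continuity and lies within r of \<open>p\<close>.\<close>
  have Z2: "\<exists>a. \<Phi> t a = 0 \<and> dist a p \<le> r" if g: "G t" and z: "Z t p r" for t p r
  proof -
    obtain j where j: "\<And>m. dist (q (j m)) p < r + 1 / real (Suc m)" "\<And>m. \<bar>\<Phi> t (q (j m))\<bar> < 1 / real (Suc m)"
      using z unfolding Z_def by metis
    define y where "y m = q (j m)" for m
    have "y m \<in> cball p (r + 1)" for m
    proof -
      have "1 / real (Suc m) \<le> 1" by simp
      then show ?thesis unfolding mem_cball dist_commute[of p] y_def using j(1)[of m] by linarith
    qed
    then obtain a s where a: "strict_mono (s::nat\<Rightarrow>nat)" "(y \<circ> s) \<longlonglongrightarrow> a"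
      using compact_cball[of p "r+1", unfolded compact_def, rule_format, of y] by blast
    have lim: "(\<lambda>m. 1 / real (Suc (s m))) \<longlonglongrightarrow> 0"
      using LIMSEQ_subseq_LIMSEQ[OF LIMSEQ_inverse_real_of_nat a(1)] by (simp add: comp_def inverse_eq_divide)
    have "dist a p \<le> r + 0"
    proof (rule LIMSEQ_le)
      show "(\<lambda>m. dist (y (s m)) p) \<longlonglongrightarrow> dist a p" using a(2) by (intro tendsto_intros) (simp add: comp_def)
      show "(\<lambda>m. r + 1 / real (Suc (s m))) \<longlonglongrightarrow> r + 0" by (intro tendsto_intros lim)
      show "\<exists>N. \<forall>n\<ge>N. dist (y (s n)) p \<le> r + 1 / real (Suc (s n))"
        using j(1) less_imp_le unfolding y_def by blast
    qed
    moreover have "\<bar>\<Phi> t a\<bar> \<le> 0 + 0"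
    proof (rule LIMSEQ_le_const)
      have "(\<lambda>m. dist (y (s m)) a) \<longlonglongrightarrow> dist a a" using a(2) by (intro tendsto_intros) (simp add: comp_def)
      then show "(\<lambda>m. dist (y (s m)) a + 1 / real (Suc (s m))) \<longlonglongrightarrow> 0 + 0"
        by (intro tendsto_add lim) simp
      have "\<bar>\<Phi> t a\<bar> \<le> dist (y (s m)) a + 1 / real (Suc (s m))" for m
      proof -
        have "\<bar>\<Phi> t a - \<Phi> t (y (s m))\<bar> \<le> dist (y (s m)) a"
          using g unfolding G_def dist_norm by (metis norm_minus_commute)
        then show ?thesis using j(2)[of "s m"] unfolding y_def by linarith
      qed
      then show "\<exists>N. \<forall>n\<ge>N. \<bar>\<Phi> t a\<bar> \<le> dist (y (s n)) a + 1 / real (Suc (s n))" by blast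
    qed
    ultimately show ?thesis by (intro exI[of _ a]) simp
  qed
  \<comment> \<open>The least admissible index keeps every stage measurable. A zero lies within
    (1/2)^k of the current centre and the next centre within (1/2)^(k+1) of that zero, so centres
    move by at most 2 (1/2)^k and converge.\<close>
  define J where "J = rec_nat (\<lambda>t. LEAST j. Z t (q j) 1)
    (\<lambda>k Jk t. LEAST j. Z t (q j) ((1/2) ^ Suc k) \<and> dist (q j) (q (Jk t)) \<le> 2 * (1/2) ^ k)"
  have J0: "J 0 t = (LEAST j. Z t (q j) 1)" for t by (simp add: J_def)
  have JS: "J (Suc k) t = (LEAST j. Z t (q j) ((1/2) ^ Suc k) \<and> dist (q j) (q (J k t)) \<le> 2 * (1/2) ^ k)" for k t
    by (simp add: J_def)
  have Jm: "J k \<in> M \<rightarrow>\<^sub>M count_space UNIV" for k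
  proof (induction k)
    case 0
    have "(\<lambda>t. LEAST j. Z t (q j) 1) \<in> M \<rightarrow>\<^sub>M count_space UNIV" by (rule measurable_Least) (rule Zm)
    then show ?case using J0 by presburger
  next
    case (Suc k)
    note [measurable] = Suc Zm
    have "(\<lambda>t. LEAST j. Z t (q j) ((1/2) ^ Suc k) \<and> dist (q j) (q (J k t)) \<le> 2 * (1/2) ^ k) \<in> M \<rightarrow>\<^sub>M count_space UNIV"
      by (rule measurable_Least) measurable
    then show ?case using JS by presburger
  qed
  have Jprop: "Z t (q (J k t)) ((1/2) ^ k)" "dist (q (J (Suc k) t)) (q (J k t)) \<le> 2 * (1/2) ^ k" if G: "G t" for t k
  proof -
    have step: "Z t (q (J (Suc k) t)) ((1/2) ^ Suc k) \<and> dist (q (J (Suc k) t)) (q (J k t)) \<le> 2 * (1/2) ^ k"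
      if Zk: "Z t (q (J k t)) ((1/2) ^ k)" for k
      unfolding JS[of k]
    proof (rule LeastI_ex)
      obtain a where a: "\<Phi> t a = 0" "dist a (q (J k t)) \<le> (1/2) ^ k" using Z2[OF G Zk] by blast
      obtain j where j: "dist (q j) a < (1/2) ^ Suc k" using q[of "(1/2) ^ Suc k" a] by auto
      have "Z t (q j) ((1/2) ^ Suc k)" using j by (intro Z1[OF G a(1)]) (simp add: dist_commute)
      moreover have "dist (q j) (q (J k t)) \<le> 2 * (1/2) ^ k"
      proof -
        have "(1/2::real) ^ Suc k \<le> (1/2) ^ k" by simp
        then show ?thesis using dist_triangle[of "q j" "q (J k t)" a] j a(2) by linarith
      qed
      ultimately show "\<exists>j. Z t (q j) ((1/2) ^ Suc k) \<and> dist (q j) (q (J k t)) \<le> 2 * (1/2) ^ k" by blast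
    qed
    show Zk: "Z t (q (J k t)) ((1/2) ^ k)"
    proof (induction k)
      case 0
      obtain a where a: "\<Phi> t a = 0" using G unfolding G_def by blast
      obtain j where "dist (q j) a < 1" using q[of 1 a] by auto
      then have "Z t (q j) 1" by (intro Z1[OF G a]) (simp add: dist_commute)
      then have "Z t (q (J 0 t)) 1" unfolding J0 by (rule LeastI)
      then show ?case by simp
    next
      case (Suc k) then show ?case using step by blast
    qed
    show "dist (q (J (Suc k) t)) (q (J k t)) \<le> 2 * (1/2) ^ k" using step[OF Zk] by blast
  qed
  define c where "c t = lim (\<lambda>k. q (J k t))" for t
  have cm: "c \<in> borel_measurable M" unfolding c_def
  proof (rule borel_measurable_lim_metric)
    fix k show "(\<lambda>t. q (J k t)) \<in> borel_measurable M"
      using measurable_compose[OF Jm, of q borel] by simp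
  qed
  show ?thesis
  proof (rule that[OF cm])
    fix t assume lip: "\<And>a b. \<bar>\<Phi> t a - \<Phi> t b\<bar> \<le> norm (a - b)" and ex: "\<exists>a. \<Phi> t a = 0"
    then have G: "G t" unfolding G_def by blast
    define y where "y k = q (J k t)" for k
    have "summable (\<lambda>k. y (Suc k) - y k)"
    proof (rule summable_norm_cancel, rule summable_comparison_test')
      show "summable (\<lambda>k. 2 * (1/2::real) ^ k)" by (intro summable_mult summable_geometric) simp
      show "norm (norm (y (Suc k) - y k)) \<le> 2 * (1/2) ^ k" for k
        using Jprop(2)[OF G, of k] by (simp add: y_def dist_norm)
    qed
    then obtain L where "(\<lambda>n. \<Sum>k<n. y (Suc k) - y k) \<longlonglongrightarrow> L"
      unfolding summable_iff_convergent convergent_def by blast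
    then have "(\<lambda>n. y n - y 0) \<longlonglongrightarrow> L" using sum_lessThan_telescope[of y] by simp
    from tendsto_add[OF this tendsto_const[of "y 0"]] have "convergent y" by (auto simp: convergent_def)
    then have yc: "y \<longlonglongrightarrow> c t" unfolding c_def y_def by (simp add: convergent_LIMSEQ_iff)
    have y0: "\<bar>\<Phi> t (y k)\<bar> \<le> (1/2) ^ k" for k
    proof -
      obtain a where "\<Phi> t a = 0" "dist a (y k) \<le> (1/2) ^ k" using Z2[OF G Jprop(1)[OF G]] y_def by auto
      then show ?thesis using lip[of "y k" a] by (simp add: dist_norm norm_minus_commute)
    qed
    have "\<bar>\<Phi> t (c t)\<bar> \<le> 0 + 0"
    proof (rule LIMSEQ_le_const)
      have "(\<lambda>k. norm (c t - y k)) \<longlonglongrightarrow> norm (c t - c t)" by (intro tendsto_intros yc)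
      moreover have "(\<lambda>k. (1/2::real) ^ k) \<longlonglongrightarrow> 0" by (rule LIMSEQ_realpow_zero) auto
      ultimately show "(\<lambda>k. norm (c t - y k) + (1/2) ^ k) \<longlonglongrightarrow> 0 + 0" by (intro tendsto_add) simp_all
      have "\<bar>\<Phi> t (c t)\<bar> \<le> norm (c t - y k) + (1/2) ^ k" for k
        using lip[of "c t" "y k"] y0[of k] by linarith
      then show "\<exists>N. \<forall>n\<ge>N. \<bar>\<Phi> t (c t)\<bar> \<le> norm (c t - y n) + (1/2) ^ n" by blast
    qed
    then show "\<Phi> t (c t) = 0" by simp
  qed
qed

section \<open>Weak derivatives on the circle\<close>

lemma AE_lebesgue_I01: "(AE s in lebesgue. s \<in> {0..1} \<longrightarrow> P s) \<longleftrightarrow> (AE s in I01. P s)"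
  unfolding AE_I01 by (rule AE_completion_iff)

lemma completion_borel_version:
  fixes f :: "'a \<Rightarrow> 'b::euclidean_space"
  assumes f: "f \<in> borel_measurable (completion M)"
  obtains f' where "f' \<in> borel_measurable M" "AE x in M. f x = f' x"
proof -
  have "\<exists>g\<in>borel_measurable M. AE x in M. f x \<bullet> i = g x" for i :: 'b
    by (rule completion_ex_borel_measurable_real) (use f in measurable)
  then obtain g where g: "\<And>i. g i \<in> borel_measurable M" "\<And>i. AE x in M. f x \<bullet> i = g i x" by metis
  note [measurable] = g(1)
  have "AE x in M. \<forall>i\<in>Basis. f x \<bullet> i = g i x" using g(2) by (intro AE_finite_allI) auto
  then have "AE x in M. f x = (\<Sum>i\<in>Basis. g i x *\<^sub>R i)"
    by eventually_elim (metis (no_types, lifting) euclidean_representation sum.cong)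
  moreover have "(\<lambda>x. \<Sum>i\<in>Basis. g i x *\<^sub>R i) \<in> borel_measurable M" by measurable
  ultimately show ?thesis by (rule that[rotated])
qed

text \<open>The notions of the theorem integrate over the completed measure, the construction works
  with Borel functions. Here \<open>h'\<close> is a Borel version of \<open>h\<close> on the
  interval, outside which nothing is known about \<open>h\<close>.\<close>

lemma set_integral_lebesgue_I01:
  fixes h :: "real \<Rightarrow> 'a::euclidean_space"
  assumes h: "AE s in I01. h s = h' s" and [measurable]: "h' \<in> borel_measurable borel"
    and hm: "(\<lambda>s. indicator {0..1} s *\<^sub>R h s) \<in> borel_measurable lebesgue"
  shows "(LINT s:{0..1}|lebesgue. h s) = (\<integral>s. h' s \<partial>I01)"
    and "set_integrable lebesgue {0..1} h \<longleftrightarrow> integrable I01 h'"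
proof -
  have ae: "AE s in lebesgue. indicator {0..1} s *\<^sub>R h s = indicator {0..1} s *\<^sub>R h' s"
    using h unfolding AE_lebesgue_I01[symmetric] by eventually_elim (auto simp: indicator_def)
  have m: "(\<lambda>s. indicator {0..1} s *\<^sub>R h' s) \<in> borel_measurable borel" by measurable
  have m': "(\<lambda>s. indicator {0..1} s *\<^sub>R h' s) \<in> borel_measurable lebesgue"
    by (rule measurable_completion) (use m in simp)
  have "(LINT s:{0..1}|lebesgue. h s) = (\<integral>s. indicator {0..1} s *\<^sub>R h' s \<partial>lebesgue)"
    unfolding set_lebesgue_integral_def by (rule integral_cong_AE[OF hm m' ae])
  also have "\<dots> = (\<integral>s. indicator {0..1} s *\<^sub>R h' s \<partial>lborel)"
    by (rule integral_completion) (use m in simp)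
  finally show "(LINT s:{0..1}|lebesgue. h s) = (\<integral>s. h' s \<partial>I01)"
    by (simp add: integral_I01 set_lebesgue_integral_def)
  have "set_integrable lebesgue {0..1} h \<longleftrightarrow> integrable lebesgue (\<lambda>s. indicator {0..1} s *\<^sub>R h' s)"
    unfolding set_integrable_def by (rule integrable_cong_AE[OF hm m' ae])
  also have "\<dots> \<longleftrightarrow> integrable lborel (\<lambda>s. indicator {0..1} s *\<^sub>R h' s)"
    by (rule integrable_completion) (use m in simp)
  finally show "set_integrable lebesgue {0..1} h \<longleftrightarrow> integrable I01 h'"
    by (simp add: integrable_I01 set_integrable_def)
qed

lemma set_integral_lebesgue_borel:
  fixes h :: "real \<Rightarrow> 'a::euclidean_space"
  assumes h: "h \<in> borel_measurable borel"
  shows "(LINT s:{0..1}|lebesgue. h s) = (\<integral>s. h s \<partial>I01)"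
    and "set_integrable lebesgue {0..1} h \<longleftrightarrow> integrable I01 h"
proof -
  have "(\<lambda>s. indicator {0..1} s *\<^sub>R h s) \<in> borel_measurable lebesgue"
    by (rule measurable_completion) (use h in measurable)
  from set_integral_lebesgue_I01[OF _ h this, OF AE_I2[OF refl]]
  show "(LINT s:{0..1}|lebesgue. h s) = (\<integral>s. h s \<partial>I01)"
    "set_integrable lebesgue {0..1} h \<longleftrightarrow> integrable I01 h" by auto
qed

lemma weak_deriv_S1_borel_iff:
  fixes f g :: "real \<Rightarrow> 'a::euclidean_space"
  assumes f: "f \<in> borel_measurable borel" and g: "g \<in> borel_measurable borel"
  shows "weak_deriv_S1 f g \<longleftrightarrow> integrable I01 f \<and> integrable I01 g \<and>
    (\<forall>\<phi> \<phi>'. test_S1 \<phi> \<phi>' \<longrightarrow> (\<integral>s. \<phi>' s *\<^sub>R f s \<partial>I01) = - (\<integral>s. \<phi> s *\<^sub>R g s \<partial>I01))"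
proof -
  have "(LINT s:{0..1}|lebesgue. \<phi>' s *\<^sub>R f s) = (\<integral>s. \<phi>' s *\<^sub>R f s \<partial>I01)"
    "(LINT s:{0..1}|lebesgue. \<phi> s *\<^sub>R g s) = (\<integral>s. \<phi> s *\<^sub>R g s \<partial>I01)" if "test_S1 \<phi> \<phi>'" for \<phi> \<phi>'
  proof -
    have "continuous_on UNIV \<phi>'" "continuous_on UNIV \<phi>"
      using that unfolding test_S1_def by (auto intro!: DERIV_continuous_on simp: has_field_derivative_at_within)
    then have [measurable]: "\<phi>' \<in> borel_measurable borel" "\<phi> \<in> borel_measurable borel"
      by (auto intro: borel_measurable_continuous_onI)
    note [measurable] = f g
    show "(LINT s:{0..1}|lebesgue. \<phi>' s *\<^sub>R f s) = (\<integral>s. \<phi>' s *\<^sub>R f s \<partial>I01)"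
      "(LINT s:{0..1}|lebesgue. \<phi> s *\<^sub>R g s) = (\<integral>s. \<phi> s *\<^sub>R g s \<partial>I01)"
      by (rule set_integral_lebesgue_borel, measurable)+
  qed
  then show ?thesis unfolding weak_deriv_S1_def
    using set_integral_lebesgue_borel(2)[OF f] set_integral_lebesgue_borel(2)[OF g] by auto
qed

lemma test_S1_FTC:
  assumes "test_S1 \<phi> \<phi>'"
  shows "continuous_on UNIV \<phi>" "continuous_on UNIV \<phi>'" "\<phi> 1 = \<phi> 0"
    "set_integrable lborel {0..1} \<phi>'" "x \<in> {0..1} \<Longrightarrow> \<phi> x = \<phi> 0 + (LINT r:{0..x}|lborel. \<phi>' r)"
proof -
  have d: "\<And>s. (\<phi> has_real_derivative \<phi>' s) (at s)" and c: "continuous_on UNIV \<phi>'" and p: "\<And>s. \<phi> (s + 1) = \<phi> s"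
    using assms by (auto simp: test_S1_def periodic1_def)
  show "continuous_on UNIV \<phi>" using d by (auto intro!: DERIV_continuous_on simp: has_field_derivative_at_within)
  show "continuous_on UNIV \<phi>'" by (rule c)
  show "\<phi> 1 = \<phi> 0" using p[of 0] by simp
  show "set_integrable lborel {0..1} \<phi>'"
    by (rule borel_integrable_atLeastAtMost') (rule continuous_on_subset[OF c], simp)
  assume x: "x \<in> {0..1}"
  have "((\<lambda>r. \<phi>' r) has_integral (\<phi> x - \<phi> 0)) {0..x}"
    by (rule fundamental_theorem_of_calculus)
      (use x d in \<open>auto simp: has_real_derivative_iff_has_vector_derivative[symmetric] has_field_derivative_at_within\<close>)
  moreover have "set_integrable lborel {0..x} \<phi>'"
    by (rule borel_integrable_atLeastAtMost') (rule continuous_on_subset[OF c], simp)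
  ultimately show "\<phi> x = \<phi> 0 + (LINT r:{0..x}|lborel. \<phi>' r)"
    using set_borel_integral_eq_integral(2)[of "{0..x}" \<phi>'] by (simp add: integral_unique)
qed

text \<open>The boundary terms cancel because the test function and \<open>F\<close> both take equal
  values at 0 and 1. The function \<open>f\<close> has to agree with the primitive only almost
  everywhere, as happens for sigma x_s and kappa - c.\<close>

lemma weak_deriv_S1_primitive:
  fixes f g :: "real \<Rightarrow> 'a::euclidean_space"
  assumes [measurable]: "f \<in> borel_measurable borel" "g \<in> borel_measurable borel"
    and int: "integrable I01 g"
    and F: "\<And>b. b \<in> {0..1} \<Longrightarrow> F b = F 0 + (LINT r:{0..b}|lborel. g r)" and per: "F 1 = F 0"
    and fF: "AE s in I01. f s = F s" and fint: "integrable I01 f"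
  shows "weak_deriv_S1 f g"
  unfolding weak_deriv_S1_borel_iff[OF assms(1,2)]
proof (intro conjI allI impI)
  fix \<phi> \<phi>' assume t: "test_S1 \<phi> \<phi>'"
  note T = test_S1_FTC[OF t]
  have [measurable]: "\<phi>' \<in> borel_measurable borel" "\<phi> \<in> borel_measurable borel"
    using T(1,2) by (auto intro: borel_measurable_continuous_onI)
  have g: "set_integrable lborel {0..1} g" using int by (simp add: integrable_I01)
  note I = ibp_scaleR[OF T(4) g zero_le_one T(5) F]
  have "(LINT x:{0..1}|lborel. \<phi> x *\<^sub>R g x) + (LINT x:{0..1}|lborel. \<phi>' x *\<^sub>R F x) = 0"
    using I(3) per T(3) by simp
  moreover have "(LINT x:{0..1}|lborel. \<phi>' x *\<^sub>R F x) = (LINT x:{0..1}|lborel. \<phi>' x *\<^sub>R f x)"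
    unfolding set_lebesgue_integral_def
  proof (rule integral_cong_AE)
    show "(\<lambda>x. indicator {0..1} x *\<^sub>R \<phi>' x *\<^sub>R F x) \<in> borel_measurable lborel"
      using I(2) unfolding set_integrable_def by (rule borel_measurable_integrable)
    show "AE x in lborel. indicator {0..1} x *\<^sub>R \<phi>' x *\<^sub>R F x = indicator {0..1} x *\<^sub>R \<phi>' x *\<^sub>R f x"
      using fF unfolding AE_I01 by eventually_elim (auto simp: indicator_def)
  qed measurable
  ultimately show "(\<integral>s. \<phi>' s *\<^sub>R f s \<partial>I01) = - (\<integral>s. \<phi> s *\<^sub>R g s \<partial>I01)"
    by (simp add: integral_I01 add_eq_0_iff)
qed (use int fint in auto)

text \<open>The positive and negative parts of \<open>k\<close> are densities of two finite measures
  that agree on all half-lines, hence coincide.\<close>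

lemma AE_zero_of_tails:
  fixes k :: "real \<Rightarrow> real"
  assumes k: "integrable I01 k" and tail: "\<And>a. 0 \<le> a \<Longrightarrow> a < 1 \<Longrightarrow> (\<integral>s. indicator {a<..<1} s * k s \<partial>I01) = 0"
  shows "AE s in I01. k s = 0"
proof -
  have [measurable]: "k \<in> borel_measurable borel" using borel_measurable_integrable[OF k] by simp
  define p where "p s = ennreal (k s)" for s
  define n where "n s = ennreal (- k s)" for s
  have [measurable]: "p \<in> borel_measurable borel" "n \<in> borel_measurable borel" unfolding p_def n_def by measurable
  have fin: "(\<integral>\<^sup>+s. p s \<partial>I01) < \<infinity>" "(\<integral>\<^sup>+s. n s \<partial>I01) < \<infinity>"
    using real_integrable_def[of I01 k] k by (auto simp: p_def n_def less_top)
  have tail': "(\<integral>s. indicator {a<..} s * k s \<partial>I01) = 0" for a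
  proof -
    define b where "b = max 0 a"
    have "(\<integral>s. indicator {a<..} s * k s \<partial>I01) = (\<integral>s. indicator {b<..<1} s * k s \<partial>I01)"
    proof (rule integral_cong_AE)
      show "AE s in I01. indicator {a<..} s * k s = indicator {b<..<1} s * k s"
        using AE_I01_ivl by eventually_elim (auto simp: b_def indicator_def)
    qed measurable
    also have "\<dots> = 0"
    proof (cases "b < 1")
      case True then show ?thesis by (intro tail) (auto simp: b_def)
    next
      case False
      then have "{b<..<1} = {}" by auto
      then show ?thesis by simp
    qed
    finally show ?thesis .
  qed
  have eq: "(\<integral>\<^sup>+s. p s * indicator {a<..} s \<partial>I01) = (\<integral>\<^sup>+s. n s * indicator {a<..} s \<partial>I01)" for a
  proof -
    let ?h = "\<lambda>s. indicator {a<..} s * k s"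
    have h: "integrable I01 ?h" using integrable_mult_indicator[OF _ k, of "{a<..}"] by simp
    have "0 = enn2real (\<integral>\<^sup>+s. ennreal (?h s) \<partial>I01) - enn2real (\<integral>\<^sup>+s. ennreal (- ?h s) \<partial>I01)"
      using real_lebesgue_integral_def[OF h] tail'[of a] by simp
    moreover have "(\<integral>\<^sup>+s. ennreal (?h s) \<partial>I01) < \<infinity>" "(\<integral>\<^sup>+s. ennreal (- ?h s) \<partial>I01) < \<infinity>"
      using real_integrable_def[of I01 ?h] h by (auto simp: less_top)
    ultimately have "(\<integral>\<^sup>+s. ennreal (?h s) \<partial>I01) = (\<integral>\<^sup>+s. ennreal (- ?h s) \<partial>I01)"
      by (metis eq_iff_diff_eq_0 ennreal_enn2real infinity_ennreal_def)
    moreover have "ennreal (?h s) = p s * indicator {a<..} s" "ennreal (- ?h s) = n s * indicator {a<..} s" for s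
      by (auto simp: p_def n_def indicator_def)
    ultimately show ?thesis by simp
  qed
  have "density I01 p = density I01 n"
  proof (rule measure_eqI_lessThan)
    show "emeasure (density I01 p) {x<..} < \<infinity>" for x
    proof -
      have "emeasure (density I01 p) {x<..} \<le> (\<integral>\<^sup>+s. p s \<partial>I01)"
        by (subst emeasure_density) (auto intro!: nn_integral_mono simp: indicator_def)
      then show ?thesis using fin(1) by (rule le_less_trans)
    qed
    show "emeasure (density I01 p) {x<..} = emeasure (density I01 n) {x<..}" for x
      using eq by (simp add: emeasure_density)
  qed auto
  then have "AE s in I01. p s = n s"
    using fin by (subst (asm) finite_density_unique) auto
  then show ?thesis
  proof eventually_elim
    case (elim s)
    then show ?case unfolding p_def n_def
      by (cases "0 \<le> k s") (auto simp: ennreal_neg)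
  qed
qed

text \<open>The increment of an antiderivative over one period does not depend on the starting
  point, and it equals the mean of \<open>\<psi>\<close>.\<close>

lemma periodic_antiderivative:
  fixes \<psi> :: "real \<Rightarrow> real"
  assumes c: "continuous_on UNIV \<psi>" and p: "\<And>s. \<psi> (s + 1) = \<psi> s" and m: "(\<integral>s. \<psi> s \<partial>I01) = 0"
  obtains \<phi> where "test_S1 \<phi> \<psi>"
proof -
  have "\<exists>F. \<forall>x::real. - \<infinity> < ereal x \<longrightarrow> ereal x < \<infinity> \<longrightarrow> (F has_vector_derivative \<psi> x) (at x)"
    by (rule einterval_antiderivative) (use c in \<open>auto simp: continuous_on_eq_continuous_at\<close>)
  then obtain \<phi> where d: "\<And>x. (\<phi> has_real_derivative \<psi> x) (at x)"
    by (auto simp: has_real_derivative_iff_has_vector_derivative)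
  have "((\<lambda>s. \<phi> (s + 1) - \<phi> s) has_real_derivative 0) (at s)" for s
  proof -
    have "((\<lambda>s. \<phi> (s + 1)) has_real_derivative \<psi> (s + 1)) (at s)"
      using d[of "s + 1"] by (simp add: DERIV_shift)
    from DERIV_diff[OF this d[of s]] show ?thesis by (simp add: p)
  qed
  then have const: "\<phi> (s + 1) - \<phi> s = \<phi> (0 + 1) - \<phi> 0" for s
    using DERIV_isconst_all[of "\<lambda>s. \<phi> (s + 1) - \<phi> s" s 0] by blast
  have "(\<psi> has_integral (\<phi> 1 - \<phi> 0)) {0..1}"
    by (rule fundamental_theorem_of_calculus)
      (use d in \<open>auto simp: has_real_derivative_iff_has_vector_derivative[symmetric] has_field_derivative_at_within\<close>)
  moreover have "set_integrable lborel {0..1} \<psi>"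
    by (rule borel_integrable_atLeastAtMost') (rule continuous_on_subset[OF c], simp)
  ultimately have "\<phi> 1 - \<phi> 0 = (\<integral>s. \<psi> s \<partial>I01)"
    using set_borel_integral_eq_integral(2)[of "{0..1}" \<psi>] borel_measurable_continuous_onI[OF c]
    by (simp add: integral_unique integral_I01)
  then have "\<phi> 1 = \<phi> 0" using m by simp
  then have "test_S1 \<phi> \<psi>" using const d c unfolding test_S1_def periodic1_def by simp
  then show ?thesis by (rule that)
qed

text \<open>The du Bois-Reymond argument on the circle: a continuous periodic w minus its mean is
  the derivative of a test function, so h minus its mean is orthogonal to every such w, and in the
  limit to the indicators of the intervals (a, 1).\<close>

lemma weak_deriv_zero_const:
  fixes h :: "real \<Rightarrow> 'a::euclidean_space"
  assumes h: "integrable I01 h"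
    and weak: "\<And>\<phi> \<phi>'. test_S1 \<phi> \<phi>' \<Longrightarrow> (\<integral>s. \<phi>' s *\<^sub>R h s \<partial>I01) = 0"
  shows "AE s in I01. h s = (\<integral>s. h s \<partial>I01)"
proof -
  define m where "m = (\<integral>s. h s \<partial>I01)"
  have [measurable]: "h \<in> borel_measurable borel" using borel_measurable_integrable[OF h] by simp
  note one = measure_I01_UNIV
  have bounded_int: "integrable I01 (\<lambda>s. w s *\<^sub>R k s)"
    if "continuous_on UNIV w" "\<And>s. \<bar>w s\<bar> \<le> C" "integrable I01 k" for w :: "real \<Rightarrow> real" and k :: "real \<Rightarrow> 'a" and C
  proof (rule Bochner_Integration.integrable_bound)
    show "integrable I01 (\<lambda>s. C * norm (k s))" using that(3) by simp
    have "w \<in> borel_measurable I01" "k \<in> borel_measurable I01"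
      using borel_measurable_continuous_onI[OF that(1)] borel_measurable_integrable[OF that(3)] by simp_all
    then show "(\<lambda>s. w s *\<^sub>R k s) \<in> borel_measurable I01" by measurable
    have "\<bar>w s\<bar> * norm (k s) \<le> C * norm (k s)" for s by (intro mult_right_mono that) auto
    then show "AE s in I01. norm (w s *\<^sub>R k s) \<le> norm (C * norm (k s))"
      by (intro AE_I2) (simp add: order_trans[OF _ abs_ge_self])
  qed
  have zero: "(\<integral>s. w s *\<^sub>R (h s - m) \<partial>I01) = 0"
    if w: "continuous_on UNIV w" "\<And>s. w (s + 1) = w s" "\<And>s. \<bar>w s\<bar> \<le> C" for w :: "real \<Rightarrow> real" and C
  proof -
    define a where "a = (\<integral>s. w s \<partial>I01)"
    have wi: "integrable I01 w" by (rule continuous_integrable_I01[OF w(1)])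
    have mean: "(\<integral>s. w s - a \<partial>I01) = 0" using wi one by (simp add: a_def)
    have cont: "continuous_on UNIV (\<lambda>s. w s - a)" by (intro continuous_intros w(1))
    obtain \<phi> where "test_S1 \<phi> (\<lambda>s. w s - a)"
      by (rule periodic_antiderivative[OF cont _ mean]) (simp_all add: w)
    from weak[OF this] have "(\<integral>s. w s *\<^sub>R h s - a *\<^sub>R h s \<partial>I01) = 0" by (simp add: algebra_simps)
    then have "(\<integral>s. w s *\<^sub>R h s \<partial>I01) = a *\<^sub>R m"
      using bounded_int[OF w(1,3) h] h by (simp add: m_def)
    then show ?thesis
      using bounded_int[OF w(1,3) h] wi by (simp add: scaleR_diff_right a_def)
  qed
  define k where "k s = h s - m" for s
  have k: "integrable I01 k" unfolding k_def using h by simp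
  note [measurable] = borel_measurable_integrable[OF k, simplified]
  have "AE s in I01. k s \<bullet> i = 0" for i
  proof (rule AE_zero_of_tails)
    show "integrable I01 (\<lambda>s. k s \<bullet> i)" using k by simp
    fix a :: real assume a: "0 \<le> a" "a < 1"
    \<comment> \<open>Multiplied by n + 1 this is the ramp that equals 1 at distance at least
      1/(n+1) from a and from 1 inside (a, 1). Unscaled it is 1-Lipschitz and equal at 0 and 1, so
      \<open>periodic_Lip1_exists\<close> makes it periodic.\<close>
    define G where "G n s = min (1 / real (Suc n)) (max 0 (min (s - a) (1 - s)))" for n s
    have "\<exists>z\<in>Lip1. \<forall>s\<in>{0..1}. ev z s = G n s" for n
    proof -
      have "G n 1 = G n 0" using a by (simp add: G_def)
      moreover have "norm (G n s - G n s') \<le> \<bar>s - s'\<bar>" for s s'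
        unfolding G_def by (auto simp: min_def max_def abs_if)
      ultimately show ?thesis using periodic_Lip1_exists[of "G n"] by metis
    qed
    then obtain z where z: "\<And>n. z n \<in> Lip1" "\<And>n s. s \<in> {0..1} \<Longrightarrow> ev (z n) s = G n s" by metis
    define w where "w n s = real (Suc n) * ev (z n) s" for n s
    have wG: "w n s = min 1 (real (Suc n) * max 0 (min (s - a) (1 - s)))" if "s \<in> {0..1}" for n s
      using z(2)[OF that, of n] by (simp add: w_def G_def min_mult_distrib_left)
    have w01: "\<bar>w n s\<bar> \<le> 1" if "s \<in> {0..1}" for n s using wG[OF that, of n] by simp
    have w1: "\<bar>w n s\<bar> \<le> 1" for n s
      using w01[of "frac s" n] ev_frac[of "z n" s] unfolding w_def
      by (simp add: frac_ge_0 less_imp_le[OF frac_lt_1])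
    have wc: "continuous_on UNIV (w n)" for n unfolding w_def by (intro continuous_intros ev_cont)
    have "(\<lambda>n. \<integral>s. w n s *\<^sub>R k s \<partial>I01) \<longlonglongrightarrow> (\<integral>s. indicator {a<..<1} s *\<^sub>R k s \<partial>I01)"
    proof (rule integral_dominated_convergence[where w="\<lambda>s. norm (k s)"])
      show "AE s in I01. (\<lambda>n. w n s *\<^sub>R k s) \<longlonglongrightarrow> indicator {a<..<1} s *\<^sub>R k s"
        using AE_I01_ivl
      proof eventually_elim
        case (elim s)
        have "eventually (\<lambda>n. w n s = indicator {a<..<1} s) sequentially"
        proof (cases "a < s")
          case True
          define d where "d = min (s - a) (1 - s)"
          have d: "d > 0" using True elim by (simp add: d_def)
          obtain N where N: "1 / real (Suc N) < d" using nat_approx_posE[OF d] .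
          show ?thesis unfolding eventually_sequentially
          proof (intro exI[of _ N] allI impI)
            fix n assume "N \<le> n"
            then have "1 / real (Suc n) \<le> 1 / real (Suc N)" by (simp add: frac_le)
            then have "1 / real (Suc n) < d" using N by linarith
            then have "1 \<le> real (Suc n) * d" by (simp add: field_simps)
            then show "w n s = indicator {a<..<1} s"
              using wG[of s n] elim True d by (simp add: d_def[symmetric] max_absorb2)
          qed
        next
          case False
          then have "w n s = indicator {a<..<1} s" for n using wG[of s n] elim by simp
          then show ?thesis by simp
        qed
        then have "(\<lambda>n. w n s) \<longlonglongrightarrow> indicator {a<..<1} s" by (rule tendsto_eventually)
        then show ?case by (intro tendsto_intros)
      qed
      show "AE s in I01. norm (w n s *\<^sub>R k s) \<le> norm (k s)" for n
        using w1[of n] by (intro AE_I2) (simp add: mult_left_le_one_le)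
      show "(\<lambda>s. w n s *\<^sub>R k s) \<in> borel_measurable I01" for n
        using borel_measurable_continuous_onI[OF wc[of n]] by measurable
    qed (use k in auto)
    moreover have "(\<integral>s. w n s *\<^sub>R k s \<partial>I01) = 0" for n
      unfolding k_def by (rule zero[OF wc _ w1]) (simp add: w_def ev_periodic)
    ultimately have "(\<integral>s. indicator {a<..<1} s *\<^sub>R k s \<partial>I01) = 0"
      using LIMSEQ_unique[OF _ tendsto_const] by simp
    moreover have "integrable I01 (\<lambda>s. indicator {a<..<1} s *\<^sub>R k s)"
      by (rule integrable_mult_indicator[OF _ k]) simp
    ultimately show "(\<integral>s. indicator {a<..<1} s * (k s \<bullet> i) \<partial>I01) = 0"
      using integral_inner_left[of i I01 "\<lambda>s. indicator {a<..<1} s *\<^sub>R k s"] by simp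
  qed
  then have "AE s in I01. \<forall>i\<in>Basis. k s \<bullet> i = 0" by (intro AE_finite_allI) auto
  then show ?thesis
  proof eventually_elim
    case (elim s)
    then have "k s = 0" by (subst euclidean_eq_iff) simp
    then show ?case by (simp add: k_def m_def)
  qed
qed

text \<open>The constant test function shows that the weak derivative has mean zero, so it has a
  primitive in \<open>Lip1\<close>. The datum differs from it by a function with zero weak
  derivative, that is, by a constant.\<close>

lemma lipschitz_representative:
  fixes \<xi>0 :: "real \<Rightarrow> 'a::euclidean_space"
  assumes wd: "weak_deriv_S1 \<xi>0 g" and g1: "AE s in lebesgue. s \<in> {0..1} \<longrightarrow> norm (g s) \<le> 1"
  obtains z where "z \<in> Lip1" "AE s in lebesgue. s \<in> {0..1} \<longrightarrow> ev z s = \<xi>0 s"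
proof -
  have version: "\<exists>h'. h' \<in> borel_measurable borel \<and> (AE s in I01. h s = h' s) \<and> (\<lambda>s. indicator {0..1} s *\<^sub>R h s) \<in> borel_measurable lebesgue"
    if "set_integrable lebesgue {0..1} h" for h :: "real \<Rightarrow> 'a"
  proof -
    have m: "(\<lambda>s. indicator {0..1} s *\<^sub>R h s) \<in> borel_measurable lebesgue"
      using that unfolding set_integrable_def by (rule borel_measurable_integrable)
    obtain h' where "h' \<in> borel_measurable lborel" "AE s in lborel. indicator {0..1} s *\<^sub>R h s = h' s"
      by (rule completion_borel_version[OF m])
    then show ?thesis using m by (intro exI[of _ h']) (auto simp: AE_I01 indicator_def elim: eventually_mono)
  qed
  have i: "set_integrable lebesgue {0..1} \<xi>0" "set_integrable lebesgue {0..1} g"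
    using wd unfolding weak_deriv_S1_def by auto
  obtain x where x: "x \<in> borel_measurable borel" "AE s in I01. \<xi>0 s = x s" "(\<lambda>s. indicator {0..1} s *\<^sub>R \<xi>0 s) \<in> borel_measurable lebesgue"
    using version[OF i(1)] by blast
  obtain w where w: "w \<in> borel_measurable borel" "AE s in I01. g s = w s" "(\<lambda>s. indicator {0..1} s *\<^sub>R g s) \<in> borel_measurable lebesgue"
    using version[OF i(2)] by blast
  note [measurable] = x(1) w(1)
  have xi: "integrable I01 x" using set_integral_lebesgue_I01(2)[OF x(2,1,3)] i(1) by simp
  have wi: "integrable I01 w" using set_integral_lebesgue_I01(2)[OF w(2,1,3)] i(2) by simp
  have weak: "(\<integral>s. \<phi>' s *\<^sub>R x s \<partial>I01) = - (\<integral>s. \<phi> s *\<^sub>R w s \<partial>I01)" if t: "test_S1 \<phi> \<phi>'" for \<phi> \<phi>'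
  proof -
    have [measurable]: "\<phi>' \<in> borel_measurable borel" "\<phi> \<in> borel_measurable borel"
      using test_S1_FTC(1,2)[OF t] by (auto intro: borel_measurable_continuous_onI)
    have mult: "(\<lambda>s. indicator {0..1} s *\<^sub>R q s *\<^sub>R h s) \<in> borel_measurable lebesgue"
      if [measurable]: "q \<in> borel_measurable borel" and hm: "(\<lambda>s. indicator {0..1} s *\<^sub>R h s) \<in> borel_measurable lebesgue"
      for q :: "real \<Rightarrow> real" and h :: "real \<Rightarrow> 'a"
    proof -
      have "q \<in> borel_measurable lebesgue" by (rule measurable_completion) simp
      then have "(\<lambda>s. q s *\<^sub>R (indicator {0..1} s *\<^sub>R h s)) \<in> borel_measurable lebesgue"
        using hm by (rule borel_measurable_scaleR)
      then show ?thesis by (simp add: mult.commute)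
    qed
    have "(LINT s:{0..1}|lebesgue. \<phi>' s *\<^sub>R \<xi>0 s) = (\<integral>s. \<phi>' s *\<^sub>R x s \<partial>I01)"
    proof (rule set_integral_lebesgue_I01(1))
      show "AE s in I01. \<phi>' s *\<^sub>R \<xi>0 s = \<phi>' s *\<^sub>R x s" using x(2) by eventually_elim simp
      show "(\<lambda>s. indicator {0..1} s *\<^sub>R \<phi>' s *\<^sub>R \<xi>0 s) \<in> borel_measurable lebesgue"
        by (rule mult[OF _ x(3)]) measurable
    qed measurable
    moreover have "(LINT s:{0..1}|lebesgue. \<phi> s *\<^sub>R g s) = (\<integral>s. \<phi> s *\<^sub>R w s \<partial>I01)"
    proof (rule set_integral_lebesgue_I01(1))
      show "AE s in I01. \<phi> s *\<^sub>R g s = \<phi> s *\<^sub>R w s" using w(2) by eventually_elim simp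
      show "(\<lambda>s. indicator {0..1} s *\<^sub>R \<phi> s *\<^sub>R g s) \<in> borel_measurable lebesgue"
        by (rule mult[OF _ w(3)]) measurable
    qed measurable
    ultimately show ?thesis using wd t unfolding weak_deriv_S1_def by simp
  qed
  have "test_S1 (\<lambda>_. 1) (\<lambda>_. 0)" by (auto simp: test_S1_def periodic1_def intro!: derivative_eq_intros)
  from weak[OF this] have w0: "(\<integral>s. w s \<partial>I01) = 0" by simp
  have w1: "AE s in I01. norm (w s) \<le> 1"
    using w(2) g1 unfolding AE_lebesgue_I01 by eventually_elim simp
  obtain G where G: "G \<in> Lip1" "\<And>b. b \<in> {0..1} \<Longrightarrow> (LINT r:{0..b}|lborel. w r) = ev G b" "ev G 0 = 0"
    using Lip1_primitive[OF w(1) w1 w0] by blast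
  have Gi: "integrable I01 (ev G)" by (rule continuous_integrable_I01[OF ev_cont])
  have "weak_deriv_S1 (ev G) w"
    by (rule weak_deriv_S1_primitive[where F="ev G"])
      (use G wi Gi w ev_periodic[of G 0] in auto)
  then have Gw: "(\<integral>s. \<phi>' s *\<^sub>R ev G s \<partial>I01) = - (\<integral>s. \<phi> s *\<^sub>R w s \<partial>I01)" if "test_S1 \<phi> \<phi>'" for \<phi> \<phi>'
    using that w by (simp add: weak_deriv_S1_borel_iff)
  define h where "h s = x s - ev G s" for s
  have hi: "integrable I01 h" unfolding h_def using xi Gi by simp
  have "AE s in I01. h s = (\<integral>s. h s \<partial>I01)"
  proof (rule weak_deriv_zero_const[OF hi])
    fix \<phi> \<phi>' assume t: "test_S1 \<phi> \<phi>'"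
    have c: "continuous_on {0..1} \<phi>'" using test_S1_FTC(2)[OF t] by (rule continuous_on_subset) simp
    have [measurable]: "\<phi>' \<in> borel_measurable borel"
      using test_S1_FTC(2)[OF t] by (rule borel_measurable_continuous_onI)
    have "bounded (\<phi>' ` {0..1})" by (intro compact_imp_bounded compact_continuous_image c) simp
    then obtain C where C: "\<forall>y\<in>\<phi>' ` {0..1}. norm y \<le> C" unfolding bounded_iff by blast
    have int: "integrable I01 (\<lambda>s. \<phi>' s *\<^sub>R k s)" if "integrable I01 k" for k :: "real \<Rightarrow> 'a"
    proof (rule Bochner_Integration.integrable_bound)
      show "integrable I01 (\<lambda>s. C * norm (k s))" using that by simp
      show "(\<lambda>s. \<phi>' s *\<^sub>R k s) \<in> borel_measurable I01"
        using borel_measurable_integrable[OF that] by measurable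
      show "AE s in I01. norm (\<phi>' s *\<^sub>R k s) \<le> norm (C * norm (k s))"
        using AE_I01_ivl
      proof eventually_elim
        case (elim s)
        then have "\<bar>\<phi>' s\<bar> \<le> C" using C by auto
        then have "\<bar>\<phi>' s\<bar> * norm (k s) \<le> C * norm (k s)" by (rule mult_right_mono) simp
        then show ?case by (simp add: order_trans[OF _ abs_ge_self])
      qed
    qed
    show "(\<integral>s. \<phi>' s *\<^sub>R h s \<partial>I01) = 0"
      using weak[OF t] Gw[OF t] int[OF xi] int[OF Gi] by (simp add: h_def scaleR_diff_right)
  qed
  define m where "m = (\<integral>s. h s \<partial>I01)"
  have ev: "ev (Cper (\<lambda>s. ev G s + m)) = (\<lambda>s. ev G s + m)"
    by (intro Cper_inverse) (auto intro!: continuous_intros ev_cont simp: ev_periodic)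
  show ?thesis
  proof (rule that)
    show "Cper (\<lambda>s. ev G s + m) \<in> Lip1" using G(1) by (simp add: Lip1_def ev)
    show "AE s in lebesgue. s \<in> {0..1} \<longrightarrow> ev (Cper (\<lambda>s. ev G s + m)) s = \<xi>0 s"
      unfolding AE_lebesgue_I01 ev using \<open>AE s in I01. h s = (\<integral>s. h s \<partial>I01)\<close> x(2)
      by eventually_elim (simp add: h_def m_def algebra_simps)
  qed
qed

section \<open>Space-time measurability and integrability\<close>

lemma sq_finite_of_close:
  fixes f g :: "'a \<Rightarrow> 'b::euclidean_space"
  assumes [measurable]: "f \<in> borel_measurable M" "g \<in> borel_measurable M"
    and f: "(\<integral>\<^sup>+x. ennreal ((norm (f x))\<^sup>2) \<partial>M) < \<infinity>"
    and fg: "(\<integral>\<^sup>+x. ennreal ((norm (f x - g x))\<^sup>2) \<partial>M) < \<infinity>"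
  shows "(\<integral>\<^sup>+x. ennreal ((norm (g x))\<^sup>2) \<partial>M) < \<infinity>"
proof -
  have "(\<integral>\<^sup>+x. ennreal ((norm (g x))\<^sup>2) \<partial>M) \<le> (\<integral>\<^sup>+x. 2 * ennreal ((norm (f x))\<^sup>2) + 2 * ennreal ((norm (f x - g x))\<^sup>2) \<partial>M)"
  proof (rule nn_integral_mono)
    fix x
    have "(norm (g x))\<^sup>2 \<le> 2 * (norm (f x))\<^sup>2 + 2 * (norm (f x - g x))\<^sup>2"
      using norm_add_sq_le[of "f x" "g x - f x"] by (simp add: norm_minus_commute)
    then show "ennreal ((norm (g x))\<^sup>2) \<le> 2 * ennreal ((norm (f x))\<^sup>2) + 2 * ennreal ((norm (f x - g x))\<^sup>2)"
      by (simp flip: ennreal_numeral ennreal_mult ennreal_plus)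
  qed
  also have "\<dots> = 2 * (\<integral>\<^sup>+x. ennreal ((norm (f x))\<^sup>2) \<partial>M) + 2 * (\<integral>\<^sup>+x. ennreal ((norm (f x - g x))\<^sup>2) \<partial>M)"
    by (subst nn_integral_add) (auto simp: nn_integral_cmult)
  also have "\<dots> < \<infinity>"
    using f fg by (auto simp: ennreal_mult_less_top)
  finally show ?thesis .
qed

text \<open>A single \<open>dq\<close> takes finitely many values on the interval and is square
  integrable; the limit is at finite distance from one of them.\<close>

lemma dyadic_sq_finite:
  fixes u :: "real \<Rightarrow> 'b::euclidean_space"
  assumes gm [measurable]: "g \<in> borel_measurable borel"
    and lim: "(\<lambda>k. \<integral>\<^sup>+x. ennreal ((norm (dq (r k) u x - g x))\<^sup>2) \<partial>I01) \<longlonglongrightarrow> 0"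
  shows "(\<integral>\<^sup>+x. ennreal ((norm (g x))\<^sup>2) \<partial>I01) < \<infinity>"
proof -
  note [measurable] = dq_measurable
  obtain k where k: "(\<integral>\<^sup>+x. ennreal ((norm (dq (r k) u x - g x))\<^sup>2) \<partial>I01) < 1"
    using order_tendstoD(2)[OF lim, of 1] by (auto simp: eventually_sequentially)
  have "cellwise (r k) (\<lambda>x. (norm (dq (r k) u x))\<^sup>2)"
    using cellwise_dq[OF order_refl, of "r k" u] unfolding cellwise_def by metis
  then have fin: "(\<integral>\<^sup>+x. ennreal ((norm (dq (r k) u x))\<^sup>2) \<partial>I01) < \<infinity>"
    by (subst cellwise_nn_integral) auto
  have "(\<integral>\<^sup>+x. ennreal ((norm (dq (r k) u x - g x))\<^sup>2) \<partial>I01) < \<infinity>"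
    using less_trans[OF k ennreal_one_less_top] by simp
  moreover have "dq (r k) u \<in> borel_measurable I01" "g \<in> borel_measurable I01"
    using dq_measurable[of "r k" u] gm by simp_all
  ultimately show ?thesis using sq_finite_of_close[of "dq (r k) u" I01 g] fin by blast
qed

text \<open>Cauchy-Schwarz on each dyadic cell, summed over the disjoint cells. It bounds the dyadic
  energies of the multiplier by the energy of the normal vector.\<close>

lemma dq_sq_le:
  fixes u f :: "real \<Rightarrow> 'b::euclidean_space"
  assumes fm [measurable]: "f \<in> borel_measurable borel" and sq: "(\<integral>\<^sup>+x. ennreal ((norm (f x))\<^sup>2) \<partial>I01) < \<infinity>"
    and u: "\<And>a b. 0 \<le> a \<Longrightarrow> a \<le> b \<Longrightarrow> b \<le> 1 \<Longrightarrow> norm (u b - u a) \<le> (\<integral>x. indicator {a<..b} x * norm (f x) \<partial>I01)"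
  shows "(\<integral>\<^sup>+x. ennreal ((norm (dq n u x))\<^sup>2) \<partial>I01) \<le> (\<integral>\<^sup>+x. ennreal ((norm (f x))\<^sup>2) \<partial>I01)"
proof -
  note [measurable] = dq_measurable
  have sqi: "integrable I01 (\<lambda>x. (norm (f x))\<^sup>2)"
    by (rule integrableI_bounded) (use sq in auto)
  have fi: "integrable I01 (\<lambda>x. norm (f x))" using I01_sq_integrable[OF fm sq] by (rule integrable_norm)
  define c where "c j = {real j / 2 ^ n <.. real (Suc j) / 2 ^ n}" for j
  have c01: "0 \<le> real j / 2 ^ n" "real (Suc j) / 2 ^ n \<le> 1" "real j / 2 ^ n \<le> real (Suc j) / 2 ^ n" if "j < 2 ^ n" for j
  proof -
    have "real (Suc j) \<le> real (2 ^ n)" using that by (simp only: of_nat_le_iff Suc_le_eq)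
    then show "real (Suc j) / 2 ^ n \<le> 1" by simp
    show "real j / 2 ^ n \<le> real (Suc j) / 2 ^ n" by (rule divide_right_mono) auto
  qed simp
  have ci: "integrable I01 (\<lambda>x. indicator (c j) x * h x)" if "integrable I01 h" for h :: "real \<Rightarrow> real" and j
    using integrable_mult_indicator[OF _ that, of "c j"] by (simp add: c_def)
  have cs: "2 ^ n * (\<integral>x. indicator (c j) x * norm (f x) \<partial>I01)\<^sup>2 \<le> (\<integral>x. indicator (c j) x * (norm (f x))\<^sup>2 \<partial>I01)" if j: "j < 2 ^ n" for j
  proof -
    define J where "J = (\<integral>x. indicator (c j) x * norm (f x) \<partial>I01)"
    \<comment> \<open>The mean of |f| over the cell; nonnegativity of the variance about it is the
      Cauchy-Schwarz inequality.\<close>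
    define \<mu> where "\<mu> = 2 ^ n * J"
    have cm: "measure I01 (c j) = 1 / 2 ^ n"
    proof -
      have sub: "c j \<inter> {0..1} = c j"
      proof -
        have "x \<in> {0..1}" if "x \<in> c j" for x
          using that c01[OF j] unfolding c_def greaterThanAtMost_iff atLeastAtMost_iff by linarith
        then show ?thesis by blast
      qed
      have "emeasure I01 (c j) = emeasure lborel (c j)" by (subst emeasure_I01) (auto simp: sub, simp add: c_def)
      also have "\<dots> = ennreal (real (Suc j) / 2 ^ n - real j / 2 ^ n)" unfolding c_def using c01(3)[OF j] by (rule emeasure_lborel_Ioc)
      also have "real (Suc j) / 2 ^ n - real j / 2 ^ n = 1 / 2 ^ n" by (simp add: diff_divide_distrib[symmetric])
      finally show ?thesis by (simp add: measure_def)
    qed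
    have indi: "integrable I01 (indicator (c j) :: real \<Rightarrow> real)"
      by (intro integrable_real_indicator) (auto simp: c_def less_top[symmetric] I01.emeasure_eq_measure)
    have "0 \<le> (\<integral>x. indicator (c j) x * (norm (f x) - \<mu>)\<^sup>2 \<partial>I01)" by (rule Bochner_Integration.integral_nonneg) auto
    also have "\<dots> = (\<integral>x. indicator (c j) x * (norm (f x))\<^sup>2 - 2 * \<mu> * (indicator (c j) x * norm (f x)) + \<mu>\<^sup>2 * indicator (c j) x \<partial>I01)"
      by (rule Bochner_Integration.integral_cong) (auto simp: power2_diff algebra_simps)
    also have "\<dots> = (\<integral>x. indicator (c j) x * (norm (f x))\<^sup>2 \<partial>I01) - 2 * \<mu> * J + \<mu>\<^sup>2 * (1 / 2 ^ n)"
      unfolding J_def using ci[OF sqi, of j] ci[OF fi, of j] indi cm by simp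
    also have "\<dots> = (\<integral>x. indicator (c j) x * (norm (f x))\<^sup>2 \<partial>I01) - 2 ^ n * J\<^sup>2"
      by (simp add: \<mu>_def power2_eq_square)
    finally show ?thesis by (simp add: J_def)
  qed
  have "cellwise n (\<lambda>x. (norm (dq n u x))\<^sup>2)"
    using cellwise_dq[OF order_refl, of n u] unfolding cellwise_def by metis
  then have "(\<integral>\<^sup>+x. ennreal ((norm (dq n u x))\<^sup>2) \<partial>I01) = ennreal (\<Sum>j<2 ^ n. (norm (dq n u (real j / 2 ^ n)))\<^sup>2 / 2 ^ n)"
    by (rule cellwise_nn_integral) auto
  also have "\<dots> \<le> ennreal (\<Sum>j<2 ^ n. \<integral>x. indicator (c j) x * (norm (f x))\<^sup>2 \<partial>I01)"
  proof (intro ennreal_leI sum_mono)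
    fix j assume "j \<in> {..<2 ^ n::nat}"
    then have j: "j < 2 ^ n" by simp
    have "(norm (dq n u (real j / 2 ^ n)))\<^sup>2 / 2 ^ n = 2 ^ n * (norm (u (real (Suc j) / 2 ^ n) - u (real j / 2 ^ n)))\<^sup>2"
      unfolding dq_at by (simp add: power_mult_distrib power2_eq_square)
    also have "\<dots> \<le> 2 ^ n * (\<integral>x. indicator (c j) x * norm (f x) \<partial>I01)\<^sup>2"
      unfolding c_def using c01[OF j] by (intro mult_left_mono power_mono u) auto
    also have "\<dots> \<le> (\<integral>x. indicator (c j) x * (norm (f x))\<^sup>2 \<partial>I01)" by (rule cs[OF j])
    finally show "(norm (dq n u (real j / 2 ^ n)))\<^sup>2 / 2 ^ n \<le> (\<integral>x. indicator (c j) x * (norm (f x))\<^sup>2 \<partial>I01)" .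
  qed
  also have "(\<Sum>j<2 ^ n. \<integral>x. indicator (c j) x * (norm (f x))\<^sup>2 \<partial>I01) = (\<integral>x. (\<Sum>j<2 ^ n. indicator (c j) x * (norm (f x))\<^sup>2) \<partial>I01)"
    by (rule Bochner_Integration.integral_sum[symmetric]) (rule ci[OF sqi])
  also have "\<dots> \<le> (\<integral>x. (norm (f x))\<^sup>2 \<partial>I01)"
  proof (rule integral_mono[OF Bochner_Integration.integrable_sum sqi])
    show "(\<Sum>j<2 ^ n. indicator (c j) x * (norm (f x))\<^sup>2) \<le> (norm (f x))\<^sup>2" for x
    proof -
      have disj: "disjoint_family_on c {..<2 ^ n}"
      proof (clarsimp simp: disjoint_family_on_def)
        fix i j :: nat assume "i \<noteq> j"
        show "c i \<inter> c j = {}"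
        proof (rule ccontr)
          assume "c i \<inter> c j \<noteq> {}"
          then obtain x where x: "x \<in> c i" "x \<in> c j" by blast
          then have "real i < x * 2 ^ n" "x * 2 ^ n \<le> real (Suc i)" "real j < x * 2 ^ n" "x * 2 ^ n \<le> real (Suc j)"
            by (auto simp: c_def field_simps)
          then have "real i < real (Suc j)" "real j < real (Suc i)" by linarith+
          then show False using \<open>i \<noteq> j\<close> by simp
        qed
      qed
      have "(\<Sum>j<2 ^ n. indicator (c j) x :: real) = indicator (\<Union>j<2 ^ n. c j) x"
        by (subst indicator_UN_disjoint[OF _ disj]) auto
      then have "(\<Sum>j<2 ^ n. indicator (c j) x :: real) \<le> 1" by (simp add: indicator_le_1)
      then show ?thesis unfolding sum_distrib_right[symmetric] by (rule mult_left_le_one_le[rotated 2]) (auto intro: sum_nonneg)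
    qed
  qed (rule ci[OF sqi])
  also have "ennreal (\<integral>x. (norm (f x))\<^sup>2 \<partial>I01) = (\<integral>\<^sup>+x. ennreal ((norm (f x))\<^sup>2) \<partial>I01)"
    using nn_integral_eq_integral[OF sqi] by simp
  finally show ?thesis by (simp add: ennreal_leI)
qed

text \<open>The weight makes the flow, which grows at most like \<open>exp t\<close>, square integrable over all
  positive times; the null sets are those of Lebesgue measure on the positive half-line.\<close>

definition MT :: "real measure" where
  "MT = density lborel (\<lambda>t. ennreal (indicator {0<..} t * exp (- 3 * t)))"

lemma sets_MT [measurable_cong, simp]: "sets MT = sets borel" by (simp add: MT_def)
lemma space_MT [simp]: "space MT = UNIV" by (simp add: MT_def)

lemma AE_MT: "(AE t in MT. P t) \<longleftrightarrow> (AE t in lborel. 0 < t \<longrightarrow> P t)"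
  unfolding MT_def by (subst AE_density) (auto simp: indicator_def)

lemma nn_integral_MT_exp: "(\<integral>\<^sup>+t. ennreal (exp (2 * t)) \<partial>MT) = 1"
proof -
  have "(\<integral>\<^sup>+t. ennreal (exp (2 * t)) \<partial>MT) = (\<integral>\<^sup>+t. ennreal (indicator {0<..} t * exp (- 3 * t)) * ennreal (exp (2 * t)) \<partial>lborel)"
    unfolding MT_def by (rule nn_integral_density) auto
  also have "\<dots> = (\<integral>\<^sup>+t. ennreal (exp (- t)) * indicator {0..} t \<partial>lborel)"
  proof (rule nn_integral_cong_AE)
    show "AE t in lborel. ennreal (indicator {0<..} t * exp (- 3 * t)) * ennreal (exp (2 * t)) = ennreal (exp (- t)) * indicator {0..} t"
      using AE_lborel_singleton[of 0]
      by eventually_elim (auto simp: indicator_def exp_add[symmetric] simp flip: ennreal_mult)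
  qed
  also have "\<dots> = ennreal (0 - (- exp (- 0)))"
  proof (rule nn_integral_FTC_atLeast[where F="\<lambda>t. - exp (- t)"])
    show "((\<lambda>t. - exp (- t :: real)) \<longlongrightarrow> 0) at_top"
      using tendsto_minus[OF filterlim_compose[OF exp_at_bot filterlim_uminus_at_bot_at_top]] by simp
  qed (auto intro!: derivative_eq_intros)
  finally show ?thesis by simp
qed

interpretation MT: finite_measure MT
proof
  have "emeasure MT (space MT) = (\<integral>\<^sup>+t. 1 \<partial>MT)" by simp
  also have "\<dots> \<le> (\<integral>\<^sup>+t. ennreal (exp (2 * t)) \<partial>MT)"
  proof (rule nn_integral_mono_AE)
    show "AE t in MT. 1 \<le> ennreal (exp (2 * t))" unfolding AE_MT by (auto simp: ennreal_ge_1)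
  qed
  also have "\<dots> < \<infinity>" by (simp add: nn_integral_MT_exp)
  finally show "emeasure MT (space MT) \<noteq> \<infinity>" by simp
qed

section \<open>Slicing the space-time strip and gluing in time\<close>

lemma AE_Q:
  assumes P: "Measurable.pred (borel \<Otimes>\<^sub>M borel) P"
    and ae: "AE t in lborel. 0 < t \<longrightarrow> (AE s in I01. P (t, s))"
  shows "AE p in lebesgue. p \<in> {0<..} \<times> {0..1::real} \<longrightarrow> P (p :: real \<times> real)"
proof (rule AE_completion)
  note [measurable] = P
  have "AE p in lborel \<Otimes>\<^sub>M lborel. p \<in> {0<..} \<times> {0..1::real} \<longrightarrow> P p"
  proof (rule lborel_pair.AE_pair_measure)
    have "{p \<in> space (borel \<Otimes>\<^sub>M borel). p \<in> {0<..} \<times> {0..1::real} \<longrightarrow> P p} \<in> sets (borel \<Otimes>\<^sub>M borel)" by measurable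
    then show "{p \<in> space (lborel \<Otimes>\<^sub>M lborel). p \<in> {0<..} \<times> {0..1::real} \<longrightarrow> P p} \<in> sets (lborel \<Otimes>\<^sub>M lborel)"
      by (simp add: space_pair_measure cong: sets_pair_measure_cong)
    show "AE t in lborel. AE s in lborel. (t, s) \<in> {0<..} \<times> {0..1::real} \<longrightarrow> P (t, s)"
      using ae unfolding AE_I01
    proof eventually_elim
      case (elim t)
      show ?case
      proof (cases "0 < t")
        case True
        with elim have "AE s in lborel. s \<in> {0..1} \<longrightarrow> P (t, s)" by simp
        then show ?thesis by eventually_elim auto
      qed simp
    qed
  qed
  then show "AE p in lborel. p \<in> {0<..} \<times> {0..1::real} \<longrightarrow> P p"
    unfolding lborel_prod[symmetric] .
qed

lemma borel_pair_lebesgue: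
  fixes F :: "real \<times> real \<Rightarrow> 'b::euclidean_space"
  assumes "F \<in> borel_measurable (borel \<Otimes>\<^sub>M borel)"
  shows "F \<in> borel_measurable borel" "F \<in> borel_measurable lebesgue"
proof -
  show b: "F \<in> borel_measurable borel" using assms by (simp add: borel_prod)
  show "F \<in> borel_measurable lebesgue" by (rule measurable_completion) (use b in simp)
qed

lemma L2loc_L2_I:
  fixes F :: "real \<Rightarrow> real \<Rightarrow> 'b::euclidean_space"
  assumes m: "(\<lambda>p. F (fst p) (snd p)) \<in> borel_measurable (borel \<Otimes>\<^sub>M borel)"
    and C: "0 \<le> C" and ae: "AE t in lborel. 0 < t \<longrightarrow> (\<integral>\<^sup>+s. ennreal ((norm (F t s))\<^sup>2) \<partial>I01) \<le> ennreal (C * exp (2 * t))"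
  shows "L2loc_L2 F"
  unfolding L2loc_L2_def
proof (intro conjI allI impI)
  note [measurable] = m
  show "(\<lambda>p. F (fst p) (snd p)) \<in> borel_measurable lebesgue" by (rule borel_pair_lebesgue(2)[OF m])
  fix T :: real assume T: "0 < T"
  let ?S = "{0<..<T} \<times> {0..1::real}"
  let ?h = "\<lambda>p. indicator ?S p *\<^sub>R (norm (F (fst p) (snd p)))\<^sup>2 :: real"
  have [measurable]: "?S \<in> sets (borel \<Otimes>\<^sub>M borel)" by measurable
  have hm [measurable]: "?h \<in> borel_measurable (borel \<Otimes>\<^sub>M borel)" by measurable
  have "integrable (lborel \<Otimes>\<^sub>M lborel) ?h"
  proof (rule integrableI_bounded)
    show "?h \<in> borel_measurable (lborel \<Otimes>\<^sub>M lborel)" using hm by (simp cong: measurable_cong_sets sets_pair_measure_cong)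
    have "(\<integral>\<^sup>+p. ennreal (norm (?h p)) \<partial>(lborel \<Otimes>\<^sub>M lborel)) = (\<integral>\<^sup>+t. \<integral>\<^sup>+s. ennreal (norm (?h (t, s))) \<partial>lborel \<partial>lborel)"
      by (rule lborel.nn_integral_fst[symmetric]) measurable
    also have "\<dots> \<le> (\<integral>\<^sup>+t. ennreal (C * exp (2 * T)) * indicator {0<..<T} t \<partial>lborel)"
    proof (rule nn_integral_mono_AE)
      show "AE t in lborel. (\<integral>\<^sup>+s. ennreal (norm (?h (t, s))) \<partial>lborel) \<le> ennreal (C * exp (2 * T)) * indicator {0<..<T} t"
        using ae
      proof eventually_elim
        case (elim t)
        show ?case
        proof (cases "t \<in> {0<..<T}")
          case True
          have [measurable]: "(\<lambda>s. F t s) \<in> borel_measurable borel"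
            using measurable_compose[OF measurable_Pair1' m, of t] by simp
          have "(\<integral>\<^sup>+s. ennreal (norm (?h (t, s))) \<partial>lborel) = (\<integral>\<^sup>+s. ennreal ((norm (F t s))\<^sup>2) \<partial>I01)"
            using True by (subst nn_integral_I01) (auto intro!: nn_integral_cong simp: indicator_def)
          also have "\<dots> \<le> ennreal (C * exp (2 * t))" using elim True by simp
          also have "\<dots> \<le> ennreal (C * exp (2 * T))" using True C by (intro ennreal_leI mult_left_mono) auto
          finally show ?thesis using True by simp
        next
          case False
          then have "indicator ?S (t, s) = (0::real)" for s by (auto simp: indicator_def)
          then have "(\<integral>\<^sup>+s. ennreal (norm (?h (t, s))) \<partial>lborel) = 0" by simp
          then show ?thesis by simp
        qed
      qed
    qed
    also have "\<dots> = ennreal (C * exp (2 * T)) * ennreal T"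
      using T by (subst nn_integral_cmult_indicator) auto
    also have "\<dots> < \<infinity>" by (simp add: ennreal_mult_less_top)
    finally show "(\<integral>\<^sup>+p. ennreal (norm (?h p)) \<partial>(lborel \<Otimes>\<^sub>M lborel)) < \<infinity>" .
  qed
  then have "integrable lborel ?h" by (simp add: lborel_prod)
  then show "set_integrable lebesgue ?S (\<lambda>p. (norm (F (fst p) (snd p)))\<^sup>2)"
    unfolding set_integrable_def using borel_pair_lebesgue(1)[OF hm]
    by (subst integrable_completion) auto
qed

lemma AE_glue:
  assumes "\<And>p::nat. AE x in I01. Q (real p + x)"
  shows "AE t in lborel. 0 < t \<longrightarrow> Q t"
proof -
  have "AE t in lborel. t - real p \<in> {0..1} \<longrightarrow> Q (real p + (t - real p))" for p :: nat
  proof -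
    have "AE x in distr lborel borel ((+) (- real p)). x \<in> {0..1} \<longrightarrow> Q (real p + x)"
      using assms[of p] unfolding AE_I01 lborel_distr_plus .
    from AE_distrD[OF _ this] show ?thesis by (simp add: algebra_simps)
  qed
  then have "AE t in lborel. \<forall>p::nat. t - real p \<in> {0..1} \<longrightarrow> Q (real p + (t - real p))"
    unfolding AE_all_countable by blast
  then show ?thesis
  proof eventually_elim
    case (elim t)
    show ?case
    proof
      assume "0 < t"
      then have "t - real (nat \<lfloor>t\<rfloor>) \<in> {0..1}" by (auto; linarith)
      with elim show "Q t" by force
    qed
  qed
qed

lemma integral_unit_pieces:
  fixes h :: "real \<Rightarrow> 'b::euclidean_space"
  assumes "\<And>p. p < P \<Longrightarrow> set_integrable lborel {0..1} (\<lambda>x. h (real p + x))"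
  shows "set_integrable lborel {0..real P} h \<and> (LINT t:{0..real P}|lborel. h t) = (\<Sum>p<P. LINT x:{0..1}|lborel. h (real p + x))"
  using assms
proof (induction P)
  case 0
  have "AE t in lborel. indicator {0..0} t *\<^sub>R h t = 0"
    using AE_lborel_singleton[of 0] by eventually_elim auto
  moreover have "(\<lambda>t. indicator {0..0} t *\<^sub>R h t) = (\<lambda>t. indicator {0} t *\<^sub>R h 0)"
    by (auto simp: fun_eq_iff indicator_def)
  ultimately show ?case
    by (auto simp: set_integrable_def set_lebesgue_integral_def)
next
  case (Suc P)
  let ?p = "real P"
  have IH: "set_integrable lborel {0..?p} h" "(LINT t:{0..?p}|lborel. h t) = (\<Sum>p<P. LINT x:{0..1}|lborel. h (real p + x))"
    using Suc by auto
  have e: "indicator {?p..?p + 1} (?p + 1 * x) *\<^sub>R h (?p + 1 * x) = indicator {0..1} x *\<^sub>R h (?p + x)" for x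
    by (simp add: indicator_def)
  have i: "set_integrable lborel {?p..?p + 1} h"
    using lborel_integrable_real_affine_iff[of 1 "\<lambda>t. indicator {?p..?p + 1} t *\<^sub>R h t" ?p] Suc.prems[of P]
    unfolding set_integrable_def e by simp
  have v: "(LINT t:{?p..?p + 1}|lborel. h t) = (LINT x:{0..1}|lborel. h (?p + x))"
    using lborel_integral_real_affine[of 1 "\<lambda>t. indicator {?p..?p + 1} t *\<^sub>R h t" ?p]
    unfolding set_lebesgue_integral_def e by simp
  have eq: "AE t in lborel. indicator {0..real (Suc P)} t *\<^sub>R h t = indicator {0..?p} t *\<^sub>R h t + indicator {?p..?p + 1} t *\<^sub>R h t"
    using AE_lborel_singleton[of ?p] by eventually_elim (auto simp: indicator_def)
  have sub: "set_integrable lborel {0..real (Suc P)} h"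
  proof -
    have "{0..real (Suc P)} = {0..?p} \<union> {?p..?p + 1}" by auto
    then show ?thesis using set_integrable_Un[OF IH(1) i] by simp
  qed
  have "(LINT t:{0..real (Suc P)}|lborel. h t) = (\<integral>t. indicator {0..?p} t *\<^sub>R h t + indicator {?p..?p + 1} t *\<^sub>R h t \<partial>lborel)"
    unfolding set_lebesgue_integral_def
    using sub IH(1) i unfolding set_integrable_def
    by (intro integral_cong_AE eq borel_measurable_integrable Bochner_Integration.integrable_add) auto
  also have "\<dots> = (LINT t:{0..?p}|lborel. h t) + (LINT t:{?p..?p + 1}|lborel. h t)"
    using IH(1) i unfolding set_integrable_def set_lebesgue_integral_def by (rule Bochner_Integration.integral_add)
  finally show ?case using sub IH(2) v by simp
qed

section \<open>Derivatives of the flow\<close>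

locale flow =
  fixes X :: "real \<Rightarrow> 'a::euclidean_space cper" and N :: real
  assumes X_in: "\<And>t. 0 \<le> t \<Longrightarrow> X t \<in> Lip1"
    and X_norm: "\<And>t. 0 \<le> t \<Longrightarrow> norm (X t) \<le> exp t * N"
    and X_lip: "\<And>a b. 0 \<le> a \<Longrightarrow> a \<le> b \<Longrightarrow> norm (X b - X a) \<le> (b - a) * (exp b * N)"
    and X_EVI: "\<And>a b z. 0 \<le> a \<Longrightarrow> a \<le> b \<Longrightarrow> z \<in> Lip1 \<Longrightarrow> (norm (X b - z))\<^sup>2 - (norm (X a - z))\<^sup>2
        \<le> 2 * (b - a) * ((X a - z) \<bullet> X a) + 2 * (b - a) * (b - a) * ((exp b * N) * (2 * (exp b * N) + norm z))"
    and X_energy: "\<And>a b. 0 \<le> a \<Longrightarrow> a \<le> b \<Longrightarrow> (norm (X b - X a))\<^sup>2 \<le> (b - a) * ((norm (X b))\<^sup>2 - (norm (X a))\<^sup>2) / 2"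
begin

text \<open>Clamping the time at 0 extends the flow constantly to negative times, which makes it
  continuous on the whole plane.\<close>

definition "\<xi> t s = ev (X (max 0 t)) s"

lemma N_nonneg: "N \<ge> 0"
  using order_trans[OF norm_ge_zero X_norm[of 0]] by simp

lemma X_tendsto:
  assumes "t \<longlonglongrightarrow> l" "\<And>n. 0 \<le> t n" "0 \<le> l"
  shows "(\<lambda>n. X (t n)) \<longlonglongrightarrow> X l"
proof -
  have le: "norm (X a - X b) \<le> \<bar>a - b\<bar> * (exp (max a b) * N)" if "0 \<le> a" "0 \<le> b" for a b
    using X_lip[of a b] X_lip[of b a] that by (cases "a \<le> b") (auto simp: norm_minus_commute max_def)
  have "(\<lambda>n. \<bar>t n - l\<bar> * (exp (max (t n) l) * N)) \<longlonglongrightarrow> \<bar>l - l\<bar> * (exp (max l l) * N)"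
    by (intro tendsto_intros assms(1) tendsto_max)
  then have g: "(\<lambda>n. \<bar>t n - l\<bar> * (exp (max (t n) l) * N)) \<longlonglongrightarrow> 0" by simp
  have "(\<lambda>n. X (t n) - X l) \<longlonglongrightarrow> 0"
    by (rule Lim_null_comparison[OF always_eventually g]) (use le[OF assms(2,3)] in blast)
  then show ?thesis by (rule LIM_zero_cancel)
qed

lemma \<xi>_lip: "norm (\<xi> t s - \<xi> t s') \<le> \<bar>s - s'\<bar>"
  using X_in[of "max 0 t"] unfolding \<xi>_def Lip1_def by simp

text \<open>Continuity in time is known in the L2 norm only; the common Lipschitz bound in s makes
  it uniform in s by \<open>Lip1_ev_tendsto\<close>.\<close>

lemma \<xi>_continuous: "continuous_on UNIV (\<lambda>p. \<xi> (fst p) (snd p))"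
  unfolding continuous_on_sequentially comp_def
proof (intro ballI allI impI, elim conjE)
  fix p :: "nat \<Rightarrow> real \<times> real" and q assume p: "p \<longlonglongrightarrow> q"
  define \<tau> where "\<tau> n = max 0 (fst (p n))" for n
  define l where "l = max 0 (fst q)"
  have "\<tau> \<longlonglongrightarrow> l" unfolding \<tau>_def l_def by (intro tendsto_max tendsto_const tendsto_fst p)
  then have X: "(\<lambda>n. X (\<tau> n)) \<longlonglongrightarrow> X l" by (rule X_tendsto) (auto simp: \<tau>_def l_def)
  have "(\<lambda>n. ev (X (\<tau> n)) (snd q)) \<longlonglongrightarrow> ev (X l) (snd q)"
  proof (rule LIMSEQ_I)
    fix e :: real assume "e > 0"
    have "eventually (\<lambda>n. \<forall>s. norm (ev (X (\<tau> n)) s - ev (X l) s) < e) sequentially"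
      by (rule Lip1_ev_tendsto[OF _ _ X \<open>e > 0\<close>]) (auto intro!: X_in simp: \<tau>_def l_def)
    then show "\<exists>no. \<forall>n\<ge>no. norm (ev (X (\<tau> n)) (snd q) - ev (X l) (snd q)) < e"
      unfolding eventually_sequentially by blast
  qed
  moreover have "(\<lambda>n. ev (X (\<tau> n)) (snd (p n)) - ev (X (\<tau> n)) (snd q)) \<longlonglongrightarrow> 0"
  proof (rule Lim_null_comparison[where g="\<lambda>n. \<bar>snd (p n) - snd q\<bar>"])
    show "eventually (\<lambda>n. norm (ev (X (\<tau> n)) (snd (p n)) - ev (X (\<tau> n)) (snd q)) \<le> \<bar>snd (p n) - snd q\<bar>) sequentially"
      using \<xi>_lip unfolding \<xi>_def \<tau>_def by simp
    have "(\<lambda>n. \<bar>snd (p n) - snd q\<bar>) \<longlonglongrightarrow> \<bar>snd q - snd q\<bar>" by (intro tendsto_intros p)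
    then show "(\<lambda>n. \<bar>snd (p n) - snd q\<bar>) \<longlonglongrightarrow> 0" by simp
  qed
  ultimately have "(\<lambda>n. ev (X (\<tau> n)) (snd q) + (ev (X (\<tau> n)) (snd (p n)) - ev (X (\<tau> n)) (snd q))) \<longlonglongrightarrow> ev (X l) (snd q) + 0"
    by (rule tendsto_add)
  then show "(\<lambda>n. \<xi> (fst (p n)) (snd (p n))) \<longlonglongrightarrow> \<xi> (fst q) (snd q)"
    by (simp add: \<xi>_def \<tau>_def l_def)
qed

lemma \<xi>_measurable: "(\<lambda>p. \<xi> (fst p) (snd p)) \<in> borel_measurable (borel \<Otimes>\<^sub>M borel)"
  using borel_measurable_continuous_onI[OF \<xi>_continuous] by (simp add: borel_prod)

lemma \<xi>_measurable1 [measurable]: "(\<lambda>t. \<xi> t s) \<in> borel_measurable borel"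
  using measurable_compose[OF measurable_Pair2' \<xi>_measurable, of s] by simp

lemma \<xi>_cont2: "continuous_on A (\<xi> t)"
  unfolding \<xi>_def[abs_def] by (rule ev_cont)

lemma \<xi>_measurable2 [measurable]: "\<xi> t \<in> borel_measurable borel"
  by (rule borel_measurable_continuous_onI[OF \<xi>_cont2])

text \<open>The Lipschitz bound keeps the quotients in s below 1 everywhere, so their energy is at
  most the total mass of \<open>MT\<close>, and the bound passes to the pointwise limit.\<close>

lemma space_derivative:
  obtains v where "(\<lambda>p. v (fst p) (snd p)) \<in> borel_measurable (borel \<Otimes>\<^sub>M borel)"
    "AE t in lborel. 0 < t \<longrightarrow> (AE s in I01. norm (v t s) \<le> 1) \<and>
       (\<forall>b\<in>{0..1}. (LINT r:{0..b}|lborel. v t r) = \<xi> t b - \<xi> t 0)"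
proof -
  have dq1: "norm (dq n (\<xi> t) x) \<le> 1" for n t x
  proof -
    define a where "a = real_of_int \<lfloor>2 ^ n * x\<rfloor> / 2 ^ n"
    define b where "b = (real_of_int \<lfloor>2 ^ n * x\<rfloor> + 1) / 2 ^ n"
    have "b - a = 1 / 2 ^ n" by (simp add: a_def b_def diff_divide_distrib[symmetric])
    then have "norm (\<xi> t b - \<xi> t a) \<le> 1 / 2 ^ n" using \<xi>_lip[of t b a] by simp
    then have "2 ^ n * norm (\<xi> t b - \<xi> t a) \<le> 2 ^ n * (1 / 2 ^ n)" by (intro mult_left_mono) auto
    then show ?thesis unfolding dq_def a_def[symmetric] b_def[symmetric] by simp
  qed
  have bd: "(\<integral>\<^sup>+t. \<integral>\<^sup>+x. ennreal ((norm (dq n (\<xi> t) x))\<^sup>2) \<partial>I01 \<partial>MT) \<le> ennreal (measure MT UNIV)" for n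
  proof -
    have "(\<integral>\<^sup>+t. \<integral>\<^sup>+x. ennreal ((norm (dq n (\<xi> t) x))\<^sup>2) \<partial>I01 \<partial>MT) \<le> (\<integral>\<^sup>+t. \<integral>\<^sup>+x. 1 \<partial>I01 \<partial>MT)"
      using dq1 by (intro nn_integral_mono) (simp add: power_le_one)
    also have "\<dots> = ennreal (measure MT UNIV)" by (simp add: emeasure_I01 MT.emeasure_eq_measure)
    finally show ?thesis .
  qed
  obtain r v where rv: "strict_mono (r::nat\<Rightarrow>nat)" "(\<lambda>p. v (fst p) (snd p)) \<in> borel_measurable (MT \<Otimes>\<^sub>M borel)"
     "AE t in MT. (\<lambda>k. \<integral>\<^sup>+x. ennreal ((norm (dq (r k) (\<xi> t) x - v t x))\<^sup>2) \<partial>I01) \<longlonglongrightarrow> 0"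
     "AE t in MT. AE x in I01. (\<lambda>k. dq (r k) (\<xi> t) x) \<longlonglongrightarrow> v t x"
    by (rule dyadic_derivative[OF MT.sigma_finite_measure_axioms _ bd]) measurable
  have vm: "(\<lambda>p. v (fst p) (snd p)) \<in> borel_measurable (borel \<Otimes>\<^sub>M borel)"
    using rv(2) by (simp cong: measurable_cong_sets sets_pair_measure_cong)
  have vt [measurable]: "v t \<in> borel_measurable borel" for t
    using measurable_compose[OF measurable_Pair1' vm, of t] by simp
  have "AE t in MT. (AE s in I01. norm (v t s) \<le> 1) \<and> (\<forall>b\<in>{0..1}. (LINT r:{0..b}|lborel. v t r) = \<xi> t b - \<xi> t 0)"
    using rv(3,4)
  proof eventually_elim
    case (elim t)
    have "AE s in I01. norm (v t s) \<le> 1"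
      using elim(2) by eventually_elim (rule LIMSEQ_le_const2[OF tendsto_norm], use dq1 in auto)
    moreover have "(LINT r:{0..b}|lborel. v t r) = \<xi> t b - \<xi> t 0" if "b \<in> {0..1}" for b
      by (rule dyadic_FTC[OF \<xi>_cont2 rv(1) vt elim(1) I01_sq_integrable[OF vt dyadic_sq_finite[OF vt elim(1)]] that])
    ultimately show ?case by blast
  qed
  then show ?thesis using that[OF vm] unfolding AE_MT by blast
qed

text \<open>The differential inclusion at one time, with \<open>h\<close> in the place of the
  velocity: the energy inequality, and membership of the difference in the normal cone. The left
  side of the first is a nonnegative integral, so square integrability of \<open>h\<close> is part
  of the notion.\<close>

definition tangent :: "real \<Rightarrow> (real \<Rightarrow> 'a) \<Rightarrow> bool" where
  "tangent t h \<longleftrightarrow> (\<integral>\<^sup>+s. ennreal ((norm (h s))\<^sup>2) \<partial>I01) \<le> ennreal (\<integral>s. \<xi> t s \<bullet> h s \<partial>I01) \<and>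
     (\<forall>z\<in>Lip1. (\<integral>s. (\<xi> t s - h s) \<bullet> (ev z s - \<xi> t s) \<partial>I01) \<le> 0)"

text \<open>The limit \<open>h\<close> need not be continuous, so it is no element of the inner
  product space. The quotients are therefore paired with the bounded limit \<open>l\<close> through
  L1 convergence, and with \<open>y k - l\<close> through their norm bound.\<close>

lemma L2_limit_inner:
  fixes D y :: "nat \<Rightarrow> 'a cper"
  assumes hm [measurable]: "h \<in> borel_measurable borel" and hi: "integrable I01 h"
    and L2: "(\<lambda>k. \<integral>\<^sup>+s. ennreal ((norm (ev (D k) s - h s))\<^sup>2) \<partial>I01) \<longlonglongrightarrow> 0"
    and K: "\<And>k. norm (D k) \<le> K" and y: "y \<longlonglongrightarrow> l"
  shows "(\<lambda>k. D k \<bullet> y k) \<longlonglongrightarrow> (\<integral>s. h s \<bullet> ev l s \<partial>I01)"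
proof -
  obtain C where C: "\<And>s. norm (ev l s) \<le> C" using ev_bounded[of l] by blast
  have Di: "integrable I01 (\<lambda>s. ev (D k) s - h s)" for k
    by (intro Bochner_Integration.integrable_diff hi continuous_integrable_I01 ev_cont)
  have L1: "(\<lambda>k. \<integral>s. norm (ev (D k) s - h s) \<partial>I01) \<longlonglongrightarrow> 0"
  proof (rule LIMSEQ_I)
    fix e :: real assume e: "e > 0"
    have "eventually (\<lambda>k. (\<integral>\<^sup>+s. ennreal ((norm (ev (D k) s - h s))\<^sup>2) \<partial>I01) < ennreal ((e/3) * (e/3))) sequentially"
      using order_tendstoD(2)[OF L2] e by simp
    then have "eventually (\<lambda>k. norm ((\<integral>s. norm (ev (D k) s - h s) \<partial>I01) - 0) < e) sequentially"
    proof eventually_elim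
      case (elim k)
      have "ennreal (\<integral>s. norm (ev (D k) s - h s) \<partial>I01) = (\<integral>\<^sup>+s. ennreal (norm (ev (D k) s - h s)) \<partial>I01)"
        by (rule nn_integral_eq_integral[symmetric]) (use Di in auto)
      also have "\<dots> \<le> ennreal (e/3) + ennreal (1/(e/3)) * (\<integral>\<^sup>+s. ennreal ((norm (ev (D k) s - h s))\<^sup>2) \<partial>I01)"
        using e by (intro I01_le_sq) auto
      also have "\<dots> \<le> ennreal (e/3) + ennreal (1/(e/3)) * ennreal ((e/3) * (e/3))"
        using elim by (intro add_left_mono mult_left_mono) auto
      also have "\<dots> = ennreal (2 * (e/3))" using e by (simp flip: ennreal_mult ennreal_plus)
      finally have "(\<integral>s. norm (ev (D k) s - h s) \<partial>I01) \<le> 2 * (e/3)" using e by (simp add: ennreal_le_iff)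
      then show ?case using e by simp
    qed
    then show "\<exists>no. \<forall>k\<ge>no. norm ((\<integral>s. norm (ev (D k) s - h s) \<partial>I01) - 0) < e"
      unfolding eventually_sequentially .
  qed
  have 1: "(\<lambda>k. D k \<bullet> l - (\<integral>s. h s \<bullet> ev l s \<partial>I01)) \<longlonglongrightarrow> 0"
  proof (rule Lim_null_comparison[where g="\<lambda>k. C * (\<integral>s. norm (ev (D k) s - h s) \<partial>I01)"])
    have "(\<lambda>k. C * (\<integral>s. norm (ev (D k) s - h s) \<partial>I01)) \<longlonglongrightarrow> C * 0" by (intro tendsto_intros L1)
    then show "(\<lambda>k. C * (\<integral>s. norm (ev (D k) s - h s) \<partial>I01)) \<longlonglongrightarrow> 0" by simp
    show "eventually (\<lambda>k. norm (D k \<bullet> l - (\<integral>s. h s \<bullet> ev l s \<partial>I01)) \<le> C * (\<integral>s. norm (ev (D k) s - h s) \<partial>I01)) sequentially"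
    proof (intro always_eventually allI)
      fix k
      have "D k \<bullet> l - (\<integral>s. h s \<bullet> ev l s \<partial>I01) = (\<integral>s. (ev (D k) s - h s) \<bullet> ev l s \<partial>I01)"
        unfolding inner_cper_def inner_diff_left
        by (rule Bochner_Integration.integral_diff[symmetric]) (intro integrable_ev_inner integrable_inner_ev hi)+
      also have "norm \<dots> \<le> (\<integral>s. norm ((ev (D k) s - h s) \<bullet> ev l s) \<partial>I01)" by (rule integral_norm_bound)
      also have "\<dots> \<le> (\<integral>s. C * norm (ev (D k) s - h s) \<partial>I01)"
      proof (rule integral_mono)
        show "integrable I01 (\<lambda>s. norm ((ev (D k) s - h s) \<bullet> ev l s))" by (intro integrable_norm integrable_inner_ev Di)
        show "integrable I01 (\<lambda>s. C * norm (ev (D k) s - h s))" using Di by simp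
        fix s
        have "norm ((ev (D k) s - h s) \<bullet> ev l s) \<le> norm (ev (D k) s - h s) * norm (ev l s)"
          using Cauchy_Schwarz_ineq2[of "ev (D k) s - h s"] by simp
        also have "\<dots> \<le> norm (ev (D k) s - h s) * C" by (intro mult_left_mono C) auto
        finally show "norm ((ev (D k) s - h s) \<bullet> ev l s) \<le> C * norm (ev (D k) s - h s)" by (simp add: mult.commute)
      qed
      finally show "norm (D k \<bullet> l - (\<integral>s. h s \<bullet> ev l s \<partial>I01)) \<le> C * (\<integral>s. norm (ev (D k) s - h s) \<partial>I01)" by simp
    qed
  qed
  have 2: "(\<lambda>k. D k \<bullet> (y k - l)) \<longlonglongrightarrow> 0"
  proof (rule Lim_null_comparison[where g="\<lambda>k. K * norm (y k - l)"])
    have "(\<lambda>k. K * norm (y k - l)) \<longlonglongrightarrow> K * norm (l - l)" by (intro tendsto_intros y)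
    then show "(\<lambda>k. K * norm (y k - l)) \<longlonglongrightarrow> 0" by simp
    show "eventually (\<lambda>k. norm (D k \<bullet> (y k - l)) \<le> K * norm (y k - l)) sequentially"
    proof (intro always_eventually allI)
      fix k
      have "norm (D k \<bullet> (y k - l)) \<le> norm (D k) * norm (y k - l)" using Cauchy_Schwarz_ineq2[of "D k"] by simp
      also have "\<dots> \<le> K * norm (y k - l)" by (intro mult_right_mono K) auto
      finally show "norm (D k \<bullet> (y k - l)) \<le> K * norm (y k - l)" .
    qed
  qed
  have "(\<lambda>k. (D k \<bullet> l - (\<integral>s. h s \<bullet> ev l s \<partial>I01)) + D k \<bullet> (y k - l)) \<longlonglongrightarrow> 0 + 0" by (rule tendsto_add[OF 1 2])
  then have "(\<lambda>k. D k \<bullet> y k - (\<integral>s. h s \<bullet> ev l s \<partial>I01)) \<longlonglongrightarrow> 0" by (simp add: inner_diff_right)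
  then show ?thesis by (rule LIM_zero_cancel)
qed

text \<open>A difference of two squared distances factors as the increment paired with a sum, so
  after division the quotients are paired with strongly converging curves. On the left of the energy
  estimate Fatou is enough.\<close>

lemma tangent_of_quotients:
  fixes a b :: "nat \<Rightarrow> real"
  defines "D \<equiv> \<lambda>k. (X (b k) - X (a k)) /\<^sub>R (b k - a k)"
  assumes t: "0 \<le> t" and ab: "\<And>k. 0 \<le> a k" "\<And>k. a k < b k" and lim: "a \<longlonglongrightarrow> t" "b \<longlonglongrightarrow> t"
    and hm [measurable]: "h \<in> borel_measurable borel" and hsq: "(\<integral>\<^sup>+s. ennreal ((norm (h s))\<^sup>2) \<partial>I01) < \<infinity>"
    and L2: "(\<lambda>k. \<integral>\<^sup>+s. ennreal ((norm (ev (D k) s - h s))\<^sup>2) \<partial>I01) \<longlonglongrightarrow> 0"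
    and ptw: "AE s in I01. (\<lambda>k. ev (D k) s) \<longlonglongrightarrow> h s"
  shows "tangent t h"
proof -
  have hi: "integrable I01 h" by (rule I01_sq_integrable[OF hm hsq])
  have Xa: "(\<lambda>k. X (a k)) \<longlonglongrightarrow> X t" by (rule X_tendsto[OF lim(1) ab(1) t])
  have b0: "0 \<le> b k" for k using ab[of k] by simp
  have Xb: "(\<lambda>k. X (b k)) \<longlonglongrightarrow> X t" by (rule X_tendsto[OF lim(2) b0 t])
  have "(\<lambda>k. exp (b k) * N) \<longlonglongrightarrow> exp t * N" by (intro tendsto_intros lim)
  then have "Bseq (\<lambda>k. exp (b k) * N)" by (intro convergent_imp_Bseq convergentI)
  then obtain K where K: "\<And>k. norm (exp (b k) * N) \<le> K" by (rule BseqE) blast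
  have DK: "norm (D k) \<le> K" for k
  proof -
    have "norm (D k) = norm (X (b k) - X (a k)) / (b k - a k)" using ab(2)[of k] by (simp add: D_def divide_inverse_commute)
    also have "\<dots> \<le> exp (b k) * N"
      using X_lip[OF ab(1)[of k] less_imp_le[OF ab(2)[of k]]] ab(2)[of k] by (simp add: pos_divide_le_eq mult.commute)
    also have "\<dots> \<le> K" using K[of k] by simp
    finally show ?thesis .
  qed
  have DX: "X (b k) - X (a k) = (b k - a k) *\<^sub>R D k" for k using ab(2)[of k] by (simp add: D_def)
  note lim_inner = L2_limit_inner[OF hm hi L2 DK]
  have t0: "max 0 t = t" using t by simp
  \<comment> \<open>The sum X b + X a tends to 2 X t, which cancels the factor 1/2.\<close>
  have energy: "(norm (D k))\<^sup>2 \<le> (D k \<bullet> (X (b k) + X (a k))) / 2" for k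
  proof -
    define d where "d = b k - a k"
    have d: "d > 0" using ab(2)[of k] by (simp add: d_def)
    have "(norm (X (b k) - X (a k)))\<^sup>2 \<le> d * ((norm (X (b k)))\<^sup>2 - (norm (X (a k)))\<^sup>2) / 2"
      unfolding d_def by (rule X_energy[OF ab(1) less_imp_le[OF ab(2)]])
    also have "(norm (X (b k)))\<^sup>2 - (norm (X (a k)))\<^sup>2 = (X (b k) - X (a k)) \<bullet> (X (b k) + X (a k))"
      unfolding power2_norm_eq_inner inner_diff_left inner_add_right
      by (simp add: inner_commute[of "X (a k)" "X (b k)"])
    finally have "d * (d * (norm (D k))\<^sup>2) \<le> d * (d * ((D k \<bullet> (X (b k) + X (a k))) / 2))"
      unfolding DX d_def[symmetric] using d by (simp add: power2_eq_square mult_ac)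
    then show ?thesis using d by simp
  qed
  have "(\<integral>\<^sup>+s. ennreal ((norm (h s))\<^sup>2) \<partial>I01) = (\<integral>\<^sup>+s. liminf (\<lambda>k. ennreal ((norm (ev (D k) s))\<^sup>2)) \<partial>I01)"
  proof (rule nn_integral_cong_AE)
    show "AE s in I01. ennreal ((norm (h s))\<^sup>2) = liminf (\<lambda>k. ennreal ((norm (ev (D k) s))\<^sup>2))"
      using ptw
    proof eventually_elim
      case (elim s)
      have "(\<lambda>k. ennreal ((norm (ev (D k) s))\<^sup>2)) \<longlonglongrightarrow> ennreal ((norm (h s))\<^sup>2)"
        by (intro tendsto_intros elim)
      from lim_imp_Liminf[OF _ this] show ?case by simp
    qed
  qed
  also have "\<dots> \<le> liminf (\<lambda>k. \<integral>\<^sup>+s. ennreal ((norm (ev (D k) s))\<^sup>2) \<partial>I01)"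
    by (rule nn_integral_liminf) measurable
  also have "\<dots> \<le> liminf (\<lambda>k. ennreal ((D k \<bullet> (X (b k) + X (a k))) / 2))"
  proof (rule Liminf_mono, intro always_eventually allI)
    fix k
    have "(\<integral>\<^sup>+s. ennreal ((norm (ev (D k) s))\<^sup>2) \<partial>I01) = ennreal ((norm (D k))\<^sup>2)"
      unfolding norm_cper_sq
      by (rule nn_integral_eq_integral) (auto intro!: continuous_integrable_I01 continuous_intros ev_cont)
    then show "(\<integral>\<^sup>+s. ennreal ((norm (ev (D k) s))\<^sup>2) \<partial>I01) \<le> ennreal ((D k \<bullet> (X (b k) + X (a k))) / 2)"
      using energy[of k] by (simp add: ennreal_leI)
  qed
  also have "\<dots> = ennreal ((\<integral>s. h s \<bullet> ev (X t + X t) s \<partial>I01) / 2)"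
  proof (rule lim_imp_Liminf)
    show "(\<lambda>k. ennreal ((D k \<bullet> (X (b k) + X (a k))) / 2)) \<longlonglongrightarrow> ennreal ((\<integral>s. h s \<bullet> ev (X t + X t) s \<partial>I01) / 2)"
      by (intro tendsto_ennrealI tendsto_divide tendsto_const lim_inner tendsto_add Xa Xb) simp
  qed simp
  also have "(\<integral>s. h s \<bullet> ev (X t + X t) s \<partial>I01) / 2 = (\<integral>s. \<xi> t s \<bullet> h s \<partial>I01)"
    using integrable_inner_ev[OF hi, of "X t"] by (simp add: ev_simps inner_add_right \<xi>_def t0 inner_commute)
  finally have en: "(\<integral>\<^sup>+s. ennreal ((norm (h s))\<^sup>2) \<partial>I01) \<le> ennreal (\<integral>s. \<xi> t s \<bullet> h s \<partial>I01)" .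
  have "(\<integral>s. (\<xi> t s - h s) \<bullet> (ev z s - \<xi> t s) \<partial>I01) \<le> 0" if z: "z \<in> Lip1" for z
  proof -
    \<comment> \<open>The difference of the squared distances to \<open>z\<close> equals the
      increment paired with \<open>y k\<close>, and \<open>y k\<close> tends to twice the difference
      of X t and \<open>z\<close>.\<close>
    define y where "y k = X (b k) + X (a k) - 2 *\<^sub>R z" for k
    define C where "C k = (exp (b k) * N) * (2 * (exp (b k) * N) + norm z)" for k
    have le: "D k \<bullet> y k \<le> 2 * ((X (a k) - z) \<bullet> X (a k)) + 2 * (b k - a k) * C k" for k
    proof -
      define d where "d = b k - a k"
      have d: "d > 0" using ab(2)[of k] by (simp add: d_def)
      have "(norm (X (b k) - z))\<^sup>2 - (norm (X (a k) - z))\<^sup>2 = (X (b k) - X (a k)) \<bullet> y k"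
        by (simp add: y_def power2_norm_eq_inner inner_diff_left inner_diff_right inner_add_left inner_add_right inner_commute)
      also have "\<dots> = d * (D k \<bullet> y k)" unfolding DX d_def by simp
      finally have "d * (D k \<bullet> y k) \<le> 2 * d * ((X (a k) - z) \<bullet> X (a k)) + 2 * d * d * C k"
        using X_EVI[OF ab(1)[of k] less_imp_le[OF ab(2)[of k]] z] by (simp add: d_def C_def)
      then have "d * (D k \<bullet> y k) \<le> d * (2 * ((X (a k) - z) \<bullet> X (a k)) + 2 * d * C k)"
        by (simp add: algebra_simps)
      then show ?thesis using d unfolding d_def[symmetric] by (simp only: mult_le_cancel_left_pos)
    qed
    have yl: "y \<longlonglongrightarrow> X t + X t - 2 *\<^sub>R z" unfolding y_def by (intro tendsto_intros Xa Xb)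
    have "(\<integral>s. h s \<bullet> ev (X t + X t - 2 *\<^sub>R z) s \<partial>I01) \<le> 2 * ((X t - z) \<bullet> X t) + 2 * (t - t) * ((exp t * N) * (2 * (exp t * N) + norm z))"
    proof (rule LIMSEQ_le[OF lim_inner[OF yl]])
      show "(\<lambda>k. 2 * ((X (a k) - z) \<bullet> X (a k)) + 2 * (b k - a k) * C k) \<longlonglongrightarrow>
        2 * ((X t - z) \<bullet> X t) + 2 * (t - t) * ((exp t * N) * (2 * (exp t * N) + norm z))"
        unfolding C_def by (intro tendsto_intros Xa lim)
    qed (use le in blast)
    then have "(\<integral>s. h s \<bullet> ev (X t) s \<partial>I01) - (\<integral>s. h s \<bullet> ev z s \<partial>I01) \<le> (X t - z) \<bullet> X t"
      using integrable_inner_ev[OF hi, of "X t"] integrable_inner_ev[OF hi, of z]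
      by (simp add: ev_simps inner_add_right inner_diff_right)
    moreover have "(\<integral>s. (\<xi> t s - h s) \<bullet> (ev z s - \<xi> t s) \<partial>I01) = X t \<bullet> z - X t \<bullet> X t - ((\<integral>s. h s \<bullet> ev z s \<partial>I01) - (\<integral>s. h s \<bullet> ev (X t) s \<partial>I01))"
    proof -
      have "(\<lambda>s. (\<xi> t s - h s) \<bullet> (ev z s - \<xi> t s)) = (\<lambda>s. (ev (X t) s \<bullet> ev z s - ev (X t) s \<bullet> ev (X t) s) - (h s \<bullet> ev z s - h s \<bullet> ev (X t) s))"
        by (auto simp: \<xi>_def t0 inner_diff_left inner_diff_right)
      then show ?thesis
        using integrable_ev_inner[of "X t" z] integrable_ev_inner[of "X t" "X t"]
          integrable_inner_ev[OF hi, of "X t"] integrable_inner_ev[OF hi, of z]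
        by (simp add: inner_cper_def)
    qed
    moreover have "(X t - z) \<bullet> X t = X t \<bullet> X t - X t \<bullet> z"
      by (simp only: inner_diff_left inner_commute[of z "X t"])
    ultimately show ?thesis by linarith
  qed
  with en show ?thesis unfolding tangent_def by blast
qed

text \<open>Now s is the parameter of \<open>dyadic_derivative\<close> and time on [p, p + 1] the
  dyadic variable. Slices at fixed s give the fundamental theorem in time; slices at fixed time give
  L2 convergence over the circle, as \<open>tangent_of_quotients\<close> requires. The dyadic
  intervals contain the time in question, so both of their endpoints move.\<close>

lemma time_piece:
  fixes p :: nat
  obtains g where "(\<lambda>q. g (fst q) (snd q)) \<in> borel_measurable (borel \<Otimes>\<^sub>M borel)"
    "AE s in I01. (\<integral>\<^sup>+x. ennreal ((norm (g s x))\<^sup>2) \<partial>I01) < \<infinity> \<and>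
       (\<forall>b\<in>{0..1}. (LINT x:{0..b}|lborel. g s x) = \<xi> (real p + b) s - \<xi> (real p) s)"
    "AE x in I01. tangent (real p + x) (\<lambda>s. g s x)"
proof -
  define u where "u s x = \<xi> (real p + x) s" for s x
  define a :: "nat \<Rightarrow> real \<Rightarrow> real" where "a n x = real p + real_of_int \<lfloor>2 ^ n * x\<rfloor> / 2 ^ n" for n x
  define b :: "nat \<Rightarrow> real \<Rightarrow> real" where "b n x = real p + (real_of_int \<lfloor>2 ^ n * x\<rfloor> + 1) / 2 ^ n" for n x
  have ba: "b n x - a n x = 1 / 2 ^ n" for n and x :: real by (simp add: a_def b_def diff_divide_distrib[symmetric])
  have aux: "0 \<le> a n x" "a n x < b n x" "a n x \<le> real p + x" "real p + x \<le> b n x" "b n x \<le> real p + x + 1 / 2 ^ n" if "0 \<le> x" for n x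
  proof -
    have f: "real_of_int \<lfloor>2 ^ n * x\<rfloor> \<le> 2 ^ n * x" "2 ^ n * x \<le> real_of_int \<lfloor>2 ^ n * x\<rfloor> + 1" by linarith+
    have "0 \<le> real_of_int \<lfloor>2 ^ n * x\<rfloor>" using that by simp
    then show "0 \<le> a n x" unfolding a_def by simp
    have "0 < 1 / (2::real) ^ n" by simp
    then show "a n x < b n x" using ba[of n x] by linarith
    have "real_of_int \<lfloor>2 ^ n * x\<rfloor> / 2 ^ n \<le> x" using f(1) by (simp add: divide_le_eq mult.commute)
    then show le: "a n x \<le> real p + x" by (simp add: a_def)
    have "x \<le> (real_of_int \<lfloor>2 ^ n * x\<rfloor> + 1) / 2 ^ n" using f(2) by (simp add: le_divide_eq mult.commute)
    then show "real p + x \<le> b n x" by (simp add: b_def)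
    show "b n x \<le> real p + x + 1 / 2 ^ n" using le ba[of n x] by linarith
  qed
  define D where "D n x = (X (b n x) - X (a n x)) /\<^sub>R (b n x - a n x)" for n x
  have dqD: "dq n (u s) x = ev (D n x) s" if "0 \<le> x" for n s x
    using aux(1,2)[OF that, of n] ba[of n x]
    unfolding D_def dq_def u_def a_def[symmetric] b_def[symmetric] by (simp add: ev_simps \<xi>_def)
  \<comment> \<open>For x < 1 the right endpoint \<open>b n x\<close> is at most p + x + 1/2^n,
    hence below p + 2.\<close>
  define L where "L = exp (real p + 2) * N"
  have DL: "norm (D n x) \<le> L" if "x \<in> {0<..<1}" for n x
  proof -
    have x0: "0 \<le> x" using that by simp
    have "1 / (2::real) ^ n \<le> 1" "x < 1" using that by simp_all
    then have bp: "b n x \<le> real p + 2" using aux(5)[OF x0, of n] by linarith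
    have "norm (X (b n x) - X (a n x)) \<le> (b n x - a n x) * (exp (b n x) * N)"
      by (rule X_lip[OF aux(1)[OF x0] less_imp_le[OF aux(2)[OF x0]]])
    moreover have "norm (D n x) = norm (X (b n x) - X (a n x)) / (b n x - a n x)"
      using aux(2)[OF x0, of n] by (simp add: D_def divide_inverse_commute)
    ultimately have "norm (D n x) \<le> exp (b n x) * N"
      using aux(2)[OF x0, of n] by (simp add: pos_divide_le_eq mult.commute)
    also have "\<dots> \<le> L" unfolding L_def using bp N_nonneg by (intro mult_right_mono) auto
    finally show ?thesis .
  qed
  interpret II: pair_sigma_finite I01 I01 ..
  have um: "(\<lambda>s. u s x) \<in> borel_measurable borel" for x unfolding u_def by measurable
  have dqm: "(\<lambda>q. dq n (u (fst q)) (snd q)) \<in> borel_measurable (I01 \<Otimes>\<^sub>M I01)" for n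
    by (rule borel_measurable_dq[where M=borel]) (use um in measurable)
  \<comment> \<open>The Lipschitz bound in time controls the norm over the circle at a fixed time,
    so the order of integration is exchanged first.\<close>
  have bd: "(\<integral>\<^sup>+s. \<integral>\<^sup>+x. ennreal ((norm (dq n (u s) x))\<^sup>2) \<partial>I01 \<partial>I01) \<le> ennreal (L\<^sup>2)" for n
  proof -
    have "(\<integral>\<^sup>+s. \<integral>\<^sup>+x. ennreal ((norm (dq n (u s) x))\<^sup>2) \<partial>I01 \<partial>I01) = (\<integral>\<^sup>+x. \<integral>\<^sup>+s. ennreal ((norm (dq n (u s) x))\<^sup>2) \<partial>I01 \<partial>I01)"
      using II.Fubini[of "\<lambda>q. ennreal ((norm (dq n (u (fst q)) (snd q)))\<^sup>2)"] dqm[of n] by simp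
    also have "\<dots> \<le> (\<integral>\<^sup>+x. ennreal (L\<^sup>2) \<partial>I01)"
    proof (rule nn_integral_mono_AE)
      show "AE x in I01. (\<integral>\<^sup>+s. ennreal ((norm (dq n (u s) x))\<^sup>2) \<partial>I01) \<le> ennreal (L\<^sup>2)"
        using AE_I01_ivl
      proof eventually_elim
        case (elim x)
        then have "(\<integral>\<^sup>+s. ennreal ((norm (dq n (u s) x))\<^sup>2) \<partial>I01) = (\<integral>\<^sup>+s. ennreal ((norm (ev (D n x) s))\<^sup>2) \<partial>I01)"
          by (simp add: dqD)
        also have "\<dots> = ennreal ((norm (D n x))\<^sup>2)"
          unfolding norm_cper_sq
          by (rule nn_integral_eq_integral) (auto intro!: continuous_integrable_I01 continuous_intros ev_cont)
        also have "\<dots> \<le> ennreal (L\<^sup>2)" using DL[OF elim, of n] by (intro ennreal_leI power_mono) auto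
        finally show ?case .
      qed
    qed
    also have "\<dots> = ennreal (L\<^sup>2)" by (simp add: emeasure_I01)
    finally show ?thesis .
  qed
  obtain r g where rg: "strict_mono (r::nat\<Rightarrow>nat)" "(\<lambda>q. g (fst q) (snd q)) \<in> borel_measurable (I01 \<Otimes>\<^sub>M borel)"
     "AE s in I01. (\<lambda>k. \<integral>\<^sup>+x. ennreal ((norm (dq (r k) (u s) x - g s x))\<^sup>2) \<partial>I01) \<longlonglongrightarrow> 0"
     "AE x in I01. (\<lambda>k. \<integral>\<^sup>+s. ennreal ((norm (dq (r k) (u s) x - g s x))\<^sup>2) \<partial>I01) \<longlonglongrightarrow> 0"
     "AE x in I01. AE s in I01. (\<lambda>k. dq (r k) (u s) x) \<longlonglongrightarrow> g s x"
    by (rule dyadic_derivative[OF I01.sigma_finite_measure_axioms _ bd]) (use um in measurable)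
  have gm: "(\<lambda>q. g (fst q) (snd q)) \<in> borel_measurable (borel \<Otimes>\<^sub>M borel)"
    using rg(2) by (simp cong: measurable_cong_sets sets_pair_measure_cong)
  have gs [measurable]: "g s \<in> borel_measurable borel" for s
    using measurable_compose[OF measurable_Pair1' gm, of s] by simp
  have gx [measurable]: "(\<lambda>s. g s x) \<in> borel_measurable borel" for x
    using measurable_compose[OF measurable_Pair2' gm, of x] by simp
  have cu: "continuous_on {0..1} (u s)" for s
  proof -
    have "continuous_on {0..1} ((\<lambda>q. \<xi> (fst q) (snd q)) \<circ> (\<lambda>x. (real p + x, s)))"
      by (intro continuous_on_compose continuous_intros continuous_on_subset[OF \<xi>_continuous]) auto
    then show ?thesis by (simp add: comp_def u_def)
  qed
  have 1: "AE s in I01. (\<integral>\<^sup>+x. ennreal ((norm (g s x))\<^sup>2) \<partial>I01) < \<infinity> \<and>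
       (\<forall>b\<in>{0..1}. (LINT x:{0..b}|lborel. g s x) = \<xi> (real p + b) s - \<xi> (real p) s)"
    using rg(3)
  proof eventually_elim
    case (elim s)
    note fin = dyadic_sq_finite[OF gs elim]
    have "(LINT x:{0..b}|lborel. g s x) = u s b - u s 0" if "b \<in> {0..1}" for b
      by (rule dyadic_FTC[OF cu rg(1) gs elim I01_sq_integrable[OF gs fin] that])
    then show ?case using fin by (simp add: u_def)
  qed
  have 2: "AE x in I01. tangent (real p + x) (\<lambda>s. g s x)"
    using AE_I01_ivl rg(4,5)
  proof eventually_elim
    case (elim x)
    have x0: "0 \<le> x" using elim(1) by simp
    have lim0: "(\<lambda>k. 1 / (2::real) ^ r k) \<longlonglongrightarrow> 0"
      using LIMSEQ_subseq_LIMSEQ[OF LIMSEQ_realpow_zero[of "1/2::real"] rg(1)] by (simp add: comp_def power_one_over)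
    have la: "(\<lambda>k. a (r k) x) \<longlonglongrightarrow> real p + x"
    proof (rule tendsto_sandwich[of "\<lambda>k. real p + x - 1 / 2 ^ r k" _ _ "\<lambda>_. real p + x"])
      have "(\<lambda>k. real p + x - 1 / 2 ^ r k) \<longlonglongrightarrow> real p + x - 0" by (intro tendsto_intros lim0)
      then show "(\<lambda>k. real p + x - 1 / 2 ^ r k) \<longlonglongrightarrow> real p + x" by simp
      show "eventually (\<lambda>k. real p + x - 1 / 2 ^ r k \<le> a (r k) x) sequentially"
      proof (intro always_eventually allI)
        fix k show "real p + x - 1 / 2 ^ r k \<le> a (r k) x" using aux(4)[OF x0, of "r k"] ba[of "r k" x] by linarith
      qed
    qed (use aux(3)[OF x0] in auto)
    have "(\<lambda>k. a (r k) x + 1 / 2 ^ r k) \<longlonglongrightarrow> (real p + x) + 0" by (rule tendsto_add[OF la lim0])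
    moreover have "a (r k) x + 1 / 2 ^ r k = b (r k) x" for k using ba[of "r k" x] by linarith
    ultimately have lb: "(\<lambda>k. b (r k) x) \<longlonglongrightarrow> real p + x" by simp
    have L2: "(\<lambda>k. \<integral>\<^sup>+s. ennreal ((norm (ev (D (r k) x) s - g s x))\<^sup>2) \<partial>I01) \<longlonglongrightarrow> 0"
      using elim(2) by (simp add: dqD[OF x0])
    have ptw: "AE s in I01. (\<lambda>k. ev (D (r k) x) s) \<longlonglongrightarrow> g s x"
      using elim(3) by (simp add: dqD[OF x0])
    have sq: "(\<integral>\<^sup>+s. ennreal ((norm (g s x))\<^sup>2) \<partial>I01) < \<infinity>"
    proof -
      obtain k where k: "(\<integral>\<^sup>+s. ennreal ((norm (ev (D (r k) x) s - g s x))\<^sup>2) \<partial>I01) < 1"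
        using order_tendstoD(2)[OF L2, of 1] by (auto simp: eventually_sequentially)
      have "(\<integral>\<^sup>+s. ennreal ((norm (ev (D (r k) x) s))\<^sup>2) \<partial>I01) = ennreal ((norm (D (r k) x))\<^sup>2)"
        unfolding norm_cper_sq
        by (rule nn_integral_eq_integral) (auto intro!: continuous_integrable_I01 continuous_intros ev_cont)
      then have fin: "(\<integral>\<^sup>+s. ennreal ((norm (ev (D (r k) x) s))\<^sup>2) \<partial>I01) < \<infinity>" by simp
      have "(\<integral>\<^sup>+s. ennreal ((norm (ev (D (r k) x) s - g s x))\<^sup>2) \<partial>I01) < \<infinity>"
        using less_trans[OF k ennreal_one_less_top] by simp
      moreover have "ev (D (r k) x) \<in> borel_measurable I01" "(\<lambda>s. g s x) \<in> borel_measurable I01"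
        using gx by simp_all
      ultimately show ?thesis using sq_finite_of_close[of "ev (D (r k) x)" I01 "\<lambda>s. g s x"] fin by blast
    qed
    show ?case
      by (rule tangent_of_quotients[where a="\<lambda>k. a (r k) x" and b="\<lambda>k. b (r k) x", folded D_def, OF _ aux(1,2)[OF x0] la lb gx sq L2 ptw])
        (use x0 in simp)
  qed
  show ?thesis using that[OF gm 1 2] .
qed

text \<open>The unit pieces are joined by the integer part of the time. The increment formula is
  kept piecewise, and the exceptional null sets of s for countably many pieces are united into
  one.\<close>

lemma time_derivative:
  obtains w where "(\<lambda>q. w (fst q) (snd q)) \<in> borel_measurable (borel \<Otimes>\<^sub>M borel)"
    "AE t in lborel. 0 < t \<longrightarrow> tangent t (w t)"
    "AE s in I01. \<forall>p::nat. (\<lambda>x. w (real p + x) s) \<in> borel_measurable borel \<and> integrable I01 (\<lambda>x. w (real p + x) s) \<and>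
       (\<forall>b\<in>{0..1}. (LINT x:{0..b}|lborel. w (real p + x) s) = \<xi> (real p + b) s - \<xi> (real p) s)"
proof -
  have "\<forall>p::nat. \<exists>g. (\<lambda>q. g (fst q) (snd q)) \<in> borel_measurable (borel \<Otimes>\<^sub>M borel) \<and>
    (AE s in I01. (\<integral>\<^sup>+x. ennreal ((norm (g s x))\<^sup>2) \<partial>I01) < \<infinity> \<and>
       (\<forall>b\<in>{0..1}. (LINT x:{0..b}|lborel. g s x) = \<xi> (real p + b) s - \<xi> (real p) s)) \<and>
    (AE x in I01. tangent (real p + x) (\<lambda>s. g s x))"
  proof
    fix p :: nat
    show "\<exists>g. (\<lambda>q. g (fst q) (snd q)) \<in> borel_measurable (borel \<Otimes>\<^sub>M borel) \<and>
      (AE s in I01. (\<integral>\<^sup>+x. ennreal ((norm (g s x))\<^sup>2) \<partial>I01) < \<infinity> \<and>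
         (\<forall>b\<in>{0..1}. (LINT x:{0..b}|lborel. g s x) = \<xi> (real p + b) s - \<xi> (real p) s)) \<and>
      (AE x in I01. tangent (real p + x) (\<lambda>s. g s x))"
      by (rule time_piece[of p]) (rule exI, intro conjI)
  qed
  from choice[OF this] obtain g where g:
    "\<And>p::nat. (\<lambda>q. g p (fst q) (snd q)) \<in> borel_measurable (borel \<Otimes>\<^sub>M borel)"
    "\<And>p::nat. AE s in I01. (\<integral>\<^sup>+x. ennreal ((norm (g p s x))\<^sup>2) \<partial>I01) < \<infinity> \<and>
       (\<forall>b\<in>{0..1}. (LINT x:{0..b}|lborel. g p s x) = \<xi> (real p + b) s - \<xi> (real p) s)"
    "\<And>p::nat. AE x in I01. tangent (real p + x) (\<lambda>s. g p s x)"
    by blast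
  define w where "w t s = g (nat \<lfloor>t\<rfloor>) s (t - real (nat \<lfloor>t\<rfloor>))" for t s
  have wm: "(\<lambda>q. w (fst q) (snd q)) \<in> borel_measurable (borel \<Otimes>\<^sub>M borel)"
    unfolding w_def
  proof (rule measurable_compose_countable[where f="\<lambda>p q. g p (snd q) (fst q - real p)" and g="\<lambda>q. nat \<lfloor>fst q\<rfloor>"])
    fix p :: nat
    have "(\<lambda>q::real\<times>real. (snd q, fst q - real p)) \<in> (borel \<Otimes>\<^sub>M borel) \<rightarrow>\<^sub>M (borel \<Otimes>\<^sub>M borel)" by measurable
    from measurable_compose[OF this g(1)[of p]]
    show "(\<lambda>q. g p (snd q) (fst q - real p)) \<in> borel_measurable (borel \<Otimes>\<^sub>M borel)" by simp
  qed measurable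
  have wp: "w (real p + x) s = g p s x" if "0 \<le> x" "x < 1" for p x s
  proof -
    have "nat \<lfloor>real p + x\<rfloor> = p" using that by linarith
    then show ?thesis by (simp add: w_def)
  qed
  have "AE t in lborel. 0 < t \<longrightarrow> tangent t (w t)"
  proof (rule AE_glue)
    fix p
    show "AE x in I01. tangent (real p + x) (w (real p + x))"
      using AE_I01_ivl g(3)[of p]
    proof eventually_elim
      case (elim x)
      then have "w (real p + x) = (\<lambda>s. g p s x)" by (auto simp: fun_eq_iff wp)
      then show ?case using elim by simp
    qed
  qed
  moreover have "AE s in I01. \<forall>p::nat. (\<lambda>x. w (real p + x) s) \<in> borel_measurable borel \<and> integrable I01 (\<lambda>x. w (real p + x) s) \<and>
       (\<forall>b\<in>{0..1}. (LINT x:{0..b}|lborel. w (real p + x) s) = \<xi> (real p + b) s - \<xi> (real p) s)"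
    unfolding AE_all_countable
  proof
    fix p :: nat
    show "AE s in I01. (\<lambda>x. w (real p + x) s) \<in> borel_measurable borel \<and> integrable I01 (\<lambda>x. w (real p + x) s) \<and>
       (\<forall>b\<in>{0..1}. (LINT x:{0..b}|lborel. w (real p + x) s) = \<xi> (real p + b) s - \<xi> (real p) s)"
      using g(2)[of p]
    proof eventually_elim
      case (elim s)
      have gs [measurable]: "g p s \<in> borel_measurable borel"
        using measurable_compose[OF measurable_Pair1' g(1)[of p], of s] by simp
      have "(\<lambda>x::real. (real p + x, s)) \<in> borel \<rightarrow>\<^sub>M (borel \<Otimes>\<^sub>M borel)" by measurable
      from measurable_compose[OF this wm]
      have ws [measurable]: "(\<lambda>x. w (real p + x) s) \<in> borel_measurable borel" by simp
      have eq: "AE x in I01. w (real p + x) s = g p s x"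
        using AE_I01_ivl by eventually_elim (simp add: wp)
      have "integrable I01 (g p s)" using elim by (intro I01_sq_integrable gs) blast
      then have "integrable I01 (\<lambda>x. w (real p + x) s)"
        by (subst integrable_cong_AE[OF _ _ eq]) auto
      moreover have "(LINT x:{0..b}|lborel. w (real p + x) s) = \<xi> (real p + b) s - \<xi> (real p) s" if b: "b \<in> {0..1}" for b
      proof -
        have "(LINT x:{0..b}|lborel. w (real p + x) s) = (LINT x:{0..b}|lborel. g p s x)"
          unfolding set_lebesgue_integral_def
        proof (rule integral_cong_AE)
          show "AE x in lborel. indicator {0..b} x *\<^sub>R w (real p + x) s = indicator {0..b} x *\<^sub>R g p s x"
            using eq unfolding AE_I01 by eventually_elim (use b in \<open>auto simp: indicator_def\<close>)
        qed measurable
        then show ?thesis using elim b by simp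
      qed
      ultimately show ?case using ws by blast
    qed
  qed
  ultimately show ?thesis using that wm by blast
qed

text \<open>For almost every s, integrate by parts in time; then Fubini with time as the inner
  variable. The local L2 bound is needed to make \<open>\<phi>\<close> times \<open>w\<close>
  integrable on the product.\<close>

lemma weak_time_derivative:
  assumes wm: "(\<lambda>q. w (fst q) (snd q)) \<in> borel_measurable (borel \<Otimes>\<^sub>M borel)"
    and wL2: "L2loc_L2 w"
    and ftc: "AE s in I01. \<forall>p::nat. (\<lambda>x. w (real p + x) s) \<in> borel_measurable borel \<and> integrable I01 (\<lambda>x. w (real p + x) s) \<and>
       (\<forall>b\<in>{0..1}. (LINT x:{0..b}|lborel. w (real p + x) s) = \<xi> (real p + b) s - \<xi> (real p) s)"
    and test: "test_Q \<phi> \<phi>t \<phi>s"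
  shows "(LINT p:({0<..} \<times> {0..1})|lebesgue. \<phi>t p *\<^sub>R \<xi> (fst p) (snd p)) =
        - (LINT p:({0<..} \<times> {0..1})|lebesgue. \<phi> p *\<^sub>R w (fst p) (snd p))"
proof -
  note [measurable] = wm \<xi>_measurable
  have der: "(\<phi> has_derivative (\<lambda>h. fst h * \<phi>t p + snd h * \<phi>s p)) (at p)" for p
    using test unfolding test_Q_def by blast
  obtain a b where ab: "0 < a" "a < b" "\<And>t s. t < a \<or> b < t \<Longrightarrow> \<phi> (t, s) = 0"
    using test unfolding test_Q_def by blast
  have ct: "continuous_on UNIV \<phi>t" using test by (simp add: test_Q_def)
  have c: "continuous_on UNIV \<phi>" using has_derivative_continuous[OF der] by (simp add: continuous_on_eq_continuous_at)
  have [measurable]: "\<phi>t \<in> borel_measurable (borel \<Otimes>\<^sub>M borel)" "\<phi> \<in> borel_measurable (borel \<Otimes>\<^sub>M borel)"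
    using borel_measurable_continuous_onI[OF ct] borel_measurable_continuous_onI[OF c] by (simp_all add: borel_prod)
  have dt: "((\<lambda>t. \<phi> (t, s)) has_real_derivative \<phi>t (t, s)) (at t)" for t s
  proof -
    have "((\<lambda>t. (t, s)) has_derivative (\<lambda>h. (h, 0))) (at t)" by (auto intro!: derivative_eq_intros)
    from has_derivative_compose[OF this der[of "(t, s)"]]
    have "((\<lambda>x. \<phi> (x, s)) has_derivative (\<lambda>x. x * \<phi>t (t, s))) (at t)" by simp
    moreover have "(\<lambda>x. x * \<phi>t (t, s)) = (*) (\<phi>t (t, s))" by (simp add: fun_eq_iff)
    ultimately show ?thesis by (simp add: has_field_derivative_def)
  qed
  \<comment> \<open>Outside [a, b] the test function vanishes on an open set of times, so its time
    derivative vanishes there too and both integrands live in a bounded time interval.\<close>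
  have zero: "\<phi>t (t, s) = 0" if "t < a \<or> b < t" for t s
  proof -
    define S where "S = {..<a} \<union> {b<..}"
    have "eventually (\<lambda>t'. \<phi> (t', s) = 0) (at t)"
    proof -
      have "open S" "t \<in> S" using that by (auto simp: S_def)
      then have "eventually (\<lambda>t'. t' \<in> S) (at t)" by (simp add: eventually_at_topological) blast
      then show ?thesis by eventually_elim (auto simp: S_def ab(3))
    qed
    then have "((\<lambda>t'. \<phi> (t', s)) has_real_derivative 0) (at t)"
    proof -
      have "eventually (\<lambda>t'. \<phi> (t', s) = 0) (nhds t)"
        using \<open>eventually (\<lambda>t'. \<phi> (t', s) = 0) (at t)\<close> ab(3)[OF that, of s] by (simp add: eventually_nhds_conv_at)
      then show ?thesis using DERIV_cong_ev[OF refl, of "\<lambda>t'. \<phi> (t', s)" "\<lambda>_. 0" t 0 0] by simp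
    qed
    then show ?thesis using dt DERIV_unique by blast
  qed
  obtain P :: nat where P: "b < real P" using reals_Archimedean2 by blast
  let ?S = "{0<..} \<times> {0..1} :: (real \<times> real) set"
  let ?S' = "{0<..<real P} \<times> {0..1::real}"
  define F where "F p = indicator ?S p *\<^sub>R (\<phi>t p *\<^sub>R \<xi> (fst p) (snd p))" for p
  define G where "G p = indicator ?S p *\<^sub>R (\<phi> p *\<^sub>R w (fst p) (snd p))" for p
  have [measurable]: "?S \<in> sets (borel \<Otimes>\<^sub>M borel)" "?S' \<in> sets (borel \<Otimes>\<^sub>M borel)"
    by (auto intro!: pair_measureI)
  have Fm [measurable]: "F \<in> borel_measurable (borel \<Otimes>\<^sub>M borel)" and Gm [measurable]: "G \<in> borel_measurable (borel \<Otimes>\<^sub>M borel)"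
    unfolding F_def G_def by measurable
  have K: "compact ({0..real P} \<times> {0..1::real})" by (intro compact_Times) auto
  have bdd: "\<exists>C\<ge>0. \<forall>p\<in>{0..real P} \<times> {0..1}. norm (f p) \<le> C" if "continuous_on UNIV f" for f :: "real \<times> real \<Rightarrow> 'c::euclidean_space"
  proof -
    have "bounded (f ` ({0..real P} \<times> {0..1}))"
      by (intro compact_imp_bounded compact_continuous_image K continuous_on_subset[OF that]) simp
    then obtain C where C: "\<forall>x\<in>f ` ({0..real P} \<times> {0..1}). norm x \<le> C" unfolding bounded_iff by blast
    show ?thesis
    proof (intro exI[of _ "\<bar>C\<bar>"] conjI ballI)
      fix p assume "p \<in> {0..real P} \<times> {0..1::real}"
      then have "f p \<in> f ` ({0..real P} \<times> {0..1})" by (rule imageI)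
      with C have "norm (f p) \<le> C" by blast
      then show "norm (f p) \<le> \<bar>C\<bar>" by linarith
    qed simp
  qed
  have ind_int: "integrable lborel (\<lambda>p. indicator ?S' p :: real)"
  proof (rule integrable_real_indicator)
    show "?S' \<in> sets lborel" using \<open>?S' \<in> sets (borel \<Otimes>\<^sub>M borel)\<close> unfolding borel_prod sets_lborel .
    have "bounded ?S'" by (rule bounded_subset[OF compact_imp_bounded[OF K]]) auto
    then show "emeasure lborel ?S' < \<infinity>" by (rule emeasure_bounded_finite)
  qed
  have sup: "p \<in> ?S'" if "p \<in> ?S" "\<phi>t p \<noteq> 0 \<or> \<phi> p \<noteq> 0" for p
  proof -
    have "\<not> (b < fst p)" using that(2) zero[of "fst p" "snd p"] ab(3)[of "fst p" "snd p"] by auto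
    then show ?thesis using that(1) P by (cases p) auto
  qed
  have Fi: "integrable lborel F"
  proof -
    obtain C1 where C1: "C1 \<ge> 0" "\<forall>p\<in>{0..real P} \<times> {0..1}. norm (\<phi>t p) \<le> C1" using bdd[OF ct] by blast
    obtain C2 where C2: "C2 \<ge> 0" "\<forall>p\<in>{0..real P} \<times> {0..1}. norm (\<xi> (fst p) (snd p)) \<le> C2" using bdd[OF \<xi>_continuous] by blast
    show ?thesis
    proof (rule Bochner_Integration.integrable_bound)
      show "integrable lborel (\<lambda>p. C1 * C2 * indicator ?S' p)" using ind_int by simp
      show "F \<in> borel_measurable lborel" using borel_pair_lebesgue(1)[OF Fm] by simp
      show "AE p in lborel. norm (F p) \<le> norm (C1 * C2 * indicator ?S' p :: real)"
      proof (rule AE_I2)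
        fix p
        show "norm (F p) \<le> norm (C1 * C2 * indicator ?S' p :: real)"
        proof (cases "p \<in> ?S \<and> \<phi>t p \<noteq> 0")
          case True
          then have p: "p \<in> ?S'" "p \<in> {0..real P} \<times> {0..1}" using sup[of p] by auto
          have "norm (F p) = norm (\<phi>t p) * norm (\<xi> (fst p) (snd p))" using True by (simp add: F_def)
          also have "\<dots> \<le> C1 * C2" using C1 C2 p(2) by (intro mult_mono) auto
          finally show ?thesis using p(1) C1(1) C2(1) by simp
        next
          case False
          then have "F p = 0" by (auto simp: F_def)
          then show ?thesis by simp
        qed
      qed
    qed
  qed
  have Gi: "integrable lborel G"
  proof -
    obtain C1 where C1: "C1 \<ge> 0" "\<forall>p\<in>{0..real P} \<times> {0..1}. norm (\<phi> p) \<le> C1" using bdd[OF c] by blast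
    have "0 < real P" using P ab by linarith
    then have "set_integrable lebesgue ?S' (\<lambda>p. (norm (w (fst p) (snd p)))\<^sup>2)" using wL2 unfolding L2loc_L2_def by blast
    moreover have "(\<lambda>p. indicator ?S' p *\<^sub>R (norm (w (fst p) (snd p)))\<^sup>2) \<in> borel_measurable lborel"
      using borel_pair_lebesgue(1)[of "\<lambda>p. indicator ?S' p *\<^sub>R (norm (w (fst p) (snd p)))\<^sup>2"] by simp
    ultimately have sq: "integrable lborel (\<lambda>p. indicator ?S' p * (norm (w (fst p) (snd p)))\<^sup>2)"
      unfolding set_integrable_def by (subst (asm) integrable_completion) auto
    show ?thesis
    proof (rule Bochner_Integration.integrable_bound)
      show "integrable lborel (\<lambda>p. C1 * (indicator ?S' p + indicator ?S' p * (norm (w (fst p) (snd p)))\<^sup>2))"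
        using ind_int sq by (intro integrable_mult_right Bochner_Integration.integrable_add) auto
      show "G \<in> borel_measurable lborel" using borel_pair_lebesgue(1)[OF Gm] by simp
      show "AE p in lborel. norm (G p) \<le> norm (C1 * (indicator ?S' p + indicator ?S' p * (norm (w (fst p) (snd p)))\<^sup>2))"
      proof (rule AE_I2)
        fix p
        show "norm (G p) \<le> norm (C1 * (indicator ?S' p + indicator ?S' p * (norm (w (fst p) (snd p)))\<^sup>2))"
        proof (cases "p \<in> ?S \<and> \<phi> p \<noteq> 0")
          case True
          then have p: "p \<in> ?S'" "p \<in> {0..real P} \<times> {0..1}" using sup[of p] by auto
          define n where "n = norm (w (fst p) (snd p))"
          have "n \<le> 1 + n\<^sup>2"
          proof -
            have "0 \<le> (n - 1)\<^sup>2" by simp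
            then have "2 * n \<le> 1 + n\<^sup>2" by (simp add: power2_diff)
            moreover have "0 \<le> n" by (simp add: n_def)
            ultimately show ?thesis by linarith
          qed
          have "norm (G p) = norm (\<phi> p) * n" using True by (simp add: G_def n_def)
          also have "\<dots> \<le> C1 * (1 + n\<^sup>2)" using C1 p(2) \<open>n \<le> 1 + n\<^sup>2\<close> by (intro mult_mono) (auto simp: n_def)
          also have "\<dots> \<le> norm (C1 * (1 + n\<^sup>2))" by simp
          finally show ?thesis using p(1) by (simp add: n_def)
        next
          case False
          then have "G p = 0" by (auto simp: G_def)
          then show ?thesis by simp
        qed
      qed
    qed
  qed
  have FGi: "integrable (lborel \<Otimes>\<^sub>M lborel) (\<lambda>p. F p + G p)" using Fi Gi by (simp add: lborel_prod)
  have "AE s in lborel. (\<integral>t. F (t, s) + G (t, s) \<partial>lborel) = 0"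
  proof -
    have "AE s in lborel. s \<in> {0..1} \<longrightarrow> (\<integral>t. F (t, s) + G (t, s) \<partial>lborel) = 0"
      using ftc unfolding AE_I01
    proof eventually_elim
      case (elim s)
      show ?case
      proof
        assume s: "s \<in> {0..1}"
        define h where "h t = \<phi>t (t, s) *\<^sub>R \<xi> t s + \<phi> (t, s) *\<^sub>R w t s" for t
        have piece: "set_integrable lborel {0..1} (\<lambda>x. h (real p + x)) \<and>
            (LINT x:{0..1}|lborel. h (real p + x)) = \<phi> (real (Suc p), s) *\<^sub>R \<xi> (real (Suc p)) s - \<phi> (real p, s) *\<^sub>R \<xi> (real p) s" for p :: nat
        proof -
          have pm: "(\<lambda>x. w (real p + x) s) \<in> borel_measurable borel" "integrable I01 (\<lambda>x. w (real p + x) s)"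
            "\<And>b. b \<in> {0..1} \<Longrightarrow> (LINT x:{0..b}|lborel. w (real p + x) s) = \<xi> (real p + b) s - \<xi> (real p) s"
            using elim s by blast+
          have cf: "continuous_on UNIV (\<lambda>x. \<phi>t (real p + x, s))"
            by (intro continuous_on_compose2[OF ct] continuous_intros) auto
          have ff: "set_integrable lborel {0..1} (\<lambda>x. \<phi>t (real p + x, s))"
            by (rule borel_integrable_atLeastAtMost') (rule continuous_on_subset[OF cf], simp)
          have gg: "set_integrable lborel {0..1} (\<lambda>x. w (real p + x) s)" using pm(2) unfolding integrable_I01[OF pm(1)] .
          have FF: "\<phi> (real p + x, s) = \<phi> (real p + 0, s) + (LINT r:{0..x}|lborel. \<phi>t (real p + r, s))" if "x \<in> {0..1}" for x
          proof -
            have d: "((\<lambda>x. \<phi> (real p + x, s)) has_real_derivative \<phi>t (real p + r, s)) (at r)" for r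
              using dt[of s "real p + r"] DERIV_shift[of "\<lambda>t. \<phi> (t, s)" _ r "real p"] by (simp add: add.commute)
            have "((\<lambda>r. \<phi>t (real p + r, s)) has_integral (\<phi> (real p + x, s) - \<phi> (real p + 0, s))) {0..x}"
              by (rule fundamental_theorem_of_calculus)
                (use that d in \<open>auto simp: has_real_derivative_iff_has_vector_derivative[symmetric] has_field_derivative_at_within\<close>)
            moreover have "set_integrable lborel {0..x} (\<lambda>r. \<phi>t (real p + r, s))"
              by (rule borel_integrable_atLeastAtMost') (rule continuous_on_subset[OF cf], simp)
            ultimately show ?thesis
              using set_borel_integral_eq_integral(2)[of "{0..x}" "\<lambda>r. \<phi>t (real p + r, s)"] by (simp add: integral_unique)
          qed
          have GG: "\<xi> (real p + x) s = \<xi> (real p + 0) s + (LINT r:{0..x}|lborel. w (real p + r) s)" if "x \<in> {0..1}" for x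
            using pm(3)[OF that] by simp
          note I = ibp_scaleR[OF ff gg zero_le_one FF GG]
          have hi: "set_integrable lborel {0..1} (\<lambda>x. h (real p + x))"
            unfolding h_def using set_integral_add(1)[OF I(2) I(1)] by simp
          have "(LINT x:{0..1}|lborel. h (real p + x)) = (LINT x:{0..1}|lborel. \<phi>t (real p + x, s) *\<^sub>R \<xi> (real p + x) s) + (LINT x:{0..1}|lborel. \<phi> (real p + x, s) *\<^sub>R w (real p + x) s)"
            unfolding h_def by (rule set_integral_add(2)[OF I(2) I(1)])
          then show ?thesis using I(3) hi by (simp add: add.commute)
        qed
        \<comment> \<open>The boundary terms of consecutive unit intervals telescope, and the outer
          two vanish because 0 < a and b < P.\<close>
        have h0: "(LINT t:{0..real P}|lborel. h t) = 0"
        proof -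
          have "(LINT t:{0..real P}|lborel. h t) = (\<Sum>p<P. LINT x:{0..1}|lborel. h (real p + x))"
            using integral_unit_pieces[of P h] piece by blast
          also have "\<dots> = (\<Sum>p<P. \<phi> (real (Suc p), s) *\<^sub>R \<xi> (real (Suc p)) s - \<phi> (real p, s) *\<^sub>R \<xi> (real p) s)"
            using piece by simp
          also have "\<dots> = \<phi> (real P, s) *\<^sub>R \<xi> (real P) s - \<phi> (real 0, s) *\<^sub>R \<xi> (real 0) s"
            by (rule sum_lessThan_telescope)
          also have "\<dots> = 0" using ab P by simp
          finally show ?thesis .
        qed
        have "(\<integral>t. F (t, s) + G (t, s) \<partial>lborel) = (\<integral>t. indicator {0..real P} t *\<^sub>R h t \<partial>lborel)"
        proof (rule integral_cong_AE)
          have ts: "(\<lambda>t::real. (t, s)) \<in> borel \<rightarrow>\<^sub>M (borel \<Otimes>\<^sub>M borel)" by measurable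
          show "(\<lambda>t. F (t, s) + G (t, s)) \<in> borel_measurable lborel"
            using measurable_compose[OF ts Fm] measurable_compose[OF ts Gm] by simp
          show "(\<lambda>t. indicator {0..real P} t *\<^sub>R h t) \<in> borel_measurable lborel"
            using integral_unit_pieces[of P h] piece unfolding set_integrable_def by (blast intro: borel_measurable_integrable)
          show "AE t in lborel. F (t, s) + G (t, s) = indicator {0..real P} t *\<^sub>R h t"
            using AE_lborel_singleton[of 0]
          proof eventually_elim
            case (elim t)
            have "\<phi>t (t, s) = 0 \<and> \<phi> (t, s) = 0" if "t > real P" using zero[of t s] ab(3)[of t s] that P by simp
            then show ?case using elim s by (auto simp: F_def G_def h_def indicator_def)
          qed
        qed
        then show "(\<integral>t. F (t, s) + G (t, s) \<partial>lborel) = 0" using h0 by (simp add: set_lebesgue_integral_def)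
      qed
    qed
    then show ?thesis
    proof eventually_elim
      case (elim s)
      show ?case
      proof (cases "s \<in> {0..1}")
        case False
        then have "F (t, s) + G (t, s) = 0" for t by (auto simp: F_def G_def indicator_def)
        then show ?thesis by simp
      qed (use elim in blast)
    qed
  qed
  then have "(\<integral>s. (\<integral>t. F (t, s) + G (t, s) \<partial>lborel) \<partial>lborel) = 0" by (rule integral_eq_zero_AE)
  moreover have "(\<integral>s. (\<integral>t. F (t, s) + G (t, s) \<partial>lborel) \<partial>lborel) = (\<integral>p. F p + G p \<partial>(lborel \<Otimes>\<^sub>M lborel))"
  proof -
    have e: "(\<lambda>(t, s). F (t, s) + G (t, s)) = (\<lambda>p. F p + G p)" by auto
    show ?thesis using lborel_pair.integral_snd[of "\<lambda>t s. F (t, s) + G (t, s)", unfolded e, OF FGi] .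
  qed
  ultimately have "(\<integral>p. F p \<partial>lborel) + (\<integral>p. G p \<partial>lborel) = 0"
    using Fi Gi by (simp add: lborel_prod)
  moreover have "(\<integral>p. F p \<partial>lebesgue) = (\<integral>p. F p \<partial>lborel)" "(\<integral>p. G p \<partial>lebesgue) = (\<integral>p. G p \<partial>lborel)"
    using borel_pair_lebesgue(1)[OF Fm] borel_pair_lebesgue(1)[OF Gm] by (simp_all add: integral_completion)
  ultimately show ?thesis
    unfolding set_lebesgue_integral_def F_def G_def by (simp add: add_eq_0_iff)
qed

end

section \<open>Assembly of the generalized solution\<close>

lemma kap_diff_le:
  fixes f :: "real \<Rightarrow> 'a::euclidean_space"
  assumes f: "integrable I01 f" and ab: "a \<le> b"
  shows "norm (kap f b - kap f a) \<le> (\<integral>x. indicator {a<..b} x * norm (f x) \<partial>I01)"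
proof -
  have "kap f a - kap f b = (\<integral>r. indicator {..b} r *\<^sub>R f r - indicator {..a} r *\<^sub>R f r \<partial>I01)"
    unfolding kap_def using integrable_kap[OF f] by simp
  also have "\<dots> = (\<integral>r. indicator {a<..b} r *\<^sub>R f r \<partial>I01)"
    by (rule Bochner_Integration.integral_cong) (use ab in \<open>auto simp: indicator_def\<close>)
  also have "norm \<dots> \<le> (\<integral>r. norm (indicator {a<..b} r *\<^sub>R f r) \<partial>I01)" by (rule integral_norm_bound)
  also have "\<dots> = (\<integral>x. indicator {a<..b} x * norm (f x) \<partial>I01)" by simp
  finally show ?thesis by (simp add: norm_minus_commute)
qed

context multiplier
begin

text \<open>Jensen's inequality, obtained from the variance of |f| about its mean
  \<open>B\<close>.\<close>

lemma B_sq_le: "ennreal (B\<^sup>2) \<le> (\<integral>\<^sup>+s. ennreal ((norm (f s))\<^sup>2) \<partial>I01)"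
proof -
  have sqi: "integrable I01 (\<lambda>s. (norm (f s))\<^sup>2)"
    by (rule integrableI_bounded) (use f in auto)
  have fi: "integrable I01 (\<lambda>s. norm (f s))" using f_int by (rule integrable_norm)
  note one = measure_I01_UNIV
  have "0 \<le> (\<integral>s. (norm (f s) - B)\<^sup>2 \<partial>I01)" by (rule Bochner_Integration.integral_nonneg) simp
  also have "\<dots> = (\<integral>s. (norm (f s))\<^sup>2 - 2 * B * norm (f s) + B\<^sup>2 \<partial>I01)"
    by (rule Bochner_Integration.integral_cong) (auto simp: power2_diff algebra_simps)
  also have "\<dots> = (\<integral>s. (norm (f s))\<^sup>2 \<partial>I01) - 2 * B * B + B\<^sup>2"
    using sqi fi one by (simp add: B_def)
  finally have "B\<^sup>2 \<le> (\<integral>s. (norm (f s))\<^sup>2 \<partial>I01)" by (simp add: power2_eq_square)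
  then show ?thesis using nn_integral_eq_integral[OF sqi] by (simp add: ennreal_leI)
qed

end

context flow
begin

text \<open>Young's inequality turns |h|^2 <= <x, h> into |h|^2 <= (|x|^2 + |h|^2) / 2, so the
  velocity is no larger than the curve, whose norm is at most N exp t. The normal vector x - h then
  has squared norm at most 4 |x|^2.\<close>

lemma tangent_bound:
  assumes h [measurable]: "h \<in> borel_measurable borel" and t: "0 \<le> t" and T: "tangent t h"
  shows "(\<integral>\<^sup>+s. ennreal ((norm (h s))\<^sup>2) \<partial>I01) \<le> ennreal (N\<^sup>2 * exp (2 * t))"
    "integrable I01 (\<lambda>s. (norm (h s))\<^sup>2)" "(\<integral>s. (norm (h s))\<^sup>2 \<partial>I01) \<le> (\<integral>s. \<xi> t s \<bullet> h s \<partial>I01)"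
    "(\<integral>\<^sup>+s. ennreal ((norm (\<xi> t s - h s))\<^sup>2) \<partial>I01) \<le> ennreal (4 * N\<^sup>2 * exp (2 * t))"
proof -
  have le: "(\<integral>\<^sup>+s. ennreal ((norm (h s))\<^sup>2) \<partial>I01) \<le> ennreal (\<integral>s. \<xi> t s \<bullet> h s \<partial>I01)"
    using T by (simp add: tangent_def)
  then have fin: "(\<integral>\<^sup>+s. ennreal ((norm (h s))\<^sup>2) \<partial>I01) < \<infinity>" by (simp add: le_less_trans)
  show sq: "integrable I01 (\<lambda>s. (norm (h s))\<^sup>2)" by (rule integrableI_bounded) (use fin in auto)
  have hi: "integrable I01 h" by (rule I01_sq_integrable[OF h fin])
  have xsq: "integrable I01 (\<lambda>s. (norm (\<xi> t s))\<^sup>2)"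
    by (intro continuous_integrable_I01 continuous_intros \<xi>_cont2)
  define e where "e = (\<integral>s. (norm (h s))\<^sup>2 \<partial>I01)"
  define n where "n = (\<integral>s. (norm (\<xi> t s))\<^sup>2 \<partial>I01)"
  define q where "q = (\<integral>s. \<xi> t s \<bullet> h s \<partial>I01)"
  have ee: "(\<integral>\<^sup>+s. ennreal ((norm (h s))\<^sup>2) \<partial>I01) = ennreal e"
    unfolding e_def by (rule nn_integral_eq_integral[OF sq]) simp
  have "(\<lambda>s. \<xi> t s \<bullet> h s) = (\<lambda>s. h s \<bullet> ev (X t) s)" using t by (simp add: \<xi>_def inner_commute)
  then have xhi: "integrable I01 (\<lambda>s. \<xi> t s \<bullet> h s)" using integrable_inner_ev[OF hi, of "X t"] by simp
  have e0: "0 \<le> e" unfolding e_def by (rule Bochner_Integration.integral_nonneg) simp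
  have qle: "q \<le> (n + e) / 2"
  proof -
    have "q \<le> (\<integral>s. ((norm (\<xi> t s))\<^sup>2 + (norm (h s))\<^sup>2) / 2 \<partial>I01)" unfolding q_def
    proof (rule integral_mono[OF xhi])
      show "integrable I01 (\<lambda>s. ((norm (\<xi> t s))\<^sup>2 + (norm (h s))\<^sup>2) / 2)" using sq xsq by simp
      fix s
      have "\<xi> t s \<bullet> h s \<le> norm (\<xi> t s) * norm (h s)" by (rule norm_cauchy_schwarz)
      also have "\<dots> \<le> ((norm (\<xi> t s))\<^sup>2 + (norm (h s))\<^sup>2) / 2"
        using sum_squares_bound[of "norm (\<xi> t s)" "norm (h s)"] by simp
      finally show "\<xi> t s \<bullet> h s \<le> ((norm (\<xi> t s))\<^sup>2 + (norm (h s))\<^sup>2) / 2" .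
    qed
    also have "\<dots> = (n + e) / 2" using sq xsq by (simp add: n_def e_def)
    finally show ?thesis .
  qed
  \<comment> \<open>In \<open>tangent\<close> a negative right side would be truncated to 0 by
    \<open>ennreal\<close>. That case cannot occur: it would force h = 0 almost everywhere, and then
    the right side is 0.\<close>
  show eq: "(\<integral>s. (norm (h s))\<^sup>2 \<partial>I01) \<le> (\<integral>s. \<xi> t s \<bullet> h s \<partial>I01)"
  proof (cases "0 \<le> q")
    case True then show ?thesis using le unfolding ee q_def[symmetric] e_def[symmetric] by simp
  next
    case False
    then have "ennreal e \<le> 0" using le unfolding ee q_def[symmetric] by (simp add: ennreal_neg)
    then have "e = 0" using e0 by simp
    then have "AE s in I01. (norm (h s))\<^sup>2 = 0"
      unfolding e_def by (subst (asm) integral_nonneg_eq_0_iff_AE[OF sq]) auto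
    then have "AE s in I01. \<xi> t s \<bullet> h s = 0" by eventually_elim simp
    then have "q = 0" unfolding q_def by (rule integral_eq_zero_AE)
    then show ?thesis using False by simp
  qed
  have en: "e \<le> n" using eq qle by (simp add: e_def q_def)
  have "n = (norm (X t))\<^sup>2" using t by (simp add: n_def norm_cper_sq \<xi>_def)
  also have "\<dots> \<le> (exp t * N)\<^sup>2" by (intro power_mono X_norm t) simp
  also have "\<dots> = N\<^sup>2 * exp (2 * t)" by (simp add: power_mult_distrib exp_double)
  finally have nN: "n \<le> N\<^sup>2 * exp (2 * t)" .
  show "(\<integral>\<^sup>+s. ennreal ((norm (h s))\<^sup>2) \<partial>I01) \<le> ennreal (N\<^sup>2 * exp (2 * t))"
    unfolding ee using en nN by (intro ennreal_leI) simp
  have "(\<integral>\<^sup>+s. ennreal ((norm (\<xi> t s - h s))\<^sup>2) \<partial>I01) \<le> (\<integral>\<^sup>+s. ennreal (2 * (norm (\<xi> t s))\<^sup>2 + 2 * (norm (h s))\<^sup>2) \<partial>I01)"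
  proof (intro nn_integral_mono ennreal_leI)
    fix s show "(norm (\<xi> t s - h s))\<^sup>2 \<le> 2 * (norm (\<xi> t s))\<^sup>2 + 2 * (norm (h s))\<^sup>2"
      using norm_add_sq_le[of "\<xi> t s" "- h s"] by simp
  qed
  also have "\<dots> = ennreal (2 * n + 2 * e)"
  proof -
    have "integrable I01 (\<lambda>s. 2 * (norm (\<xi> t s))\<^sup>2 + 2 * (norm (h s))\<^sup>2)" using sq xsq by simp
    from nn_integral_eq_integral[OF this] show ?thesis using sq xsq by (simp add: n_def e_def)
  qed
  also have "\<dots> \<le> ennreal (4 * N\<^sup>2 * exp (2 * t))" using en nN by (intro ennreal_leI) simp
  finally show "(\<integral>\<^sup>+s. ennreal ((norm (\<xi> t s - h s))\<^sup>2) \<partial>I01) \<le> ennreal (4 * N\<^sup>2 * exp (2 * t))" .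
qed

lemma \<xi>_periodic: "\<xi> t (s + 1) = \<xi> t s"
  by (simp add: \<xi>_def ev_periodic)

text \<open>The fixed-time construction with measurable dependence on time. The median is chosen by
  \<open>measurable_zero_selection\<close>, and the derivative of sigma again comes from the dyadic
  martingale, so it is jointly measurable as well.\<close>

lemma multiplier_exists:
  assumes wm: "(\<lambda>q. w (fst q) (snd q)) \<in> borel_measurable (borel \<Otimes>\<^sub>M borel)"
    and wt: "AE t in lborel. 0 < t \<longrightarrow> tangent t (w t)"
    and vm: "(\<lambda>q. v (fst q) (snd q)) \<in> borel_measurable (borel \<Otimes>\<^sub>M borel)"
    and vt: "AE t in lborel. 0 < t \<longrightarrow> (AE s in I01. norm (v t s) \<le> 1) \<and>
       (\<forall>b\<in>{0..1}. (LINT r:{0..b}|lborel. v t r) = \<xi> t b - \<xi> t 0)"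
  obtains \<sigma> sg :: "real \<Rightarrow> real \<Rightarrow> real" where
    "(\<lambda>q. \<sigma> (fst q) (snd q)) \<in> borel_measurable (borel \<Otimes>\<^sub>M borel)"
    "(\<lambda>q. sg (fst q) (snd q)) \<in> borel_measurable (borel \<Otimes>\<^sub>M borel)"
    "\<And>t s. 0 \<le> \<sigma> t s" "\<And>t s. \<sigma> t (s + 1) = \<sigma> t s"
    "AE t in lborel. 0 < t \<longrightarrow>
      (\<integral>\<^sup>+s. ennreal ((norm (\<sigma> t s))\<^sup>2) \<partial>I01) \<le> ennreal (36 * N\<^sup>2 * exp (2 * t)) \<and>
      (\<integral>\<^sup>+s. ennreal ((norm (sg t s))\<^sup>2) \<partial>I01) \<le> ennreal (4 * N\<^sup>2 * exp (2 * t)) \<and>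
      weak_deriv_S1 (\<sigma> t) (sg t) \<and>
      weak_deriv_S1 (\<lambda>s. \<sigma> t s *\<^sub>R v t s) (\<lambda>s. w t s - \<xi> t s) \<and>
      (AE s in I01. \<sigma> t s * ((norm (v t s))\<^sup>2 - 1) = 0)"
proof -
  define f where "f t s = \<xi> t s - w t s" for t s
  have ws [measurable]: "w t \<in> borel_measurable borel" for t
    using measurable_compose[OF measurable_Pair1' wm, of t] by simp
  have vs [measurable]: "v t \<in> borel_measurable borel" for t
    using measurable_compose[OF measurable_Pair1' vm, of t] by simp
  have fm: "(\<lambda>q. f (fst q) (snd q)) \<in> borel_measurable (borel \<Otimes>\<^sub>M borel)"
    unfolding f_def using wm \<xi>_measurable by measurable
  have fs [measurable]: "f t \<in> borel_measurable borel" for t unfolding f_def[abs_def] by measurable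
  \<comment> \<open>The \<open>multiplier\<close> locale applies at these times only. They exhaust
    almost all positive times; elsewhere the selected \<open>c\<close> is measurable but
    arbitrary.\<close>
  define good where "good t \<longleftrightarrow> 0 < t \<and> tangent t (w t) \<and> (AE s in I01. norm (v t s) \<le> 1) \<and>
       (\<forall>b\<in>{0..1}. (LINT r:{0..b}|lborel. v t r) = \<xi> t b - \<xi> t 0)" for t
  have aeg: "AE t in lborel. 0 < t \<longrightarrow> good t"
    using wt vt by eventually_elim (simp add: good_def)
  have fsq: "(\<integral>\<^sup>+s. ennreal ((norm (f t s))\<^sup>2) \<partial>I01) \<le> ennreal (4 * N\<^sup>2 * exp (2 * t))" if "good t" for t
    unfolding f_def using that tangent_bound(4)[OF ws] by (simp add: good_def)
  have mult: "multiplier (f t) (v t) (X t)" if g: "good t" for t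
  proof
    have t: "0 < t" "max 0 t = t" using g by (auto simp: good_def)
    show "(\<integral>\<^sup>+s. ennreal ((norm (f t s))\<^sup>2) \<partial>I01) < \<infinity>" using fsq[OF g] by (simp add: le_less_trans)
    show "AE s in I01. norm (v t s) \<le> 1" using g by (simp add: good_def)
    show "X t \<in> Lip1" using t by (intro X_in) simp
    show "(LINT r:{0..b}|lborel. v t r) = ev (X t) b - ev (X t) 0" if "b \<in> {0..1}" for b
      using g that t unfolding good_def by (simp add: \<xi>_def)
    show "(\<integral>s. f t s \<bullet> (ev z s - ev (X t) s) \<partial>I01) \<le> 0" if "z \<in> Lip1" for z
      using g that t(2) unfolding good_def tangent_def f_def \<xi>_def by simp
  qed (fact fs vs)+
  define \<kappa> where "\<kappa> t s = kap (f t) s" for t s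
  have \<kappa>m: "(\<lambda>q. \<kappa> (fst q) (snd q)) \<in> borel_measurable (borel \<Otimes>\<^sub>M borel)"
  proof -
    have a: "(\<lambda>q :: (real \<times> real) \<times> real. (fst (fst q), snd q)) \<in> (borel \<Otimes>\<^sub>M borel) \<Otimes>\<^sub>M I01 \<rightarrow>\<^sub>M borel \<Otimes>\<^sub>M borel" by measurable
    have b: "(\<lambda>q :: (real \<times> real) \<times> real. f (fst (fst q)) (snd q)) \<in> borel_measurable ((borel \<Otimes>\<^sub>M borel) \<Otimes>\<^sub>M I01)"
      using measurable_compose[OF a fm] by simp
    have c: "(\<lambda>q :: (real \<times> real) \<times> real. indicator {..snd (fst q)} (snd q) :: real) \<in> borel_measurable ((borel \<Otimes>\<^sub>M borel) \<Otimes>\<^sub>M I01)"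
      unfolding indicator_def atMost_iff by measurable
    have "(\<lambda>q. \<integral>r. indicator {..snd q} r *\<^sub>R f (fst q) r \<partial>I01) \<in> borel_measurable (borel \<Otimes>\<^sub>M borel)"
      by (rule I01.borel_measurable_lebesgue_integral) (use borel_measurable_scaleR[OF c b] in \<open>simp add: case_prod_beta\<close>)
    then show ?thesis unfolding \<kappa>_def kap_def by measurable
  qed
  define \<Phi> where "\<Phi> t c = (\<integral>s. norm (\<kappa> t s - c) - (\<kappa> t s - c) \<bullet> v t s \<partial>I01)" for t c
  have \<Phi>m: "(\<lambda>t. \<Phi> t c) \<in> borel_measurable borel" for c
  proof -
    note [measurable] = \<kappa>m vm
    have "(\<lambda>q. norm (\<kappa> (fst q) (snd q) - c) - (\<kappa> (fst q) (snd q) - c) \<bullet> v (fst q) (snd q)) \<in> borel_measurable (borel \<Otimes>\<^sub>M borel)"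
      by measurable
    then have "(\<lambda>q. norm (\<kappa> (fst q) (snd q) - c) - (\<kappa> (fst q) (snd q) - c) \<bullet> v (fst q) (snd q)) \<in> borel_measurable (borel \<Otimes>\<^sub>M I01)"
      by (simp cong: measurable_cong_sets sets_pair_measure_cong)
    then show ?thesis unfolding \<Phi>_def by (intro I01.borel_measurable_lebesgue_integral) (simp add: case_prod_beta)
  qed
  obtain c where cm: "c \<in> borel_measurable borel" and c:
    "\<And>t. (\<And>a b. \<bar>\<Phi> t a - \<Phi> t b\<bar> \<le> norm (a - b)) \<Longrightarrow> \<exists>a. \<Phi> t a = 0 \<Longrightarrow> \<Phi> t (c t) = 0"
    by (rule measurable_zero_selection[of \<Phi> borel, OF \<Phi>m]) blast
  have \<Phi>0: "multiplier.\<Phi> (f t) (v t) (c t) = 0" if g: "good t" for t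
  proof -
    have eq: "multiplier.\<Phi> (f t) (v t) a = \<Phi> t a" for a
      unfolding multiplier.\<Phi>_def[OF mult[OF g]] by (simp add: \<Phi>_def \<kappa>_def)
    show ?thesis unfolding eq
      by (rule c) (use multiplier.\<Phi>_lip[OF mult[OF g]] multiplier.median_exists[OF mult[OF g]] eq in auto)
  qed
  \<comment> \<open>The fractional part makes sigma periodic. At s = 1 it reads \<open>kap\<close>
    at 0, which agrees with the value at 1 at good times because both are zero.\<close>
  define \<sigma> where "\<sigma> t s = norm (\<kappa> t (frac s) - c t)" for t s
  have \<sigma>m: "(\<lambda>q. \<sigma> (fst q) (snd q)) \<in> borel_measurable (borel \<Otimes>\<^sub>M borel)"
  proof -
    note [measurable] = cm
    have "(\<lambda>q :: real \<times> real. (fst q, frac (snd q))) \<in> (borel \<Otimes>\<^sub>M borel) \<rightarrow>\<^sub>M (borel \<Otimes>\<^sub>M borel)"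
      unfolding frac_def by measurable
    from measurable_compose[OF this \<kappa>m] have [measurable]: "(\<lambda>q. \<kappa> (fst q) (frac (snd q))) \<in> borel_measurable (borel \<Otimes>\<^sub>M borel)"
      by simp
    show ?thesis unfolding \<sigma>_def by measurable
  qed
  have \<sigma>s [measurable]: "\<sigma> t \<in> borel_measurable borel" for t
    using measurable_compose[OF measurable_Pair1' \<sigma>m, of t] by simp
  have \<sigma>t: "(\<lambda>t. \<sigma> t s) \<in> borel_measurable borel" for s
    using measurable_compose[OF measurable_Pair2' \<sigma>m, of s] by simp
  have \<sigma>eq: "\<sigma> t s = norm (kap (f t) s - c t)" if g: "good t" and s: "s \<in> {0..1}" for t s
  proof (cases "s = 1")
    case True
    interpret multiplier "f t" "v t" "X t" by (rule mult[OF g])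
    show ?thesis using True by (simp add: \<sigma>_def \<kappa>_def kap_0 kap_1)
  next
    case False
    then have "frac s = s" using s by (simp add: frac_eq)
    then show ?thesis by (simp add: \<sigma>_def \<kappa>_def)
  qed
  have \<sigma>c: "continuous_on {0..1} (\<sigma> t)" if g: "good t" for t
  proof -
    interpret multiplier "f t" "v t" "X t" by (rule mult[OF g])
    have "continuous_on {0..1} (\<lambda>s. norm (kap (f t) s - c t))" by (intro continuous_intros kap_cont)
    then show ?thesis by (rule continuous_on_eq) (simp add: \<sigma>eq[OF g])
  qed
  \<comment> \<open>By the reverse triangle inequality sigma varies no more than
    \<open>kap (f t)\<close>, whose increments are controlled by the integral of |f|.\<close>
  have dq\<sigma>: "(\<integral>\<^sup>+x. ennreal ((norm (dq n (\<sigma> t) x))\<^sup>2) \<partial>I01) \<le> ennreal (4 * N\<^sup>2 * exp (2 * t))" if g: "good t" for n t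
  proof -
    interpret multiplier "f t" "v t" "X t" by (rule mult[OF g])
    have "(\<integral>\<^sup>+x. ennreal ((norm (dq n (\<sigma> t) x))\<^sup>2) \<partial>I01) \<le> (\<integral>\<^sup>+x. ennreal ((norm (norm (f t x)))\<^sup>2) \<partial>I01)"
    proof (rule dq_sq_le)
      show "(\<integral>\<^sup>+x. ennreal ((norm (norm (f t x)))\<^sup>2) \<partial>I01) < \<infinity>" using f(2) by simp
      fix a b :: real assume ab: "0 \<le> a" "a \<le> b" "b \<le> 1"
      have "norm (\<sigma> t b - \<sigma> t a) \<le> norm (kap (f t) b - kap (f t) a)"
        using ab \<sigma>eq[OF g, of a] \<sigma>eq[OF g, of b] norm_triangle_ineq3[of "kap (f t) b - c t" "kap (f t) a - c t"] by simp
      also have "\<dots> \<le> (\<integral>x. indicator {a<..b} x * norm (f t x) \<partial>I01)" by (rule kap_diff_le[OF f_int ab(2)])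
      finally show "norm (\<sigma> t b - \<sigma> t a) \<le> (\<integral>x. indicator {a<..b} x * norm (norm (f t x)) \<partial>I01)" by simp
    qed measurable
    then show ?thesis using fsq[OF g] by (simp add: order_trans)
  qed
  have bd: "(\<integral>\<^sup>+t. \<integral>\<^sup>+x. ennreal ((norm (dq n (\<sigma> t) x))\<^sup>2) \<partial>I01 \<partial>MT) \<le> ennreal (4 * N\<^sup>2)" for n
  proof -
    have "(\<integral>\<^sup>+t. \<integral>\<^sup>+x. ennreal ((norm (dq n (\<sigma> t) x))\<^sup>2) \<partial>I01 \<partial>MT) \<le> (\<integral>\<^sup>+t. ennreal (4 * N\<^sup>2) * ennreal (exp (2 * t)) \<partial>MT)"
    proof (rule nn_integral_mono_AE)
      show "AE t in MT. (\<integral>\<^sup>+x. ennreal ((norm (dq n (\<sigma> t) x))\<^sup>2) \<partial>I01) \<le> ennreal (4 * N\<^sup>2) * ennreal (exp (2 * t))"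
        unfolding AE_MT using aeg by eventually_elim (use dq\<sigma> in \<open>simp add: ennreal_mult[symmetric]\<close>)
    qed
    also have "\<dots> = ennreal (4 * N\<^sup>2)" by (subst nn_integral_cmult) (auto simp: nn_integral_MT_exp)
    finally show ?thesis .
  qed
  obtain r sg where rs: "strict_mono (r::nat\<Rightarrow>nat)" "(\<lambda>q. sg (fst q) (snd q)) \<in> borel_measurable (MT \<Otimes>\<^sub>M borel)"
     "AE t in MT. (\<lambda>k. \<integral>\<^sup>+x. ennreal ((norm (dq (r k) (\<sigma> t) x - sg t x))\<^sup>2) \<partial>I01) \<longlonglongrightarrow> 0"
     "AE t in MT. AE x in I01. (\<lambda>k. dq (r k) (\<sigma> t) x) \<longlonglongrightarrow> sg t x"
    by (rule dyadic_derivative[OF MT.sigma_finite_measure_axioms _ bd]) (use \<sigma>t in measurable)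
  have sgm: "(\<lambda>q. sg (fst q) (snd q)) \<in> borel_measurable (borel \<Otimes>\<^sub>M borel)"
    using rs(2) by (simp cong: measurable_cong_sets sets_pair_measure_cong)
  have sgs [measurable]: "sg t \<in> borel_measurable borel" for t
    using measurable_compose[OF measurable_Pair1' sgm, of t] by simp
  have main: "AE t in lborel. 0 < t \<longrightarrow>
      (\<integral>\<^sup>+s. ennreal ((norm (\<sigma> t s))\<^sup>2) \<partial>I01) \<le> ennreal (36 * N\<^sup>2 * exp (2 * t)) \<and>
      (\<integral>\<^sup>+s. ennreal ((norm (sg t s))\<^sup>2) \<partial>I01) \<le> ennreal (4 * N\<^sup>2 * exp (2 * t)) \<and>
      weak_deriv_S1 (\<sigma> t) (sg t) \<and>
      weak_deriv_S1 (\<lambda>s. \<sigma> t s *\<^sub>R v t s) (\<lambda>s. w t s - \<xi> t s) \<and>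
      (AE s in I01. \<sigma> t s * ((norm (v t s))\<^sup>2 - 1) = 0)"
    using aeg rs(3,4)[unfolded AE_MT]
  proof eventually_elim
    case (elim t)
    show ?case
    proof
      assume t: "0 < t"
      with elim have g: "good t"
        and L2: "(\<lambda>k. \<integral>\<^sup>+x. ennreal ((norm (dq (r k) (\<sigma> t) x - sg t x))\<^sup>2) \<partial>I01) \<longlonglongrightarrow> 0"
        and ptw: "AE x in I01. (\<lambda>k. dq (r k) (\<sigma> t) x) \<longlonglongrightarrow> sg t x" by auto
      interpret multiplier "f t" "v t" "X t" by (rule mult[OF g])
      have \<sigma>1: "\<sigma> t 1 = \<sigma> t 0" by (simp add: \<sigma>_def)
      note mp = median_props[OF \<Phi>0[OF g]]
      have \<sigma>B: "\<sigma> t s \<le> 3 * B" for s unfolding \<sigma>_def \<kappa>_def by (rule mp(2))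
      have ind01: "AE s in I01. s \<in> {0..1}" using AE_I01_ivl by eventually_elim simp
      \<comment> \<open>The constant is 36 = 3^2 * 4: sigma is at most 3 B, and B^2 is at most the
        integral of |f|^2.\<close>
      have 1: "(\<integral>\<^sup>+s. ennreal ((norm (\<sigma> t s))\<^sup>2) \<partial>I01) \<le> ennreal (36 * N\<^sup>2 * exp (2 * t))"
      proof -
        have "(\<integral>\<^sup>+s. ennreal ((norm (\<sigma> t s))\<^sup>2) \<partial>I01) \<le> (\<integral>\<^sup>+s. ennreal ((3 * B)\<^sup>2) \<partial>I01)"
          using \<sigma>B by (intro nn_integral_mono ennreal_leI power_mono) (auto simp: \<sigma>_def)
        also have "\<dots> = ennreal 9 * ennreal (B\<^sup>2)" by (simp add: emeasure_I01 power_mult_distrib ennreal_mult)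
        also have "\<dots> \<le> ennreal 9 * ennreal (4 * N\<^sup>2 * exp (2 * t))"
          using order_trans[OF B_sq_le fsq[OF g]] by (rule mult_left_mono) simp
        also have "\<dots> = ennreal (36 * N\<^sup>2 * exp (2 * t))" by (subst ennreal_mult[symmetric]) auto
        finally show ?thesis .
      qed
      have 2: "(\<integral>\<^sup>+s. ennreal ((norm (sg t s))\<^sup>2) \<partial>I01) \<le> ennreal (4 * N\<^sup>2 * exp (2 * t))"
        by (rule dyadic_sq_bound[OF sgs ptw dq\<sigma>[OF g]])
      have sgi: "integrable I01 (sg t)" by (rule I01_sq_integrable[OF sgs]) (use 2 in \<open>simp add: le_less_trans\<close>)
      have \<sigma>i: "integrable I01 (\<sigma> t)"
        by (rule I01_sq_integrable[OF \<sigma>s]) (use 1 in \<open>simp add: le_less_trans\<close>)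
      have 3: "weak_deriv_S1 (\<sigma> t) (sg t)"
      proof (rule weak_deriv_S1_primitive[where F="\<sigma> t", OF \<sigma>s sgs sgi _ \<sigma>1 _ \<sigma>i])
        fix b :: real assume "b \<in> {0..1}"
        from dyadic_FTC[OF \<sigma>c[OF g] rs(1) sgs L2 sgi this]
        show "\<sigma> t b = \<sigma> t 0 + (LINT r:{0..b}|lborel. sg t r)" by simp
      qed simp
      have ae\<sigma>v: "AE s in I01. \<sigma> t s *\<^sub>R v t s = kap (f t) s - c t"
        using mp(1) ind01 by eventually_elim (use \<sigma>eq[OF g] in metis)
      \<comment> \<open>Almost everywhere sigma v equals kappa - c, a periodic primitive of - f =
        x_t - x. This is the evolution equation in weak form.\<close>
      have 4: "weak_deriv_S1 (\<lambda>s. \<sigma> t s *\<^sub>R v t s) (\<lambda>s. w t s - \<xi> t s)"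
      proof (rule weak_deriv_S1_primitive[where F="\<lambda>s. kap (f t) s - c t"])
        have fi: "(\<lambda>s. w t s - \<xi> t s) = (\<lambda>s. - f t s)" by (simp add: f_def)
        show "integrable I01 (\<lambda>s. w t s - \<xi> t s)" unfolding fi using f_int by simp
        show "kap (f t) b - c t = kap (f t) 0 - c t + (LINT r:{0..b}|lborel. w t r - \<xi> t r)" if "b \<in> {0..1}" for b
          unfolding fi kap_eq[OF fs that] by (simp add: kap_0 set_lebesgue_integral_def)
        show "kap (f t) 1 - c t = kap (f t) 0 - c t" by (simp add: kap_0 kap_1)
        show "AE s in I01. \<sigma> t s *\<^sub>R v t s = kap (f t) s - c t" by (rule ae\<sigma>v)
        have "integrable I01 (\<lambda>s. kap (f t) s - c t)"
          by (intro continuous_integrable_I01 continuous_intros kap_cont)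
        then show "integrable I01 (\<lambda>s. \<sigma> t s *\<^sub>R v t s)"
          by (subst integrable_cong_AE[OF _ _ ae\<sigma>v]) measurable
      qed measurable
      have 5: "AE s in I01. \<sigma> t s * ((norm (v t s))\<^sup>2 - 1) = 0"
        using mp(1) ind01 by eventually_elim (use \<sigma>eq[OF g] in simp)
      show "(\<integral>\<^sup>+s. ennreal ((norm (\<sigma> t s))\<^sup>2) \<partial>I01) \<le> ennreal (36 * N\<^sup>2 * exp (2 * t)) \<and>
        (\<integral>\<^sup>+s. ennreal ((norm (sg t s))\<^sup>2) \<partial>I01) \<le> ennreal (4 * N\<^sup>2 * exp (2 * t)) \<and>
        weak_deriv_S1 (\<sigma> t) (sg t) \<and>
        weak_deriv_S1 (\<lambda>s. \<sigma> t s *\<^sub>R v t s) (\<lambda>s. w t s - \<xi> t s) \<and>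
        (AE s in I01. \<sigma> t s * ((norm (v t s))\<^sup>2 - 1) = 0)"
        using 1 2 3 4 5 by blast
    qed
  qed
  show ?thesis
  proof (rule that[OF \<sigma>m sgm _ _ main])
    show "0 \<le> \<sigma> t s" for t s by (simp add: \<sigma>_def)
    show "\<sigma> t (s + 1) = \<sigma> t s" for t s by (simp add: \<sigma>_def frac_1_eq)
  qed
qed

lemma initial_limit:
  "((\<lambda>t. LINT s:{0..1}|lebesgue. (norm (\<xi> t s - \<xi> 0 s))\<^sup>2) \<longlongrightarrow> 0) (at_right 0)"
proof -
  have eq: "(LINT s:{0..1}|lebesgue. (norm (\<xi> t s - \<xi> 0 s))\<^sup>2) = (norm (X t - X 0))\<^sup>2" if "0 \<le> t" for t
  proof -
    have "(\<lambda>s. (norm (\<xi> t s - \<xi> 0 s))\<^sup>2) \<in> borel_measurable borel" by measurable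
    from set_integral_lebesgue_borel(1)[OF this]
    show ?thesis using that by (simp add: norm_cper_sq ev_simps \<xi>_def)
  qed
  have "((\<lambda>t. ((t - 0) * (exp t * N))\<^sup>2) \<longlongrightarrow> ((0 - 0) * (exp 0 * N))\<^sup>2) (at_right 0)"
    by (intro tendsto_intros)
  then have g: "((\<lambda>t. ((t - 0) * (exp t * N))\<^sup>2) \<longlongrightarrow> 0) (at_right 0)" by simp
  show ?thesis
  proof (rule Lim_null_comparison[OF _ g])
    show "eventually (\<lambda>t. norm (LINT s:{0..1}|lebesgue. (norm (\<xi> t s - \<xi> 0 s))\<^sup>2) \<le> ((t - 0) * (exp t * N))\<^sup>2) (at_right 0)"
      unfolding eventually_at_right_field
    proof (intro exI[of _ 1] conjI allI impI)
      fix t :: real assume "0 < t"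
      then have "norm (X t - X 0) \<le> (t - 0) * (exp t * N)" by (intro X_lip) auto
      then have "(norm (X t - X 0))\<^sup>2 \<le> ((t - 0) * (exp t * N))\<^sup>2" by (intro power_mono) auto
      then show "norm (LINT s:{0..1}|lebesgue. (norm (\<xi> t s - \<xi> 0 s))\<^sup>2) \<le> ((t - 0) * (exp t * N))\<^sup>2"
        using eq[of t] \<open>0 < t\<close> by simp
    qed simp
  qed
qed

lemma \<xi>_bounded: "\<exists>C. \<forall>t\<in>{0..T}. \<forall>s\<in>{0..1}. norm (\<xi> t s) \<le> C"
proof -
  have "compact ({0..T} \<times> {0..1::real})" by (intro compact_Times) auto
  then have "bounded ((\<lambda>p. \<xi> (fst p) (snd p)) ` ({0..T} \<times> {0..1}))"
    by (intro compact_imp_bounded compact_continuous_image continuous_on_subset[OF \<xi>_continuous]) simp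
  then obtain C where C: "\<forall>x\<in>(\<lambda>p. \<xi> (fst p) (snd p)) ` ({0..T} \<times> {0..1}). norm x \<le> C" unfolding bounded_iff by blast
  show ?thesis
  proof (intro exI[of _ C] ballI)
    fix t s assume "t \<in> {0..T}" "s \<in> {0..1::real}"
    then have "\<xi> t s \<in> (\<lambda>p. \<xi> (fst p) (snd p)) ` ({0..T} \<times> {0..1})" by (intro image_eqI[of _ _ "(t, s)"]) auto
    then show "norm (\<xi> t s) \<le> C" using C by blast
  qed
qed

end

lemma flow_gen_solution:
  fixes X :: "real \<Rightarrow> (real ^ 'd) cper"
  assumes "flow X N" and init: "AE s in lebesgue. s \<in> {0..1} \<longrightarrow> ev (X 0) s = \<xi>0 s"
  shows "\<exists>\<xi> \<sigma>. gen_solution \<xi>0 \<xi> \<sigma> \<and> (AE p in lebesgue. p \<in> {0<..} \<times> {0..1} \<longrightarrow> \<sigma> (fst p) (snd p) \<ge> 0)"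
proof -
  interpret flow X N by fact
  obtain v where vm: "(\<lambda>p. v (fst p) (snd p)) \<in> borel_measurable (borel \<Otimes>\<^sub>M borel)" and
    v: "AE t in lborel. 0 < t \<longrightarrow> (AE s in I01. norm (v t s) \<le> 1) \<and>
       (\<forall>b\<in>{0..1}. (LINT r:{0..b}|lborel. v t r) = \<xi> t b - \<xi> t 0)"
    using space_derivative by blast
  obtain w where wm: "(\<lambda>q. w (fst q) (snd q)) \<in> borel_measurable (borel \<Otimes>\<^sub>M borel)" and
    wt: "AE t in lborel. 0 < t \<longrightarrow> tangent t (w t)" and
    wf: "AE s in I01. \<forall>p::nat. (\<lambda>x. w (real p + x) s) \<in> borel_measurable borel \<and> integrable I01 (\<lambda>x. w (real p + x) s) \<and>
       (\<forall>b\<in>{0..1}. (LINT x:{0..b}|lborel. w (real p + x) s) = \<xi> (real p + b) s - \<xi> (real p) s)"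
    using time_derivative by blast
  obtain \<sigma> sg :: "real \<Rightarrow> real \<Rightarrow> real" where
    \<sigma>m: "(\<lambda>q. \<sigma> (fst q) (snd q)) \<in> borel_measurable (borel \<Otimes>\<^sub>M borel)" and
    sgm: "(\<lambda>q. sg (fst q) (snd q)) \<in> borel_measurable (borel \<Otimes>\<^sub>M borel)" and
    \<sigma>0: "\<And>t s. 0 \<le> \<sigma> t s" and \<sigma>p: "\<And>t s. \<sigma> t (s + 1) = \<sigma> t s" and
    \<sigma>: "AE t in lborel. 0 < t \<longrightarrow>
      (\<integral>\<^sup>+s. ennreal ((norm (\<sigma> t s))\<^sup>2) \<partial>I01) \<le> ennreal (36 * N\<^sup>2 * exp (2 * t)) \<and>
      (\<integral>\<^sup>+s. ennreal ((norm (sg t s))\<^sup>2) \<partial>I01) \<le> ennreal (4 * N\<^sup>2 * exp (2 * t)) \<and>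
      weak_deriv_S1 (\<sigma> t) (sg t) \<and>
      weak_deriv_S1 (\<lambda>s. \<sigma> t s *\<^sub>R v t s) (\<lambda>s. w t s - \<xi> t s) \<and>
      (AE s in I01. \<sigma> t s * ((norm (v t s))\<^sup>2 - 1) = 0)"
    by (rule multiplier_exists[OF wm wt vm v]) blast
  note [measurable] = vm wm \<sigma>m sgm \<xi>_measurable
  have ws [measurable]: "w t \<in> borel_measurable borel" for t
    using measurable_compose[OF measurable_Pair1' wm, of t] by simp
  have vs [measurable]: "v t \<in> borel_measurable borel" for t
    using measurable_compose[OF measurable_Pair1' vm, of t] by simp
  have \<sigma>v: "AE t in lborel. 0 < t \<longrightarrow> (\<integral>\<^sup>+s. ennreal ((norm (\<sigma> t s *\<^sub>R v t s))\<^sup>2) \<partial>I01) \<le> ennreal (36 * N\<^sup>2 * exp (2 * t))"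
    using v \<sigma>
  proof eventually_elim
    case (elim t)
    show ?case
    proof
      assume t: "0 < t"
      then have "AE s in I01. norm (v t s) \<le> 1" using elim by blast
      then have "AE s in I01. ennreal ((norm (\<sigma> t s *\<^sub>R v t s))\<^sup>2) \<le> ennreal ((norm (\<sigma> t s))\<^sup>2)"
      proof eventually_elim
        case (elim s)
        then have "\<bar>\<sigma> t s\<bar> * norm (v t s) \<le> \<bar>\<sigma> t s\<bar> * 1" by (intro mult_left_mono) auto
        then show ?case by (intro ennreal_leI power_mono) auto
      qed
      then have "(\<integral>\<^sup>+s. ennreal ((norm (\<sigma> t s *\<^sub>R v t s))\<^sup>2) \<partial>I01) \<le> (\<integral>\<^sup>+s. ennreal ((norm (\<sigma> t s))\<^sup>2) \<partial>I01)"
        by (rule nn_integral_mono_AE)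
      also have "\<dots> \<le> ennreal (36 * N\<^sup>2 * exp (2 * t))" using elim t by blast
      finally show "(\<integral>\<^sup>+s. ennreal ((norm (\<sigma> t s *\<^sub>R v t s))\<^sup>2) \<partial>I01) \<le> ennreal (36 * N\<^sup>2 * exp (2 * t))" .
    qed
  qed
  have wL2: "L2loc_L2 w"
    by (rule L2loc_L2_I[OF wm, of "N\<^sup>2"]) (use wt in \<open>auto elim!: eventually_mono intro: tangent_bound(1)[OF ws]\<close>)
  have w\<xi>L2: "L2loc_L2 (\<lambda>t s. w t s - \<xi> t s)"
  proof (rule L2loc_L2_I[of _ "4 * N\<^sup>2"])
    show "AE t in lborel. 0 < t \<longrightarrow> (\<integral>\<^sup>+s. ennreal ((norm (w t s - \<xi> t s))\<^sup>2) \<partial>I01) \<le> ennreal (4 * N\<^sup>2 * exp (2 * t))"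
      using wt
    proof eventually_elim
      case (elim t)
      then show ?case using tangent_bound(4)[OF ws, of t] by (auto simp: norm_minus_commute)
    qed
  qed auto
  have \<sigma>L2: "L2loc_L2 \<sigma>"
    by (rule L2loc_L2_I[OF \<sigma>m, of "36 * N\<^sup>2"]) (use \<sigma> in \<open>auto elim!: eventually_mono\<close>)
  have sgL2: "L2loc_L2 sg"
    by (rule L2loc_L2_I[OF sgm, of "4 * N\<^sup>2"]) (use \<sigma> in \<open>auto elim!: eventually_mono\<close>)
  have \<sigma>vL2: "L2loc_L2 (\<lambda>t s. \<sigma> t s *\<^sub>R v t s)"
    by (rule L2loc_L2_I[of _ "36 * N\<^sup>2"]) (use \<sigma>v in auto)
  have v1: "AE p in lebesgue. p \<in> {0<..} \<times> {0..1} \<longrightarrow> norm (v (fst p) (snd p)) \<le> 1"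
  proof (rule AE_Q)
    show "AE t in lborel. 0 < t \<longrightarrow> (AE s in I01. norm (v (fst (t, s)) (snd (t, s))) \<le> 1)"
      using v by eventually_elim simp
  qed measurable
  have per: "\<forall>t. periodic1 (\<xi> t)" "\<forall>t. periodic1 (\<sigma> t)"
    by (simp_all add: periodic1_def \<xi>_periodic \<sigma>p)
  have "gen_solution \<xi>0 \<xi> \<sigma>"
    unfolding gen_solution_def
  \<comment> \<open>With \<open>w t s - \<xi> t s\<close> as the derivative of sigma x_s the
    pointwise evolution equation becomes an identity; its content lies in the claim that this
    function is that weak derivative.\<close>
  proof (rule conjI[OF per(1)], rule conjI[OF per(2)], rule exI[of _ v], rule exI[of _ w], rule exI[of _ sg],
      rule exI[of _ "\<lambda>t s. w t s - \<xi> t s"], intro conjI allI impI)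
    show "(\<lambda>p. \<xi> (fst p) (snd p)) \<in> borel_measurable lebesgue" by (rule borel_pair_lebesgue(2)[OF \<xi>_measurable])
    show "(\<lambda>p. v (fst p) (snd p)) \<in> borel_measurable lebesgue" by (rule borel_pair_lebesgue(2)[OF vm])
    show "AE t in lebesgue. 0 < t \<longrightarrow> weak_deriv_S1 (\<xi> t) (v t)"
    proof (rule AE_completion)
      show "AE t in lborel. 0 < t \<longrightarrow> weak_deriv_S1 (\<xi> t) (v t)"
        using v
      proof eventually_elim
        case (elim t)
        show ?case
        proof
          assume "0 < t"
          with elim have e: "AE s in I01. norm (v t s) \<le> 1" "\<And>b. b \<in> {0..1} \<Longrightarrow> (LINT r:{0..b}|lborel. v t r) = \<xi> t b - \<xi> t 0"
            by blast+
          show "weak_deriv_S1 (\<xi> t) (v t)"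
          proof (rule weak_deriv_S1_primitive[where F="\<xi> t"])
            show "integrable I01 (v t)" by (rule I01.integrable_const_bound[of _ 1]) (use e in auto)
            show "integrable I01 (\<xi> t)" by (rule continuous_integrable_I01[OF \<xi>_cont2])
            show "\<xi> t b = \<xi> t 0 + (LINT r:{0..b}|lborel. v t r)" if "b \<in> {0..1}" for b using e(2)[OF that] by simp
            show "\<xi> t 1 = \<xi> t 0" using \<xi>_periodic[of t 0] by simp
          qed auto
        qed
      qed
    qed
    fix T :: real
    obtain C where C: "\<forall>t\<in>{0..T}. \<forall>s\<in>{0..1}. norm (\<xi> t s) \<le> C" using \<xi>_bounded by blast
    show "\<exists>C. AE p in lebesgue. p \<in> {0<..<T} \<times> {0..1} \<longrightarrow> norm (\<xi> (fst p) (snd p)) \<le> C \<and> norm (v (fst p) (snd p)) \<le> C"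
    proof (intro exI[of _ "max C 1"])
      show "AE p in lebesgue. p \<in> {0<..<T} \<times> {0..1} \<longrightarrow> norm (\<xi> (fst p) (snd p)) \<le> max C 1 \<and> norm (v (fst p) (snd p)) \<le> max C 1"
        using v1
      proof eventually_elim
        case (elim p)
        show ?case
        proof
          assume p: "p \<in> {0<..<T} \<times> {0..1}"
          then have "norm (\<xi> (fst p) (snd p)) \<le> C" using C by (auto simp: mem_Times_iff)
          moreover have "norm (v (fst p) (snd p)) \<le> 1" using elim p by (auto simp: mem_Times_iff)
          ultimately show "norm (\<xi> (fst p) (snd p)) \<le> max C 1 \<and> norm (v (fst p) (snd p)) \<le> max C 1" by linarith
        qed
      qed
    qed
  next
    show "L2loc_L2 w" by (rule wL2)
    show "(LINT p:({0<..} \<times> {0..1})|lebesgue. \<phi>t p *\<^sub>R \<xi> (fst p) (snd p)) = - (LINT p:({0<..} \<times> {0..1})|lebesgue. \<phi> p *\<^sub>R w (fst p) (snd p))"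
      if "test_Q \<phi> \<phi>t \<phi>s" for \<phi> \<phi>t \<phi>s by (rule weak_time_derivative[OF wm wL2 wf that])
    show "L2loc_H1 \<sigma> sg" unfolding L2loc_H1_def
      using \<sigma>L2 sgL2 \<sigma> by (auto intro!: AE_completion elim: eventually_mono)
    show "L2loc_H1 (\<lambda>t s. \<sigma> t s *\<^sub>R v t s) (\<lambda>t s. w t s - \<xi> t s)" unfolding L2loc_H1_def
      using \<sigma>vL2 w\<xi>L2 \<sigma> by (auto intro!: AE_completion elim: eventually_mono)
    have "AE p in lebesgue. p \<in> {0<..} \<times> {0..1} \<longrightarrow> \<sigma> (fst p) (snd p) * ((norm (v (fst p) (snd p)))\<^sup>2 - 1) = 0"
    proof (rule AE_Q)
      show "AE t in lborel. 0 < t \<longrightarrow> (AE s in I01. \<sigma> (fst (t, s)) (snd (t, s)) * ((norm (v (fst (t, s)) (snd (t, s))))\<^sup>2 - 1) = 0)"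
        using \<sigma> by eventually_elim simp
    qed measurable
    with v1 show "AE p in lebesgue. p \<in> {0<..} \<times> {0..1} \<longrightarrow>
        w (fst p) (snd p) = w (fst p) (snd p) - \<xi> (fst p) (snd p) + \<xi> (fst p) (snd p) \<and>
        \<sigma> (fst p) (snd p) * ((norm (v (fst p) (snd p)))\<^sup>2 - 1) = 0 \<and> norm (v (fst p) (snd p)) \<le> 1"
      by eventually_elim simp
    show "AE s in lebesgue. s \<in> {0..1} \<longrightarrow> \<xi> 0 s = \<xi>0 s" using init by (simp add: \<xi>_def)
    show "((\<lambda>t. LINT s:{0..1}|lebesgue. (norm (\<xi> t s - \<xi> 0 s))\<^sup>2) \<longlongrightarrow> 0) (at_right 0)" by (rule initial_limit)
    show "AE t in lebesgue. 0 < t \<longrightarrow> (LINT s:{0..1}|lebesgue. (norm (w t s))\<^sup>2) \<le> (LINT s:{0..1}|lebesgue. \<xi> t s \<bullet> w t s)"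
    proof (rule AE_completion)
      have e: "(LINT s:{0..1}|lebesgue. (norm (w t s))\<^sup>2) = (\<integral>s. (norm (w t s))\<^sup>2 \<partial>I01)"
        "(LINT s:{0..1}|lebesgue. \<xi> t s \<bullet> w t s) = (\<integral>s. \<xi> t s \<bullet> w t s \<partial>I01)" for t
        by (rule set_integral_lebesgue_borel(1), measurable)+
      show "AE t in lborel. 0 < t \<longrightarrow> (LINT s:{0..1}|lebesgue. (norm (w t s))\<^sup>2) \<le> (LINT s:{0..1}|lebesgue. \<xi> t s \<bullet> w t s)"
        unfolding e using wt by eventually_elim (use tangent_bound(3)[OF ws] in auto)
    qed
  qed
  moreover have "AE p in lebesgue. p \<in> {0<..} \<times> {0..1} \<longrightarrow> \<sigma> (fst p) (snd p) \<ge> 0" using \<sigma>0 by simp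
  ultimately show ?thesis by blast
qed

theorem theorem3p24:
  fixes \<xi>0 :: "real \<Rightarrow> real ^ 'd"
  assumes "CARD('d) \<ge> 2"
    and "W1inf_S1 \<xi>0"
    and "\<exists>g. weak_deriv_S1 \<xi>0 g \<and> (AE s in lebesgue. s \<in> {0..1} \<longrightarrow> norm (g s) \<le> 1)"
  shows "\<exists>\<xi> \<sigma>. gen_solution \<xi>0 \<xi> \<sigma> \<and>
           (AE p in lebesgue. p \<in> {0<..} \<times> {0..1} \<longrightarrow> \<sigma> (fst p) (snd p) \<ge> 0)"
proof -
  obtain g where "weak_deriv_S1 \<xi>0 g" "AE s in lebesgue. s \<in> {0..1} \<longrightarrow> norm (g s) \<le> 1" using assms(3) by blast
  \<comment> \<open>The flow starts from the Lipschitz representative of the datum, which agrees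
    with it almost everywhere, as the initial condition demands.\<close>
  then obtain z where z: "z \<in> Lip1" "AE s in lebesgue. s \<in> {0..1} \<longrightarrow> ev z s = \<xi>0 s"
    by (rule lipschitz_representative)
  interpret constrained_flow Lip1 z
    by unfold_locales (rule Lip1_convex Lip1_complete Lip1_zero z)+
  from flow_exists obtain X where X: "X 0 = z" "\<forall>t\<ge>0. X t \<in> Lip1 \<and> norm (X t) \<le> exp t * norm z"
    "\<forall>a b. 0 \<le> a \<longrightarrow> a \<le> b \<longrightarrow> norm (X b - X a) \<le> (b - a) * (exp b * norm z)"
    "\<forall>a b. 0 \<le> a \<longrightarrow> a \<le> b \<longrightarrow> (\<forall>y\<in>Lip1. (norm (X b - y))\<^sup>2 - (norm (X a - y))\<^sup>2
        \<le> 2 * (b - a) * ((X a - y) \<bullet> X a) + 2 * (b - a) * (b - a) * ((exp b * norm z) * (2 * (exp b * norm z) + norm y)))"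
    "\<forall>a b. 0 \<le> a \<longrightarrow> a \<le> b \<longrightarrow> (norm (X b - X a))\<^sup>2 \<le> (b - a) * ((norm (X b))\<^sup>2 - (norm (X a))\<^sup>2) / 2"
    by (elim exE conjE)
  have "flow X (norm z)" by unfold_locales (use X(2-5) in blast)+
  then show ?thesis by (rule flow_gen_solution) (use z(2) X(1) in simp)
qed

end
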